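(* There exist positive numbers $c$ and $\epsilon_0$ and unit vectors $\hat{v}^{(1)},\dots,\hat{v}^{(9)}\in\mathbb{R}^3$ with the following property. Let $\hat{\mathcal{U}}$ be any single-qubit unitary channel and let $\epsilon\in(0,\epsilon_0]$. Let $\hat{\mathcal{U}}_1,\dots,\hat{\mathcal{U}}_9$ be single-qubit unitary channels satisfying $$\tfrac12\big[\mathcal{J}(\hat{\mathcal{U}}_j\circ\hat{\mathcal{U}}^{-1})\big]_{MB}=\hat e^{(j)}\hat e^{(j)T},\qquad \hat e^{(j)}=\begin{pmatrix}\sqrt{1-(c\epsilon)^2}\\ c\epsilon\,\hat v^{(j)}\end{pmatrix}\in\mathbb{R}^4,$$ and let $\mathcal{U}_1,\dots,\mathcal{U}_9$ be any single-qubit unitary channels with $\tfrac12\|\hat{\mathcal{U}}_j-\mathcal{U}_j\|_\diamond\le\epsilon$ for all $j$. Then there exists a probability distribution $(p_j)_{j=1}^9$ such that the remnant error $\mathcal{E}_{\rm rem}=\big(\sum_j p_j\mathcal{U}_j\big)\circ\hat{\mathcal{U}}^{-1}$ is a depolarizing channel, i.e. $\mathcal{E}_{\rm rem}(\rho)=(1-3q)\rho+q(X\rho X+Y\rho Y+Z\rho Z)$ for some $q\ge0$. Moreover, for the probability distribution $p$ that minimizes $\tfrac12\|\hat{\mathcal{U}}-\sum_j p_j\mathcal{U}_j\|_\diamond$ among all probability distributions on $\{1,\dots,9\}$ for which $\mathcal{E}_{\rm rem}$ is a depolarizing channel, $$((c-1)\epsilon)^2\le \tfrac12\Big\|\hat{\mathcal{U}}-\sum_{j=1}^9p_j\mathcal{U}_j\Big\|_\diamond\le((c+1)\epsilon)^2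 .$$
   Context: A single-qubit unitary channel is $\mathcal{U}(\rho)=U\rho U^\dagger$ with $U\in U(2)$. $\|\cdot\|_\diamond$ is the diamond norm. For a linear map $\Phi$ on $2\times2$ matrices, the Choi operator is $\mathcal{J}(\Phi)=(\mathrm{Id}\otimes\Phi)(|\Omega\rangle\langle\Omega|)$ with the unnormalized $|\Omega\rangle=|00\rangle+|11\rangle$. The magic basis is $|\Psi_1\rangle=\frac{1}{\sqrt2}(|00\rangle+|11\rangle)$, $|\Psi_2\rangle=\frac{i}{\sqrt2}(|00\rangle-|11\rangle)$, $|\Psi_3\rangle=\frac{i}{\sqrt2}(|01\rangle+|10\rangle)$, $|\Psi_4\rangle=\frac{1}{\sqrt2}(|01\rangle-|10\rangle)$, and $[A]_{MB}$ denotes the $4\times4$ matrix with entries $([A]_{MB})_{ij}=\langle\Psi_i|A|\Psi_j\rangle$. For every single-qubit unitary channel $\mathcal{U}$ one has $\tfrac12[\mathcal{J}(\mathcal{U})]_{MB}=rr^T$ for a real unit vector $r\in\mathbb{R}^4$. $X,Y,Z$ are the Pauli matrices. *)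

theory Defs
  imports Complex_Main "Jordan_Normal_Form.Matrix"
begin

text \<open>Complex matrices are Jordan_Normal_Form matrices of type complex mat with explicit dimensions.
  Index convention for a two-qubit space: basis vector |a i> has index 2*a + i (first factor = left).\<close>

definition adj :: "complex mat \<Rightarrow> complex mat" where
  "adj A = mat (dim_col A) (dim_row A) (\<lambda>(i,j). cnj (A $$ (j,i)))"

definition unitary2 :: "complex mat \<Rightarrow> bool" where
  "unitary2 U \<longleftrightarrow> U \<in> carrier_mat 2 2 \<and> U * adj U = 1\<^sub>m 2"

definition psd :: "nat \<Rightarrow> complex mat \<Rightarrow> bool" where
  "psd n P \<longleftrightarrow> P \<in> carrier_mat n n \<and> adj P = P \<and>
     (\<forall>v. 0 \<le> Re (\<Sum>i<n. \<Sum>j<n. cnj (v i) * P $$ (i,j) * v j))"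

definition msqrt :: "nat \<Rightarrow> complex mat \<Rightarrow> complex mat" where
  "msqrt n A = (THE P. psd n P \<and> P * P = A)"

definition mtrace :: "complex mat \<Rightarrow> complex" where
  "mtrace A = (\<Sum>i<dim_row A. A $$ (i,i))"

definition trace_norm :: "complex mat \<Rightarrow> real" where
  "trace_norm A = Re (mtrace (msqrt (dim_col A) (adj A * A)))"

text \<open>Single-qubit linear maps are modelled as functions on complex mat (applied to 2x2 matrices).\<close>
type_synonym qmap = "complex mat \<Rightarrow> complex mat"

definition block2 :: "complex mat \<Rightarrow> nat \<Rightarrow> nat \<Rightarrow> complex mat" where
  "block2 X a b = mat 2 2 (\<lambda>(i,k). X $$ (2*a + i, 2*b + k))"

definition id_tensor :: "qmap \<Rightarrow> complex mat \<Rightarrow> complex mat" where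
  "id_tensor \<Phi> X = mat 4 4 (\<lambda>(r,s). (\<Phi> (block2 X (r div 2) (s div 2))) $$ (r mod 2, s mod 2))"

text \<open>Diamond norm (ancilla of the same dimension 2 as the input).\<close>
definition diamond_norm :: "qmap \<Rightarrow> real" where
  "diamond_norm \<Phi> = Sup {trace_norm (id_tensor \<Phi> X) | X. X \<in> carrier_mat 4 4 \<and> trace_norm X \<le> 1}"

text \<open>|Omega><Omega| with unnormalized |Omega> = |00> + |11>.\<close>
definition Omega_proj :: "complex mat" where
  "Omega_proj = mat 4 4 (\<lambda>(r,s). if r \<in> {0,3} \<and> s \<in> {0,3} then 1 else 0)"

definition choi :: "qmap \<Rightarrow> complex mat" where
  "choi \<Phi> = id_tensor \<Phi> Omega_proj"

text \<open>Magic basis: psi k r is the r-th computational-basis component of Psi_k (k = 1..4).\<close>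
definition psi :: "nat \<Rightarrow> nat \<Rightarrow> complex" where
  "psi k r = (let s = 1 / complex_of_real (sqrt 2) in
     if k = 1 then (if r = 0 then s else if r = 3 then s else 0)
     else if k = 2 then (if r = 0 then \<i> * s else if r = 3 then - \<i> * s else 0)
     else if k = 3 then (if r = 1 then \<i> * s else if r = 2 then \<i> * s else 0)
     else (if r = 1 then s else if r = 2 then - s else 0))"

definition magic :: "complex mat \<Rightarrow> complex mat" where
  "magic A = mat 4 4 (\<lambda>(i,j). \<Sum>r<4. \<Sum>s<4. cnj (psi (i+1) r) * A $$ (r,s) * psi (j+1) s)"

definition unitary_channel :: "complex mat \<Rightarrow> qmap" where
  "unitary_channel U = (\<lambda>\<rho>. U * \<rho> * adj U)"

definition mix9 :: "(nat \<Rightarrow> real) \<Rightarrow> (nat \<Rightarrow> qmap) \<Rightarrow> qmap" where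
  "mix9 p \<Phi> = (\<lambda>\<rho>. mat 2 2 (\<lambda>(a,b). \<Sum>j\<in>{1..9}. complex_of_real (p j) * (\<Phi> j \<rho>) $$ (a,b)))"

definition prob9 :: "(nat \<Rightarrow> real) \<Rightarrow> bool" where
  "prob9 p \<longleftrightarrow> (\<forall>j\<in>{1..9}. 0 \<le> p j) \<and> (\<Sum>j\<in>{1..9}. p j) = 1"

definition pauliX :: "complex mat" where "pauliX = mat 2 2 (\<lambda>(i,j). if i \<noteq> j then 1 else 0)"
definition pauliY :: "complex mat" where
  "pauliY = mat 2 2 (\<lambda>(i,j). if i = 0 \<and> j = 1 then - \<i> else if i = 1 \<and> j = 0 then \<i> else 0)"
definition pauliZ :: "complex mat" where
  "pauliZ = mat 2 2 (\<lambda>(i,j). if i = j then (if i = 0 then 1 else -1) else 0)"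

definition depolarizing :: "qmap \<Rightarrow> bool" where
  "depolarizing E \<longleftrightarrow> (\<exists>q::real. q \<ge> 0 \<and> (\<forall>\<rho> \<in> carrier_mat 2 2.
     E \<rho> = complex_of_real (1 - 3*q) \<cdot>\<^sub>m \<rho> + complex_of_real q \<cdot>\<^sub>m
        (pauliX * \<rho> * pauliX + pauliY * \<rho> * pauliY + pauliZ * \<rho> * pauliZ)))"

definition map_diff :: "qmap \<Rightarrow> qmap \<Rightarrow> qmap" where
  "map_diff \<Phi> \<Psi> = (\<lambda>\<rho>. \<Phi> \<rho> - \<Psi> \<rho>)"

end

(*
  Relative to the target, every channel is a unit quaternion r in R^4, and a mixture of the channels is
  depolarizing iff the weighted sum of r r^T is diag(1 - 3q, q, q, q). Up to scaling this says that the
  weighted harmonic polynomials of degree 1 and 2 of the imaginary parts cancel: 8 homogeneous linear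
  conditions on 9 weights. For the exact frame they have a strictly positive solution and the frame
  determines such a polynomial, so by separation 0 stays in the convex hull of the 9 points of R^8
  under perturbations of relative size 1/c, once c is large. The diamond distance to a
  depolarizing mixture is 6q = 2 sum_j p_j (1 - (r_j)_0^2), and (1 - (r_j)_0^2)^(1/2) is the
  sine distance of r_j from the identity, which by the triangle inequality lies between
  (c - 1) epsilon and (c + 1) epsilon. Diamond norms are bounded through the duality between the trace
  norm and contractions.
*)
theory Submission
  imports Defs "Jordan_Normal_Form.Schur_Decomposition" "HOL-Analysis.Convex_Euclidean_Space"
begin

hide_const (open) Finite_Cartesian_Product.mat Finite_Cartesian_Product.vec
no_notation Finite_Cartesian_Product.vec_nth (infixl "$" 90)
(* without this, c*\<epsilon>*v is read as an application of the infix operator *v *)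
no_notation Finite_Cartesian_Product.matrix_vector_mult (infixl "*v" 70)

section \<open>The trace norm\<close>

text \<open>\<open>trace_norm\<close> hides a definite description and \<open>diamond_norm\<close> a
  supremum, so neither can be evaluated by unfolding. Duality serves in both directions: a
  combination of unitary conjugations has diamond norm at most the sum of the absolute coefficients,
  and a single test input with a single reflection bounds it from below. No constant may be lost
  there, since the statement has exactly (c - 1) epsilon and (c + 1) epsilon: half the diamond
  distance of two unitary channels must dominate the full sine of the angle between their
  quaternions, and for a depolarizing mixture the two bounds must meet. Nine is 8 + 1: the frame
  gives a simplex in R^8 with 0 in its interior. Quantitatively, a polynomial that is at least -mu
  on the frame has coefficients at most 39 mu in modulus. Dividing the imaginary parts by c epsilon
  makes the errors of order 1/c whatever epsilon is, so c is chosen first; epsilon_0 serves to keep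
  the real parts near 1 and the angles small. A Choi matrix determines a quaternion only up to sign;
  the sign is chosen so that the overlap with the intended quaternion is nonnegative.\<close>

lemma adj_carrier [simp]: "A \<in> carrier_mat n m \<Longrightarrow> adj A \<in> carrier_mat m n"
  by (simp add: adj_def)

lemma adj_index: "A \<in> carrier_mat n m \<Longrightarrow> i < m \<Longrightarrow> j < n \<Longrightarrow> adj A $$ (i,j) = cnj (A $$ (j,i))"
  by (auto simp: adj_def)

lemma mult_index:
  assumes "A \<in> carrier_mat n m" "B \<in> carrier_mat m k" "i < n" "j < k"
  shows "(A * B) $$ (i,j) = (\<Sum>l<m. A $$ (i,l) * B $$ (l,j))"
  using assms by (auto simp: scalar_prod_def lessThan_atLeast0)

lemma adj_adj [simp]: "adj (adj A) = A"
  by (rule eq_matI) (auto simp: adj_def)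

lemma adj_mult:
  assumes "A \<in> carrier_mat n m" "B \<in> carrier_mat m k"
  shows "adj (A * B) = adj B * adj A"
proof (rule eq_matI)
  fix i j assume "i < dim_row (adj B * adj A)" "j < dim_col (adj B * adj A)"
  then have "i < k" "j < n" using assms by (auto simp: adj_def)
  then show "adj (A * B) $$ (i,j) = (adj B * adj A) $$ (i,j)"
    using assms
    by (subst adj_index[of _ n k]) (auto simp: mult_index[of _ n m _ k] mult_index[of _ k m _ n] adj_index[of _ n m] adj_index[of _ m k]
        mult.commute simp del: index_mult_mat intro!: sum.cong)
qed (use assms in \<open>auto simp: adj_def\<close>)

lemma adj_dim [simp]: "dim_row (adj A) = dim_col A" "dim_col (adj A) = dim_row A"
  by (auto simp: adj_def)

lemma adj_mult_dim: "dim_col A = dim_row B \<Longrightarrow> adj (A * B) = adj B * adj A"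
  by (rule adj_mult) auto

lemma mult_assoc_dim: "dim_col A = dim_row B \<Longrightarrow> dim_col B = dim_row C \<Longrightarrow> A * B * C = A * (B * (C :: complex mat))"
  by (rule assoc_mult_mat) auto

lemma carrier_dims: "A \<in> carrier_mat n m \<Longrightarrow> dim_row A = n \<and> dim_col A = m"
  by auto

lemmas mat_algebra = adj_mult_dim mult_assoc_dim left_mult_one_mat' right_mult_one_mat'

lemma adj_one [simp]: "adj (1\<^sub>m n) = 1\<^sub>m n"
  by (rule eq_matI) (auto simp: adj_def)

lemma mtrace_comm:
  assumes "A \<in> carrier_mat n m" "B \<in> carrier_mat m n"
  shows "mtrace (A * B) = mtrace (B * A)"
proof -
  have "mtrace (A * B) = (\<Sum>i<n. \<Sum>l<m. A $$ (i,l) * B $$ (l,i))"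
    unfolding mtrace_def using assms by (auto simp: mult_index[OF assms] simp del: index_mult_mat(1) intro!: sum.cong)
  also have "\<dots> = (\<Sum>l<m. \<Sum>i<n. B $$ (l,i) * A $$ (i,l))"
    by (subst sum.swap) (simp add: mult.commute)
  also have "\<dots> = mtrace (B * A)"
    unfolding mtrace_def using assms by (auto simp: mult_index[OF assms(2,1)] simp del: index_mult_mat(1) intro!: sum.cong)
  finally show ?thesis .
qed

lemma left_unitary_imp_right:
  assumes "P \<in> carrier_mat n n" "adj P * P = 1\<^sub>m n"
  shows "P * adj P = 1\<^sub>m n"
  using mat_mult_left_right_inverse[of "adj P" n P] assms by simp

section \<open>Spectral theorem for Hermitian matrices\<close>

text \<open>Gram-Schmidt keeps its first vector: completing \<open>v\<close> to a basis,
  orthogonalizing and dividing every column by its length yields a unitary matrix whose first column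
  is a multiple of \<open>v\<close>. It provides the deflation step below.\<close>

lemma unitary_first_column:
  assumes v: "v \<in> carrier_vec n" "v \<noteq> 0\<^sub>v n" and n: "n \<noteq> 0"
  shows "\<exists>W c. W \<in> carrier_mat n n \<and> adj W * W = 1\<^sub>m n \<and> (\<forall>i<n. W $$ (i,0) = c * v $ i)"
proof -
  interpret cof_vec_space n "TYPE(complex)" .
  define b where "b = basis_completion v"
  define ws where "ws = gram_schmidt n b"
  from basis_completion[OF v, folded b_def]
  have dist_b: "distinct b" and indep: "\<not> lin_dep (set b)" and b: "set b \<subseteq> carrier_vec n"
    and hdb: "hd b = v" and len_b: "length b = n" by auto
  from hdb len_b n obtain vs where bv: "b = v # vs" by (cases b, auto)
  from gram_schmidt_result[OF b dist_b indep refl, folded ws_def]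
  have ws: "set ws \<subseteq> carrier_vec n" "corthogonal ws" "length ws = n" by (auto simp: len_b)
  from gram_schmidt_hd[OF v(1), of vs, folded bv] have hdws: "hd ws = v" unfolding ws_def .
  have ws0: "ws ! 0 = v" using hdws ws(3) n hd_conv_nth[of ws] by auto
  have wsc: "ws ! i \<in> carrier_vec n" if "i < n" for i using ws that by auto
  define N where "N i = sqrt (\<Sum>k<n. (cmod (ws ! i $ k))\<^sup>2)" for i
  have ip: "ws ! j \<bullet>c ws ! i = (\<Sum>k<n. cnj (ws ! i $ k) * ws ! j $ k)" if "i < n" "j < n" for i j
    using wsc[OF that(1)] wsc[OF that(2)]
    by (auto simp: scalar_prod_def lessThan_atLeast0 mult.commute intro!: sum.cong)
  have ip0: "(\<Sum>k<n. cnj (ws ! i $ k) * ws ! j $ k) = 0" if "i < n" "j < n" "i \<noteq> j" for i j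
    using corthogonalD[OF ws(2), of j i] ws(3) that ip[of i j] by auto
  have ipN: "(\<Sum>k<n. cnj (ws ! i $ k) * ws ! i $ k) = complex_of_real ((N i)\<^sup>2)" for i
  proof -
    have "(\<Sum>k<n. cnj (ws ! i $ k) * ws ! i $ k) = complex_of_real (\<Sum>k<n. (cmod (ws ! i $ k))\<^sup>2)"
      unfolding of_real_sum by (intro sum.cong refl) (simp add: complex_norm_square mult.commute del: of_real_power)
    then show ?thesis unfolding N_def by (simp add: sum_nonneg del: of_real_sum of_real_power)
  qed
  have N0: "N i \<noteq> 0" if "i < n" for i
    using corthogonalD[OF ws(2), of i i] ws(3) that ip[of i i] ipN[of i] by auto
  define W where "W = mat n n (\<lambda>(i,j). ws ! j $ i / complex_of_real (N j))"
  have W: "W \<in> carrier_mat n n" by (simp add: W_def)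
  have "adj W * W = 1\<^sub>m n"
  proof (rule eq_matI)
    fix i j assume "i < dim_row (1\<^sub>m n)" "j < dim_col (1\<^sub>m n)"
    then have ij: "i < n" "j < n" by auto
    have "(adj W * W) $$ (i,j) = (\<Sum>k<n. cnj (ws ! i $ k) * ws ! j $ k) / (N i * N j)"
      using ij W by (subst mult_index[of _ n n _ n]) (auto simp: adj_index[OF W] sum_divide_distrib intro!: sum.cong, simp add: W_def)
    also have "\<dots> = (1\<^sub>m n) $$ (i,j)"
      using ij N0[of i] by (cases "i = j") (auto simp: ip0 ipN power2_eq_square simp del: of_real_power)
    finally show "(adj W * W) $$ (i,j) = (1\<^sub>m n) $$ (i,j)" .
  qed (use W in auto)
  moreover have "\<forall>i<n. W $$ (i,0) = (1 / complex_of_real (N 0)) * v $ i"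
    using n ws0 by (auto simp: W_def)
  ultimately show ?thesis using W by blast
qed

text \<open>Deflation: in an orthonormal basis starting with an eigenvector the first column is (e,
  0, ..., 0). Hermiticity gives the same first row and makes e real, and the remaining m x m block
  is again Hermitian.\<close>

lemma hermitian_diagonalization:
  assumes "A \<in> carrier_mat n n" "adj A = A"
  shows "\<exists>P d. P \<in> carrier_mat n n \<and> adj P * P = 1\<^sub>m n \<and>
    adj P * A * P = mat n n (\<lambda>(i,j). if i = j then complex_of_real (d i) else 0)"
  using assms
proof (induction n arbitrary: A)
  case 0
  show ?case by (intro exI[of _ "1\<^sub>m 0"]) (auto intro!: eq_matI)
next
  case (Suc m A)
  let ?n = "Suc m"
  note A = Suc.prems(1)
  from char_poly_factorized[OF A] obtain as where "char_poly A = (\<Prod>a\<leftarrow>as. [:- a, 1:])" "length as = ?n" by auto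
  then obtain e where "poly (char_poly A) e = 0" by (cases as) auto
  then have "eigenvalue A e" using eigenvalue_root_char_poly[OF A] by simp
  then obtain v where v: "v \<in> carrier_vec ?n" "v \<noteq> 0\<^sub>v ?n" and ev: "A *\<^sub>v v = e \<cdot>\<^sub>v v"
    using A unfolding eigenvalue_def eigenvector_def by auto
  from unitary_first_column[OF v] obtain W c where W: "W \<in> carrier_mat ?n ?n" "adj W * W = 1\<^sub>m ?n"
    and Wv: "\<And>i. i < ?n \<Longrightarrow> W $$ (i,0) = c * v $ i" by auto
  have evi: "(\<Sum>l<?n. A $$ (k,l) * v $ l) = e * v $ k" if "k < ?n" for k
    using arg_cong[OF ev, of "\<lambda>w. w $ k"] that A v by (simp add: scalar_prod_def lessThan_atLeast0)
  define B where "B = adj W * A * W"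
  have B: "B \<in> carrier_mat ?n ?n" unfolding B_def using A W(1) by (intro mult_carrier_mat adj_carrier)
  have hB: "adj B = B" unfolding B_def using A W Suc.prems(2)
    by (auto dest!: carrier_dims simp: mat_algebra simp del: assoc_mult_mat)
  have AW0: "(A * W) $$ (k,0) = e * W $$ (k,0)" if "k < ?n" for k
  proof -
    have "(A * W) $$ (k,0) = (\<Sum>l<?n. A $$ (k,l) * v $ l) * c"
      unfolding sum_distrib_right using that A W by (subst mult_index[of _ ?n ?n _ ?n]) (auto simp: Wv intro!: sum.cong)
    then show ?thesis using evi[OF that] Wv[OF that] by simp
  qed
  have B0: "B $$ (i,0) = (if i = 0 then e else 0)" if "i < ?n" for i
  proof -
    have "B $$ (i,0) = (adj W * (A * W)) $$ (i,0)" unfolding B_def using A W by (auto dest!: carrier_dims simp: mat_algebra simp del: assoc_mult_mat)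
    also have "\<dots> = (\<Sum>l<?n. adj W $$ (i,l) * W $$ (l,0)) * e"
      unfolding sum_distrib_right using that A W
      by (subst mult_index[of _ ?n ?n _ ?n]) (auto simp: AW0 simp del: index_mult_mat(1) intro!: sum.cong)
    also have "(\<Sum>l<?n. adj W $$ (i,l) * W $$ (l,0)) = (adj W * W) $$ (i,0)"
      using that W by (subst mult_index[of _ ?n ?n _ ?n]) auto
    finally show ?thesis using that W(2) by simp
  qed
  have Bh: "B $$ (i,j) = cnj (B $$ (j,i))" if "i < ?n" "j < ?n" for i j
    using adj_index[OF B, of i j] that hB by simp
  have e_real: "e = complex_of_real (Re e)" using Bh[of 0 0] B0[of 0] by (simp add: complex_eq_iff)
  have B0': "B $$ (0,i) = (if i = 0 then e else 0)" if "i < ?n" for i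
    using Bh[of 0 i] B0[OF that] that e_real by (cases "i = 0") (auto simp: B0)
  define A3 where "A3 = mat m m (\<lambda>(i,j). B $$ (Suc i, Suc j))"
  have A3: "A3 \<in> carrier_mat m m" by (simp add: A3_def)
  have "adj A3 = A3"
    by (rule eq_matI) (auto simp: A3_def adj_def intro: Bh[symmetric])
  from Suc.IH[OF A3 this] obtain P' d' where P': "P' \<in> carrier_mat m m" "adj P' * P' = 1\<^sub>m m"
    and D': "adj P' * A3 * P' = mat m m (\<lambda>(i,j). if i = j then complex_of_real (d' i) else 0)" by blast
  \<comment> \<open>The direct sum of the 1 x 1 identity and \<open>P'\<close>;
    \<open>W * P''\<close> will diagonalize \<open>A\<close>.\<close>
  define P'' where "P'' = mat ?n ?n (\<lambda>(i,j). if i = 0 \<or> j = 0 then (if i = j then 1 else 0) else P' $$ (i-1,j-1))"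
  have P'': "P'' \<in> carrier_mat ?n ?n" by (simp add: P''_def)
  have P''i: "P'' $$ (0,0) = 1" "\<And>i. i < m \<Longrightarrow> P'' $$ (Suc i,0) = 0" "\<And>i. i < m \<Longrightarrow> P'' $$ (0,Suc i) = 0"
    "\<And>i j. i < m \<Longrightarrow> j < m \<Longrightarrow> P'' $$ (Suc i,Suc j) = P' $$ (i,j)" by (auto simp: P''_def)
  note sums = sum.lessThan_Suc_shift
  have U'': "adj P'' * P'' = 1\<^sub>m ?n"
  proof (rule eq_matI)
    fix i j assume "i < dim_row (1\<^sub>m ?n)" "j < dim_col (1\<^sub>m ?n)"
    then have ij: "i < ?n" "j < ?n" by auto
    have *: "(\<Sum>l<m. cnj (P' $$ (l,a)) * P' $$ (l,b)) = (if a = b then 1 else 0)" if "a < m" "b < m" for a b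
    proof -
      have "(\<Sum>l<m. cnj (P' $$ (l,a)) * P' $$ (l,b)) = (adj P' * P') $$ (a,b)"
        using that P'(1) by (subst mult_index[of _ m m _ m]) (auto simp: adj_index[OF P'(1)] intro!: sum.cong)
      then show ?thesis using P'(2) that by simp
    qed
    have "(adj P'' * P'') $$ (i,j) = (\<Sum>l<?n. cnj (P'' $$ (l,i)) * P'' $$ (l,j))"
      using ij P'' by (subst mult_index[of _ ?n ?n _ ?n]) (auto simp: adj_index[OF P''] intro!: sum.cong)
    also have "\<dots> = (if i = j then 1 else 0)"
      using ij by (cases i; cases j) (auto simp: sums P''i * simp del: sum.lessThan_Suc)
    finally show "(adj P'' * P'') $$ (i,j) = (1\<^sub>m ?n) $$ (i,j)" using ij by simp
  qed (use P'' in auto)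
  define d where "d i = (if i = 0 then Re e else d' (i - 1))" for i
  have D'': "adj P'' * B * P'' = mat ?n ?n (\<lambda>(i,j). if i = j then complex_of_real (d i) else 0)" (is "_ = ?D")
  proof (rule eq_matI)
    fix i j assume "i < dim_row ?D" "j < dim_col ?D"
    then have ij: "i < ?n" "j < ?n" by auto
    have *: "(\<Sum>k<m. (\<Sum>l<m. cnj (P' $$ (l,a)) * B $$ (Suc l, Suc k)) * P' $$ (k,b)) = (if a = b then complex_of_real (d' a) else 0)"
      if "a < m" "b < m" for a b
    proof -
      have "(adj P' * A3 * P') $$ (a,b) = (\<Sum>k<m. (adj P' * A3) $$ (a,k) * P' $$ (k,b))"
        using that P'(1) A3 by (subst mult_index[of _ m m _ m]) auto
      also have "\<dots> = (\<Sum>k<m. (\<Sum>l<m. cnj (P' $$ (l,a)) * B $$ (Suc l, Suc k)) * P' $$ (k,b))"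
        using that P'(1) A3 by (intro sum.cong refl, subst mult_index[of _ m m _ m]) (auto simp: adj_index[OF P'(1)] A3_def intro!: sum.cong)
      finally show ?thesis using D' that by simp
    qed
    have "(adj P'' * B * P'') $$ (i,j) = (\<Sum>k<?n. (adj P'' * B) $$ (i,k) * P'' $$ (k,j))"
      using ij P'' B by (subst mult_index[of _ ?n ?n _ ?n]) auto
    also have "\<dots> = (\<Sum>k<?n. (\<Sum>l<?n. cnj (P'' $$ (l,i)) * B $$ (l,k)) * P'' $$ (k,j))"
      using ij P'' B by (intro sum.cong refl, subst mult_index[of _ ?n ?n _ ?n]) (auto simp: adj_index[OF P''] intro!: sum.cong)
    also have "\<dots> = (if i = j then complex_of_real (d i) else 0)"
      using ij e_real by (cases i; cases j) (auto simp: sums P''i * B0 B0' d_def simp del: sum.lessThan_Suc)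
    finally show "(adj P'' * B * P'') $$ (i,j) = ?D $$ (i,j)" using ij by simp
  qed (use P'' B in auto)
  have 1: "adj (W * P'') * (W * P'') = adj P'' * (adj W * W) * P''"
    using W(1) P'' by (auto dest!: carrier_dims simp: mat_algebra simp del: assoc_mult_mat)
  have 2: "adj (W * P'') * A * (W * P'') = adj P'' * B * P''"
    unfolding B_def using W(1) P'' A by (auto dest!: carrier_dims simp: mat_algebra simp del: assoc_mult_mat)
  have "W * P'' \<in> carrier_mat ?n ?n" using W(1) P'' by simp
  moreover have "adj (W * P'') * (W * P'') = 1\<^sub>m ?n" unfolding 1 W(2) using U'' P'' by simp
  ultimately show ?case using 2 D'' by (metis (no_types, lifting))
qed

section \<open>Inner products and contractions\<close>

text \<open>The squared length. Vectors are matrices with one column, so that inner products and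
  channels share one matrix algebra; a scalar is the entry (0,0) of a 1 x 1 matrix.\<close>

definition nrm2 :: "complex mat \<Rightarrow> real" where
  "nrm2 X = Re ((adj X * X) $$ (0,0))"

lemma inner_index:
  assumes "X \<in> carrier_mat n 1" "Y \<in> carrier_mat n 1"
  shows "(adj X * Y) $$ (0,0) = (\<Sum>i<n. cnj (X $$ (i,0)) * Y $$ (i,0))"
  using assms by (subst mult_index[of _ 1 n _ 1]) (auto simp: adj_index[of _ n 1] intro!: sum.cong)

lemma inner_self:
  assumes "X \<in> carrier_mat n 1"
  shows "(adj X * X) $$ (0,0) = complex_of_real (nrm2 X)"
    and nrm2_sum: "nrm2 X = (\<Sum>i<n. (cmod (X $$ (i,0)))\<^sup>2)"
proof -
  have *: "(adj X * X) $$ (0,0) = complex_of_real (\<Sum>i<n. (cmod (X $$ (i,0)))\<^sup>2)"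
    unfolding inner_index[OF assms assms] of_real_sum
    by (intro sum.cong refl) (simp add: complex_norm_square mult.commute del: of_real_power)
  then show "nrm2 X = (\<Sum>i<n. (cmod (X $$ (i,0)))\<^sup>2)" unfolding nrm2_def by simp
  with * show "(adj X * X) $$ (0,0) = complex_of_real (nrm2 X)" by simp
qed

lemma nrm2_nonneg: "X \<in> carrier_mat n 1 \<Longrightarrow> 0 \<le> nrm2 X"
  by (simp add: nrm2_sum sum_nonneg)

lemma inner_Cauchy_Schwarz:
  assumes "X \<in> carrier_mat n 1" "Y \<in> carrier_mat n 1"
  shows "(cmod ((adj X * Y) $$ (0,0)))\<^sup>2 \<le> nrm2 X * nrm2 Y"
proof -
  have "cmod ((adj X * Y) $$ (0,0)) \<le> (\<Sum>i<n. cmod (X $$ (i,0)) * cmod (Y $$ (i,0)))"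
    unfolding inner_index[OF assms] by (rule order_trans[OF norm_sum]) (simp add: norm_mult)
  then have "(cmod ((adj X * Y) $$ (0,0)))\<^sup>2 \<le> (\<Sum>i<n. cmod (X $$ (i,0)) * cmod (Y $$ (i,0)))\<^sup>2"
    by (intro power_mono) auto
  also have "\<dots> \<le> nrm2 X * nrm2 Y"
    unfolding nrm2_sum[OF assms(1)] nrm2_sum[OF assms(2)] by (rule Cauchy_Schwarz_ineq_sum)
  finally show ?thesis .
qed

lemma nrm2_mult:
  assumes "C \<in> carrier_mat n n" "X \<in> carrier_mat n 1"
  shows "nrm2 (C * X) = Re ((adj X * (adj C * C) * X) $$ (0,0))"
  unfolding nrm2_def using assms
  by (auto dest!: carrier_dims simp: mat_algebra simp del: assoc_mult_mat)

lemma nrm2_unitary: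
  assumes "C \<in> carrier_mat n n" "adj C * C = 1\<^sub>m n" "X \<in> carrier_mat n 1"
  shows "nrm2 (C * X) = nrm2 X"
proof -
  have "nrm2 (C * X) = Re ((adj X * 1\<^sub>m n * X) $$ (0,0))" using nrm2_mult[OF assms(1,3)] assms(2) by simp
  then show ?thesis unfolding nrm2_def right_mult_one_mat[OF adj_carrier[OF assms(3)]] .
qed

text \<open>Operator norm at most 1, phrased through sesquilinear forms and squared to avoid roots:
  the unit ball dual to the trace norm.\<close>

definition contractive :: "nat \<Rightarrow> complex mat \<Rightarrow> bool" where
  "contractive n B \<longleftrightarrow> B \<in> carrier_mat n n \<and>
     (\<forall>X \<in> carrier_mat n 1. \<forall>Y \<in> carrier_mat n 1. (cmod ((adj X * B * Y) $$ (0,0)))\<^sup>2 \<le> nrm2 X * nrm2 Y)"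

text \<open>Cyclicity of the trace moves the unitaries of a channel from the state to the dual
  operator; this keeps that operator in the dual unit ball.\<close>

lemma contractive_conj:
  assumes "contractive n B" "C \<in> carrier_mat n n" "adj C * C = 1\<^sub>m n"
  shows "contractive n (adj C * B * C)"
  unfolding contractive_def
proof (intro conjI ballI)
  have B: "B \<in> carrier_mat n n" using assms(1) by (simp add: contractive_def)
  show "adj C * B * C \<in> carrier_mat n n" using B assms(2) by (intro mult_carrier_mat adj_carrier)
  fix X Y :: "complex mat" assume X: "X \<in> carrier_mat n 1" and Y: "Y \<in> carrier_mat n 1"
  have "adj X * (adj C * B * C) * Y = adj (C * X) * B * (C * Y)"
    using X Y B assms(2)
    by (auto dest!: carrier_dims simp: mat_algebra simp del: assoc_mult_mat)
  moreover have "C * X \<in> carrier_mat n 1" "C * Y \<in> carrier_mat n 1" using X Y assms(2) by auto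
  ultimately show "(cmod ((adj X * (adj C * B * C) * Y) $$ (0,0)))\<^sup>2 \<le> nrm2 X * nrm2 Y"
    using assms(1) nrm2_unitary[OF assms(2,3)] X Y unfolding contractive_def by metis
qed

section \<open>Positive square roots\<close>

lemma mult_diag_index:
  assumes "P \<in> carrier_mat n n" "i < n" "j < n"
  shows "(P * mat n n (\<lambda>(i,j). if i = j then d i else (0::complex))) $$ (i,j) = P $$ (i,j) * d j"
proof -
  have "(P * mat n n (\<lambda>(i,j). if i = j then d i else (0::complex))) $$ (i,j)
     = (\<Sum>l<n. P $$ (i,l) * (if l = j then d l else 0))"
    using assms by (subst mult_index[of _ n n _ n]) (auto intro!: sum.cong)
  also have "\<dots> = (\<Sum>l<n. if l = j then P $$ (i,l) * d l else 0)" by (intro sum.cong) auto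
  finally show ?thesis using assms by simp
qed

lemma psd_quadratic:
  assumes "psd n P"
  shows "0 \<le> Re (\<Sum>k<n. cnj (v k) * (\<Sum>l<n. P $$ (k,l) * v l))"
  using assms unfolding psd_def by (simp add: sum_distrib_left mult.assoc)

text \<open>If R (R x) = s^2 x, then y = R x - s x satisfies R y = - s y, so positivity of R forces y = 0
  when s > 0; the case s = 0 uses |R x|^2 = 0 instead.\<close>
lemma psd_sqrt_unique:
  assumes P: "P \<in> carrier_mat n n" "adj P * P = 1\<^sub>m n"
    and S: "S = mat n n (\<lambda>(i,j). if i = j then complex_of_real (s i) else 0)" and s: "\<And>i. i < n \<Longrightarrow> 0 \<le> s i"
    and R: "psd n R" and RR: "R * R = P * (S * S) * adj P"
  shows "R = P * S * adj P"
proof -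
  have Rc: "R \<in> carrier_mat n n" "adj R = R" using R by (auto simp: psd_def)
  have Sc: "S \<in> carrier_mat n n" by (simp add: S)
  note PP = left_unitary_imp_right[OF P]
  \<comment> \<open>Column i of \<open>W\<close> is the vector y of the remark above, for x the i-th
    column of \<open>P\<close> and s = \<open>s i\<close>.\<close>
  define W where "W = R * P - P * S"
  have RP: "R * P \<in> carrier_mat n n" and PS: "P * S \<in> carrier_mat n n" using Rc P Sc by auto
  have W: "W \<in> carrier_mat n n" unfolding W_def using PS by (rule minus_carrier_mat)
  have RRP: "R * (R * P) = P * S * S"
  proof -
    have "R * (R * P) = (P * (S * S) * adj P) * P" unfolding RR[symmetric] using Rc P(1) by (auto dest!: carrier_dims simp: mat_algebra simp del: assoc_mult_mat)
    also have "\<dots> = P * (S * S) * (adj P * P)" using P(1) Sc by (auto dest!: carrier_dims simp: mat_algebra simp del: assoc_mult_mat)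
    also have "\<dots> = P * S * S" using P Sc by (auto dest!: carrier_dims simp: mat_algebra simp del: assoc_mult_mat)
    finally show ?thesis .
  qed
  have RW: "R * W = - (W * S)"
  proof -
    have "R * W = P * S * S - R * (P * S)"
      unfolding W_def using Rc RP PS by (simp add: mult_minus_distrib_mat[of _ n n _ n] RRP)
    also have "\<dots> = - (W * S)"
      unfolding W_def using RP PS Sc Rc P by (subst minus_mult_distrib_mat[of _ n n _ _ n]) (auto simp: mult_assoc_dim)
    finally show ?thesis .
  qed
  have RWi: "(\<Sum>l<n. R $$ (k,l) * W $$ (l,i)) = - complex_of_real (s i) * W $$ (k,i)" if "k < n" "i < n" for k i
  proof -
    have "(\<Sum>l<n. R $$ (k,l) * W $$ (l,i)) = (R * W) $$ (k,i)" using that Rc W by (simp add: mult_index[of _ n n _ n] del: index_mult_mat(1))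
    also have "\<dots> = - (W * S) $$ (k,i)" unfolding RW using that W Sc by simp
    also have "\<dots> = - (W $$ (k,i) * complex_of_real (s i))" unfolding S using mult_diag_index[OF W that] by simp
    finally show ?thesis by simp
  qed
  have W0: "W $$ (k,i) = 0" if k: "k < n" and i: "i < n" for k i
  proof -
    have sq: "(\<Sum>k<n. cnj (W $$ (k,i)) * W $$ (k,i)) = complex_of_real (\<Sum>k<n. (cmod (W $$ (k,i)))\<^sup>2)"
      unfolding of_real_sum by (intro sum.cong refl) (simp add: complex_norm_square mult.commute del: of_real_power)
    have "(\<Sum>k<n. (cmod (W $$ (k,i)))\<^sup>2) \<le> 0"
    proof (cases "s i = 0")
      case True
      have Wi: "W $$ (l,i) = (R * P) $$ (l,i)" if "l < n" for l
      proof -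
        have "(P * S) $$ (l,i) = 0" unfolding S using mult_diag_index[OF P(1) that i] True by simp
        then show ?thesis unfolding W_def using that i RP PS P Sc by (simp del: index_mult_mat(1))
      qed
      \<comment> \<open>Here column i of \<open>W\<close> is R x, and <R x, R x> = <x, R (R x)> =
        0.\<close>
      have "(\<Sum>k<n. cnj (W $$ (k,i)) * W $$ (k,i)) = (\<Sum>k<n. adj (R * P) $$ (i,k) * W $$ (k,i))"
        using i by (intro sum.cong refl) (simp add: adj_index[OF RP] Wi del: index_mult_mat(1))
      also have "\<dots> = (adj (R * P) * W) $$ (i,i)" using i RP W by (simp add: mult_index[of _ n n _ n] del: index_mult_mat(1))
      also have "adj (R * P) * W = adj P * (R * W)" using Rc P W by (auto dest!: carrier_dims simp: mat_algebra simp del: assoc_mult_mat)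
      also have "(adj P * (R * W)) $$ (i,i) = (\<Sum>k<n. adj P $$ (i,k) * (R * W) $$ (k,i))"
        using i P Rc W by (subst mult_index[of _ n n _ n]) auto
      also have "\<dots> = 0"
      proof (intro sum.neutral ballI)
        fix k assume "k \<in> {..<n}"
        then show "adj P $$ (i,k) * (R * W) $$ (k,i) = 0"
          using RWi[of k i] i Rc W True by (simp add: mult_index[of _ n n _ n] del: index_mult_mat(1))
      qed
      finally have "complex_of_real (\<Sum>k<n. (cmod (W $$ (k,i)))\<^sup>2) = 0" using sq by simp
      then have "(\<Sum>k<n. (cmod (W $$ (k,i)))\<^sup>2) = 0" by (simp only: of_real_eq_0_iff)
      then show ?thesis by simp
    next
      case False
      have "(\<Sum>k<n. cnj (W $$ (k,i)) * (\<Sum>l<n. R $$ (k,l) * W $$ (l,i)))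
         = - complex_of_real (s i) * (\<Sum>k<n. cnj (W $$ (k,i)) * W $$ (k,i))"
        using i by (subst sum_distrib_left) (intro sum.cong refl, simp add: RWi)
      then have "0 \<le> Re (- complex_of_real (s i) * complex_of_real (\<Sum>k<n. (cmod (W $$ (k,i)))\<^sup>2))"
        using psd_quadratic[OF R, of "\<lambda>k. W $$ (k,i)"] sq by simp
      then have "s i * (\<Sum>k<n. (cmod (W $$ (k,i)))\<^sup>2) \<le> 0" by simp
      then show ?thesis using s[OF i] False by (simp add: mult_le_0_iff)
    qed
    moreover have "(cmod (W $$ (k,i)))\<^sup>2 \<le> (\<Sum>k<n. (cmod (W $$ (k,i)))\<^sup>2)"
      using k by (intro member_le_sum) auto
    ultimately have "(cmod (W $$ (k,i)))\<^sup>2 \<le> 0" by linarith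
    then show ?thesis by simp
  qed
  have "R * P = P * S"
  proof (rule eq_matI)
    fix i j assume "i < dim_row (P * S)" "j < dim_col (P * S)"
    then have "i < n" "j < n" using P Sc by auto
    then show "(R * P) $$ (i,j) = (P * S) $$ (i,j)"
      using W0[of i j] RP PS P Sc Rc by (simp add: W_def del: index_mult_mat(1))
  qed (use P Sc Rc in auto)
  then have "R * P * adj P = P * S * adj P" by simp
  moreover have "R * P * adj P = R" using P(1) PP Rc by (auto dest!: carrier_dims simp: mat_algebra simp del: assoc_mult_mat)
  ultimately show ?thesis by simp
qed

text \<open>With z = \<open>adj P\<close> applied to v, the quadratic form is the sum of the
  \<open>s l\<close> |z_l|^2.\<close>

lemma psd_diag_conj:
  assumes P: "P \<in> carrier_mat n n"
    and S: "S = mat n n (\<lambda>(i,j). if i = j then complex_of_real (s i) else 0)" and s: "\<And>i. i < n \<Longrightarrow> 0 \<le> s i"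
  shows "psd n (P * S * adj P)"
  unfolding psd_def
proof (intro conjI allI)
  have Sc: "S \<in> carrier_mat n n" by (simp add: S)
  have hS: "adj S = S" by (rule eq_matI) (auto simp: S adj_def)
  show c: "P * S * adj P \<in> carrier_mat n n" using P Sc by (intro mult_carrier_mat adj_carrier)
  show "adj (P * S * adj P) = P * S * adj P"
    using P Sc hS by (auto dest!: carrier_dims simp: mat_algebra simp del: assoc_mult_mat)
  fix v :: "nat \<Rightarrow> complex"
  have e: "(P * S * adj P) $$ (i,j) = (\<Sum>l<n. P $$ (i,l) * complex_of_real (s l) * cnj (P $$ (j,l)))" if "i < n" "j < n" for i j
  proof -
    have "(P * S * adj P) $$ (i,j) = (\<Sum>l<n. (P * S) $$ (i,l) * adj P $$ (l,j))"
      using that P Sc by (subst mult_index[of _ n n _ n]) auto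
    also have "\<dots> = (\<Sum>l<n. P $$ (i,l) * complex_of_real (s l) * cnj (P $$ (j,l)))"
      using that P unfolding S by (intro sum.cong refl) (simp only: mult_diag_index[OF P] adj_index[OF P] lessThan_iff)
    finally show ?thesis .
  qed
  define z where "z l = (\<Sum>j<n. cnj (P $$ (j,l)) * v j)" for l
  have "(\<Sum>i<n. \<Sum>j<n. cnj (v i) * (P * S * adj P) $$ (i,j) * v j)
      = (\<Sum>i<n. \<Sum>j<n. \<Sum>l<n. cnj (v i) * P $$ (i,l) * complex_of_real (s l) * cnj (P $$ (j,l)) * v j)"
    by (intro sum.cong refl) (simp add: e sum_distrib_left sum_distrib_right mult.assoc del: index_mult_mat(1))
  also have "\<dots> = (\<Sum>i<n. \<Sum>l<n. \<Sum>j<n. cnj (v i) * P $$ (i,l) * complex_of_real (s l) * cnj (P $$ (j,l)) * v j)"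
    by (intro sum.cong refl sum.swap)
  also have "\<dots> = (\<Sum>l<n. \<Sum>i<n. \<Sum>j<n. cnj (v i) * P $$ (i,l) * complex_of_real (s l) * cnj (P $$ (j,l)) * v j)"
    by (rule sum.swap)
  also have "\<dots> = (\<Sum>l<n. complex_of_real (s l) * (cnj (z l) * z l))"
    by (intro sum.cong refl) (simp add: z_def sum_product sum_distrib_left mult_ac)
  also have "\<dots> = (\<Sum>l<n. complex_of_real (s l * (cmod (z l))\<^sup>2))"
    by (intro sum.cong refl) (simp add: complex_norm_square mult.commute del: of_real_power)
  finally show "0 \<le> Re (\<Sum>i<n. \<Sum>j<n. cnj (v i) * (P * S * adj P) $$ (i,j) * v j)"
    using s by (auto intro!: sum_nonneg)
qed

section \<open>Singular values and the duality of the trace norm\<close>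

text \<open>\<open>P\<close> diagonalizes \<open>adj A * A\<close>, so the columns of
  \<open>A * P\<close> are orthogonal with lengths \<open>s i\<close>. This half of a singular value
  decomposition involves no left singular vectors, hence no special case for zero singular values.
  Uniqueness of the square root resolves the description in \<open>msqrt\<close>.\<close>

lemma singular_values:
  assumes A: "A \<in> carrier_mat n n"
  shows "\<exists>P s. P \<in> carrier_mat n n \<and> adj P * P = 1\<^sub>m n \<and> (\<forall>i<n. 0 \<le> s i) \<and>
    adj (A * P) * (A * P) = mat n n (\<lambda>(i,j). if i = j then complex_of_real ((s i)\<^sup>2) else 0) \<and>
    trace_norm A = (\<Sum>i<n. s i)"
proof -
  have H: "adj A * A \<in> carrier_mat n n" using A by (intro mult_carrier_mat adj_carrier)
  have "adj (adj A * A) = adj A * A" using A by (auto dest!: carrier_dims simp: mat_algebra simp del: assoc_mult_mat)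
  from hermitian_diagonalization[OF H this] obtain P d where P: "P \<in> carrier_mat n n" "adj P * P = 1\<^sub>m n"
    and D: "adj P * (adj A * A) * P = mat n n (\<lambda>(i,j). if i = j then complex_of_real (d i) else 0)" by blast
  have AP: "A * P \<in> carrier_mat n n" using A P by auto
  have D': "adj (A * P) * (A * P) = mat n n (\<lambda>(i,j). if i = j then complex_of_real (d i) else 0)"
    unfolding D[symmetric] using A P by (auto dest!: carrier_dims simp: mat_algebra simp del: assoc_mult_mat)
  \<comment> \<open>\<open>d i\<close> is the squared length of column i of
    \<open>A * P\<close>.\<close>
  have d: "0 \<le> d i" if "i < n" for i
  proof -
    have "complex_of_real (d i) = (adj (A * P) * (A * P)) $$ (i,i)" unfolding D' using that by simp
    also have "\<dots> = (\<Sum>k<n. complex_of_real ((cmod ((A * P) $$ (k,i)))\<^sup>2))"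
      using that AP by (subst mult_index[of _ n n _ n]) (auto simp: adj_index[OF AP] complex_norm_square mult.commute simp del: index_mult_mat(1) of_real_power intro!: sum.cong)
    finally have "complex_of_real (d i) = complex_of_real (\<Sum>k<n. (cmod ((A * P) $$ (k,i)))\<^sup>2)" by simp
    then have "d i = (\<Sum>k<n. (cmod ((A * P) $$ (k,i)))\<^sup>2)" by (simp only: of_real_eq_iff)
    then show ?thesis by (simp add: sum_nonneg)
  qed
  define s where "s i = sqrt (d i)" for i
  define S where "S = mat n n (\<lambda>(i,j). if i = j then complex_of_real (s i) else 0)"
  have Sc: "S \<in> carrier_mat n n" by (simp add: S_def)
  have s: "0 \<le> s i" if "i < n" for i using d[OF that] by (simp add: s_def)
  have sd: "(s i)\<^sup>2 = d i" if "i < n" for i using d[OF that] by (simp add: s_def)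
  have SS: "S * S = mat n n (\<lambda>(i,j). if i = j then complex_of_real (d i) else 0)"
  proof (rule eq_matI)
    fix i j assume "i < dim_row (mat n n (\<lambda>(i,j). if i = j then complex_of_real (d i) else 0))"
      "j < dim_col (mat n n (\<lambda>(i,j). if i = j then complex_of_real (d i) else 0))"
    then have ij: "i < n" "j < n" by auto
    have "(S * S) $$ (i,j) = S $$ (i,j) * complex_of_real (s j)"
      using mult_diag_index[OF Sc ij, of "\<lambda>i. complex_of_real (s i)"] by (simp only: S_def)
    then show "(S * S) $$ (i,j) = mat n n (\<lambda>(i,j). if i = j then complex_of_real (d i) else 0) $$ (i,j)"
      using ij sd[of j] by (auto simp: S_def power2_eq_square simp flip: of_real_mult)
  qed (use Sc in auto)
  note PP = left_unitary_imp_right[OF P]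
  have HP: "adj A * A = P * (S * S) * adj P"
  proof -
    have "P * (S * S) * adj P = P * (adj P * (adj A * A) * P) * adj P" unfolding SS D ..
    also have "\<dots> = (P * adj P) * (adj A * A) * (P * adj P)" using P(1) A by (auto dest!: carrier_dims simp: mat_algebra simp del: assoc_mult_mat)
    finally show ?thesis by (simp only: PP left_mult_one_mat[OF H] right_mult_one_mat[OF H])
  qed
  have RR: "(P * S * adj P) * (P * S * adj P) = adj A * A"
  proof -
    have "(P * S * adj P) * (P * S * adj P) = P * S * (adj P * P) * S * adj P" using P(1) Sc by (auto dest!: carrier_dims simp: mat_algebra simp del: assoc_mult_mat)
    then show ?thesis unfolding P(2) HP using P(1) Sc by (auto dest!: carrier_dims simp: mat_algebra simp del: assoc_mult_mat)
  qed
  have "msqrt n (adj A * A) = P * S * adj P"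
    unfolding msqrt_def
  proof (rule the_equality)
    show "psd n (P * S * adj P) \<and> P * S * adj P * (P * S * adj P) = adj A * A"
      using psd_diag_conj[OF P(1) S_def s] RR by simp
    fix R assume "psd n R \<and> R * R = adj A * A"
    then show "R = P * S * adj P" using psd_sqrt_unique[OF P S_def s] HP by simp
  qed
  then have "trace_norm A = Re (mtrace (P * S * adj P))" unfolding trace_norm_def using A by simp
  also have "mtrace (P * S * adj P) = mtrace (adj P * (P * S))"
    using P Sc by (intro mtrace_comm[of _ n n]) auto
  also have "adj P * (P * S) = (adj P * P) * S" using P(1) Sc by (auto dest!: carrier_dims simp: mat_algebra simp del: assoc_mult_mat)
  also have "\<dots> = S" using P(2) Sc by simp
  also have "mtrace S = complex_of_real (\<Sum>i<n. s i)" unfolding mtrace_def S_def by simp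
  finally have "trace_norm A = (\<Sum>i<n. s i)" by simp
  moreover have "adj (A * P) * (A * P) = mat n n (\<lambda>(i,j). if i = j then complex_of_real ((s i)\<^sup>2) else 0)"
    unfolding D' by (intro cong_mat refl) (auto simp: sd simp del: of_real_power)
  ultimately show ?thesis using P s by blast
qed

text \<open>In the orthonormal basis of the columns P_i the trace of \<open>B * A\<close> is the sum
  of the <P_i, B (A P_i)>, and a contraction bounds each term by |P_i| |A P_i| =
  \<open>s i\<close>.\<close>

lemma trace_norm_ge:
  assumes A: "A \<in> carrier_mat n n" and B: "contractive n B"
  shows "cmod (mtrace (B * A)) \<le> trace_norm A"
proof -
  have Bc: "B \<in> carrier_mat n n" using B by (simp add: contractive_def)
  from singular_values[OF A] obtain P s where P: "P \<in> carrier_mat n n" "adj P * P = 1\<^sub>m n"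
    and s: "\<And>i. i < n \<Longrightarrow> 0 \<le> s i"
    and D: "adj (A * P) * (A * P) = mat n n (\<lambda>(i,j). if i = j then complex_of_real ((s i)\<^sup>2) else 0)"
    and tn: "trace_norm A = (\<Sum>i<n. s i)" by blast
  define Q where "Q = A * P"
  have Q: "Q \<in> carrier_mat n n" using A P by (auto simp: Q_def)
  define cl where "cl M i = mat n 1 (\<lambda>(k,_). M $$ (k,i))" for M :: "complex mat" and i
  have cl: "cl M i \<in> carrier_mat n 1" for M i by (simp add: cl_def)
  have entry: "(adj M * N) $$ (i,i) = (adj (cl M i) * cl N i) $$ (0,0)"
    if "M \<in> carrier_mat n n" "N \<in> carrier_mat n n" "i < n" for M N i
    unfolding inner_index[OF cl cl] using that
    by (subst mult_index[of _ n n _ n]) (auto simp: adj_index[of _ n n] cl_def intro!: sum.cong)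
  have BQ: "cl (B * Q) i = B * cl Q i" if "i < n" for i
    using that Bc Q by (intro eq_matI) (auto simp: cl_def mult_index[of _ n n _ n] mult_index[of _ n n _ 1] simp del: index_mult_mat(1))
  have "mtrace (B * A) = mtrace (B * (A * (P * adj P)))"
    using left_unitary_imp_right[OF P] A by simp
  also have "\<dots> = mtrace ((B * Q) * adj P)" unfolding Q_def using A P Bc by (auto dest!: carrier_dims simp: mat_algebra simp del: assoc_mult_mat)
  also have "\<dots> = mtrace (adj P * (B * Q))" using P Bc Q by (intro mtrace_comm[of _ n n]) auto
  also have "\<dots> = (\<Sum>i<n. (adj (cl P i) * (B * cl Q i)) $$ (0,0))"
    unfolding mtrace_def using P Bc Q by (intro sum.cong) (auto simp: entry BQ simp del: index_mult_mat(1))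
  finally have "cmod (mtrace (B * A)) \<le> (\<Sum>i<n. cmod ((adj (cl P i) * (B * cl Q i)) $$ (0,0)))"
    by (simp only: norm_sum)
  also have "\<dots> \<le> (\<Sum>i<n. s i)"
  proof (rule sum_mono)
    fix i assume "i \<in> {..<n}" then have i: "i < n" by simp
    have "nrm2 (cl P i) = 1" unfolding nrm2_def entry[OF P(1) P(1) i, symmetric] P(2) using i by simp
    moreover have "nrm2 (cl Q i) = (s i)\<^sup>2" unfolding nrm2_def entry[OF Q Q i, symmetric] unfolding Q_def D using i by simp
    moreover have "adj (cl P i) * (B * cl Q i) = adj (cl P i) * B * cl Q i"
      using cl[of P i] cl[of Q i] Bc by (auto dest!: carrier_dims simp: mat_algebra simp del: assoc_mult_mat)
    ultimately have "(cmod ((adj (cl P i) * (B * cl Q i)) $$ (0,0)))\<^sup>2 \<le> (s i)\<^sup>2"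
      using B cl unfolding contractive_def by (metis mult_1)
    then show "cmod ((adj (cl P i) * (B * cl Q i)) $$ (0,0)) \<le> s i" using s[OF i] by (rule power2_le_imp_le)
  qed
  finally show ?thesis using tn by simp
qed

text \<open>The optimal operator is the adjoint of the partial isometry in the polar decomposition
  of \<open>A\<close>. In the proof it is \<open>P * T\<close>, where the rows of \<open>T\<close>
  are the normalized columns of \<open>A * P\<close>, conjugated.\<close>

lemma trace_norm_attained:
  assumes A: "A \<in> carrier_mat n n"
  shows "\<exists>B. contractive n B \<and> mtrace (B * A) = complex_of_real (trace_norm A)"
proof -
  from singular_values[OF A] obtain P s where P: "P \<in> carrier_mat n n" "adj P * P = 1\<^sub>m n"
    and s: "\<And>i. i < n \<Longrightarrow> 0 \<le> s i"
    and D: "adj (A * P) * (A * P) = mat n n (\<lambda>(i,j). if i = j then complex_of_real ((s i)\<^sup>2) else 0)"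
    and tn: "trace_norm A = (\<Sum>i<n. s i)" by blast
  note PP = left_unitary_imp_right[OF P]
  define Q where "Q = A * P"
  have Q: "Q \<in> carrier_mat n n" using A P by (auto simp: Q_def)
  have Di: "(\<Sum>k<n. cnj (Q $$ (k,i)) * Q $$ (k,j)) = (if i = j then complex_of_real ((s i)\<^sup>2) else 0)" if "i < n" "j < n" for i j
  proof -
    have "(\<Sum>k<n. cnj (Q $$ (k,i)) * Q $$ (k,j)) = (adj Q * Q) $$ (i,j)"
      using that Q by (subst mult_index[of _ n n _ n]) (auto simp: adj_index[OF Q] intro!: sum.cong)
    then show ?thesis using D that by (simp add: Q_def del: index_mult_mat(1))
  qed
  \<comment> \<open>rows belonging to the singular value 0 vanish because of x / 0 = 0\<close>
  define T where "T = mat n n (\<lambda>(i,j). cnj (Q $$ (j,i)) / complex_of_real (s i))"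
  have T: "T \<in> carrier_mat n n" by (simp add: T_def)
  have TQ: "(T * Q) $$ (i,i) = complex_of_real (s i)" if "i < n" for i
  proof -
    have "(T * Q) $$ (i,i) = (\<Sum>k<n. cnj (Q $$ (k,i)) * Q $$ (k,i)) / complex_of_real (s i)"
      unfolding sum_divide_distrib using that Q T by (subst mult_index[of _ n n _ n]) (auto simp: T_def intro!: sum.cong)
    then show ?thesis using Di[OF that that] by (simp add: power2_eq_square)
  qed
  define \<delta> where "\<delta> i = (if s i = 0 then 0 else (1::complex))" for i
  have TT: "T * adj T = mat n n (\<lambda>(i,j). if i = j then \<delta> i else 0)" (is "_ = ?\<Delta>")
  proof (rule eq_matI)
    fix i j assume "i < dim_row ?\<Delta>" "j < dim_col ?\<Delta>"
    then have ij: "i < n" "j < n" by auto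
    have "(T * adj T) $$ (i,j) = (\<Sum>k<n. cnj (Q $$ (k,i)) * Q $$ (k,j)) / (complex_of_real (s i) * complex_of_real (s j))"
      unfolding sum_divide_distrib using ij Q T by (subst mult_index[of _ n n _ n]) (auto simp: T_def adj_def intro!: sum.cong)
    then show "(T * adj T) $$ (i,j) = ?\<Delta> $$ (i,j)" using Di[OF ij] ij by (auto simp: \<delta>_def power2_eq_square)
  qed (use T in auto)
  \<comment> \<open>\<open>T * adj T\<close> is a diagonal projection, so \<open>adj T\<close> does
    not increase lengths. This passes to \<open>T\<close> by |T Y|^2 = <adj T (T Y), Y> and
    Cauchy-Schwarz.\<close>
  have bessel: "nrm2 (T * Y) \<le> nrm2 Y" if Y: "Y \<in> carrier_mat n 1" for Y
  proof -
    define Z where "Z = T * Y"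
    have Z: "Z \<in> carrier_mat n 1" using T Y by (auto simp: Z_def)
    have TZ: "adj T * Z \<in> carrier_mat n 1" using T Z by (auto intro!: mult_carrier_mat)
    have "nrm2 (adj T * Z) = Re ((adj Z * (?\<Delta> * Z)) $$ (0,0))"
      using T Z by (simp add: nrm2_mult[of _ n] TT assoc_mult_mat[of _ 1 n _ n _ 1])
    also have "\<dots> = (\<Sum>i<n. Re (\<delta> i) * (cmod (Z $$ (i,0)))\<^sup>2)"
    proof -
      have "(?\<Delta> * Z) $$ (i,0) = \<delta> i * Z $$ (i,0)" if "i < n" for i
      proof -
        have "(?\<Delta> * Z) $$ (i,0) = (\<Sum>l<n. (if i = l then \<delta> i else 0) * Z $$ (l,0))"
          using that Z by (subst mult_index[of _ n n _ 1]) (auto intro!: sum.cong)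
        also have "\<dots> = (\<Sum>l<n. if i = l then \<delta> i * Z $$ (l,0) else 0)" by (intro sum.cong) auto
        finally show ?thesis using that by simp
      qed
      then have "(adj Z * (?\<Delta> * Z)) $$ (0,0) = (\<Sum>i<n. cnj (Z $$ (i,0)) * (\<delta> i * Z $$ (i,0)))"
        using Z by (subst inner_index[of _ n]) (auto simp del: index_mult_mat(1) intro!: sum.cong)
      also have "\<dots> = (\<Sum>i<n. complex_of_real (Re (\<delta> i) * (cmod (Z $$ (i,0)))\<^sup>2))"
        by (intro sum.cong refl) (auto simp: \<delta>_def complex_norm_square mult.commute simp del: of_real_power)
      finally show ?thesis by simp
    qed
    also have "\<dots> \<le> nrm2 Z" unfolding nrm2_sum[OF Z] by (intro sum_mono) (auto simp: \<delta>_def)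
    finally have le: "nrm2 (adj T * Z) \<le> nrm2 Z" .
    have "adj Z * Z = adj (adj T * Z) * Y"
      unfolding Z_def using T Y by (auto dest!: carrier_dims simp: mat_algebra simp del: assoc_mult_mat)
    then have "(cmod (complex_of_real (nrm2 Z)))\<^sup>2 \<le> nrm2 (adj T * Z) * nrm2 Y"
      using inner_Cauchy_Schwarz[OF TZ Y] inner_self(1)[OF Z] by simp
    also have "\<dots> \<le> nrm2 Z * nrm2 Y" using le nrm2_nonneg[OF Y] by (rule mult_right_mono)
    finally have "nrm2 Z * nrm2 Z \<le> nrm2 Z * nrm2 Y" by (simp add: power2_eq_square)
    then have "nrm2 Z \<le> nrm2 Y" using nrm2_nonneg[OF Y] nrm2_nonneg[OF Z] by (cases "nrm2 Z = 0") auto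
    then show ?thesis by (simp add: Z_def)
  qed
  have "contractive n (P * T)"
    unfolding contractive_def
  proof (intro conjI ballI)
    show "P * T \<in> carrier_mat n n" using P T by auto
    fix X Y :: "complex mat" assume X: "X \<in> carrier_mat n 1" and Y: "Y \<in> carrier_mat n 1"
    have PX: "adj P * X \<in> carrier_mat n 1" and TY: "T * Y \<in> carrier_mat n 1" using P T X Y by (auto intro!: mult_carrier_mat)
    have "adj X * (P * T) * Y = adj (adj P * X) * (T * Y)"
      using X Y P(1) T by (auto dest!: carrier_dims simp: mat_algebra simp del: assoc_mult_mat)
    then have "(cmod ((adj X * (P * T) * Y) $$ (0,0)))\<^sup>2 \<le> nrm2 (adj P * X) * nrm2 (T * Y)"
      using inner_Cauchy_Schwarz[OF PX TY] by simp
    also have "nrm2 (adj P * X) = nrm2 X" using P PP X by (intro nrm2_unitary[of _ n]) auto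
    also have "nrm2 X * nrm2 (T * Y) \<le> nrm2 X * nrm2 Y" using bessel[OF Y] nrm2_nonneg[OF X] by (rule mult_left_mono)
    finally show "(cmod ((adj X * (P * T) * Y) $$ (0,0)))\<^sup>2 \<le> nrm2 X * nrm2 Y" .
  qed
  moreover have "mtrace (P * T * A) = complex_of_real (trace_norm A)"
  proof -
    have "mtrace (P * T * A) = mtrace (P * (T * A))" using P T A by (auto dest!: carrier_dims simp: mat_algebra simp del: assoc_mult_mat)
    also have "\<dots> = mtrace (T * A * P)" using P T A by (intro mtrace_comm[of _ n n]) auto
    also have "T * A * P = T * Q" unfolding Q_def using P T A by (auto dest!: carrier_dims simp: mat_algebra simp del: assoc_mult_mat)
    also have "mtrace (T * Q) = (\<Sum>i<n. complex_of_real (s i))"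
      unfolding mtrace_def using T Q by (intro sum.cong) (auto simp: TQ simp del: index_mult_mat(1))
    finally show ?thesis using tn by simp
  qed
  ultimately show ?thesis by blast
qed

section \<open>Combinations of unitary channels and the diamond norm\<close>

lemma mtrace_mult:
  assumes "B \<in> carrier_mat n n" "M \<in> carrier_mat n n"
  shows "mtrace (B * M) = (\<Sum>i<n. \<Sum>l<n. B $$ (i,l) * M $$ (l,i))"
  unfolding mtrace_def using assms
  by (intro sum.cong) (auto simp: mult_index[OF assms] simp del: index_mult_mat(1))

lemma contractive_unitary:
  assumes V: "V \<in> carrier_mat n n" "adj V * V = 1\<^sub>m n"
  shows "contractive n V"
  unfolding contractive_def
proof (intro conjI ballI V(1))
  fix X Y :: "complex mat" assume X: "X \<in> carrier_mat n 1" and Y: "Y \<in> carrier_mat n 1"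
  have VY: "V * Y \<in> carrier_mat n 1" using V Y by auto
  have "adj X * V * Y = adj X * (V * Y)" using X Y V by (auto dest!: carrier_dims simp: mult_assoc_dim simp del: assoc_mult_mat)
  then show "(cmod ((adj X * V * Y) $$ (0,0)))\<^sup>2 \<le> nrm2 X * nrm2 Y"
    using inner_Cauchy_Schwarz[OF X VY] nrm2_unitary[OF V Y] by simp
qed

text \<open>Duality with the reflection 2 x x^* / |x|^2 - 1.\<close>
lemma trace_norm_reflection:
  assumes M: "M \<in> carrier_mat n n" and x: "x \<in> carrier_mat n 1" and N: "nrm2 x > 0"
  shows "2 * Re ((adj x * M * x) $$ (0,0)) - nrm2 x * Re (mtrace M) \<le> nrm2 x * trace_norm M"
proof -
  define N where "N = nrm2 x"
  define f where "f i = x $$ (i,0)" for i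
  define \<alpha> where "\<alpha> = complex_of_real (2 / N)"
  define V where "V = mat n n (\<lambda>(i,j). \<alpha> * f i * cnj (f j) - (if i = j then 1 else 0))"
  have V: "V \<in> carrier_mat n n" by (simp add: V_def)
  have Vi: "V $$ (i,j) = \<alpha> * f i * cnj (f j) - (if i = j then 1 else 0)" if "i < n" "j < n" for i j
    using that by (simp add: V_def)
  have ff: "(\<Sum>k<n. cnj (f k) * f k) = complex_of_real N"
    using inner_self(1)[OF x] unfolding inner_index[OF x x] by (simp add: f_def N_def)
  have N0: "N > 0" using N by (simp add: N_def)
  have "adj V * V = 1\<^sub>m n"
  proof (rule eq_matI)
    fix i j assume "i < dim_row (1\<^sub>m n)" "j < dim_col (1\<^sub>m n)"
    then have ij: "i < n" "j < n" by auto
    have "(adj V * V) $$ (i,j) = (\<Sum>k<n. (\<alpha> * cnj (f k) * f i - (if k = i then 1 else 0)) * (\<alpha> * f k * cnj (f j) - (if k = j then 1 else 0)))"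
      using ij V by (subst mult_index[of _ n n _ n]) (auto simp: adj_index[OF V] Vi \<alpha>_def intro!: sum.cong)
    also have "\<dots> = (\<Sum>k<n. \<alpha> * \<alpha> * f i * cnj (f j) * (cnj (f k) * f k) - (if k = j then \<alpha> * cnj (f k) * f i else 0)
        - (if k = i then \<alpha> * f k * cnj (f j) else 0) + (if k = i then (if k = j then 1 else 0) else 0))"
      by (intro sum.cong refl) (simp add: algebra_simps)
    also have "\<dots> = \<alpha> * \<alpha> * f i * cnj (f j) * complex_of_real N - \<alpha> * cnj (f j) * f i - \<alpha> * f i * cnj (f j) + (if i = j then 1 else 0)"
      using ij by (simp add: sum.distrib sum_subtractf ff flip: sum_distrib_left)
    also have "\<alpha> * \<alpha> * f i * cnj (f j) * complex_of_real N = 2 * \<alpha> * f i * cnj (f j)"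
      using N0 by (simp add: \<alpha>_def)
    finally show "(adj V * V) $$ (i,j) = (1\<^sub>m n) $$ (i,j)" using ij by simp
  qed (use V in auto)
  then have "contractive n V" by (rule contractive_unitary[OF V])
  from trace_norm_ge[OF M this] have *: "Re (mtrace (V * M)) \<le> trace_norm M"
    using complex_Re_le_cmod order_trans by blast
  have q: "(adj x * M * x) $$ (0,0) = (\<Sum>l<n. \<Sum>i<n. cnj (f l) * M $$ (l,i) * f i)"
  proof -
    have "(adj x * M * x) $$ (0,0) = (adj x * (M * x)) $$ (0,0)"
      using x M by (auto dest!: carrier_dims simp: mult_assoc_dim simp del: assoc_mult_mat index_mult_mat(1))
    also have "\<dots> = (\<Sum>l<n. cnj (f l) * (M * x) $$ (l,0))"
      using M x by (subst inner_index[of _ n]) (auto simp: f_def)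
    also have "\<dots> = (\<Sum>l<n. \<Sum>i<n. cnj (f l) * M $$ (l,i) * f i)"
      using M x by (intro sum.cong refl) (auto simp: mult_index[of _ n n _ 1] f_def sum_distrib_left mult.assoc simp del: index_mult_mat(1))
    finally show ?thesis .
  qed
  have "mtrace (V * M) = (\<Sum>i<n. (\<Sum>l<n. \<alpha> * (cnj (f l) * M $$ (l,i) * f i)) - M $$ (i,i))"
  proof (unfold mtrace_mult[OF V M], intro sum.cong refl)
    fix i assume "i \<in> {..<n}"
    then have i: "i < n" by simp
    have "(\<Sum>l<n. V $$ (i,l) * M $$ (l,i)) = (\<Sum>l<n. \<alpha> * (cnj (f l) * M $$ (l,i) * f i) - (if l = i then M $$ (l,i) else 0))"
      using i by (intro sum.cong refl) (simp add: V_def algebra_simps)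
    then show "(\<Sum>l<n. V $$ (i,l) * M $$ (l,i)) = (\<Sum>l<n. \<alpha> * (cnj (f l) * M $$ (l,i) * f i)) - M $$ (i,i)"
      using i by (simp add: sum_subtractf)
  qed
  also have "\<dots> = \<alpha> * (adj x * M * x) $$ (0,0) - mtrace M"
    unfolding q using M
    by (subst sum.swap[of _ "{..<n}"]) (simp add: sum_subtractf sum_distrib_left mtrace_def)
  finally have "Re (mtrace (V * M)) = (2 / N) * Re ((adj x * M * x) $$ (0,0)) - Re (mtrace M)"
    by (simp add: \<alpha>_def del: index_mult_mat(1) of_real_divide)
  with * have "N * ((2 / N) * Re ((adj x * M * x) $$ (0,0)) - Re (mtrace M)) \<le> N * trace_norm M"
    using N0 by (intro mult_left_mono) auto
  then show ?thesis unfolding N_def[symmetric] using N0 by (simp add: right_diff_distrib del: index_mult_mat(1))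
qed

lemma sum_lessThan_2: "(\<Sum>i<(2::nat). f i) = f 0 + (f 1 :: 'a :: comm_monoid_add)"
  by (simp add: numeral_2_eq_2)

lemma sum_lessThan_4: "(\<Sum>i<(4::nat). f i) = f 0 + f 1 + f 2 + (f 3 :: 'a :: comm_monoid_add)"
  by (simp add: eval_nat_numeral)

lemma less_4_disj: "(i::nat) < 4 \<Longrightarrow> i = 0 \<or> i = 1 \<or> i = 2 \<or> i = 3"
  by auto

section \<open>Channels acting beside an ancilla\<close>

text \<open>The operator 1 (x) A: the ancilla is the left factor, so \<open>A\<close> acts on the
  index modulo 2.\<close>

definition lift :: "complex mat \<Rightarrow> complex mat" where
  "lift A = mat 4 4 (\<lambda>(r,s). if r div 2 = s div 2 then A $$ (r mod 2, s mod 2) else 0)"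

lemma lift_carrier [simp]: "lift A \<in> carrier_mat 4 4"
  by (simp add: lift_def)

lemma lift_dim [simp]: "dim_row (lift A) = 4" "dim_col (lift A) = 4"
  by (simp_all add: lift_def)

lemma lift_mult:
  assumes "A \<in> carrier_mat 2 2" "B \<in> carrier_mat 2 2"
  shows "lift A * lift B = lift (A * B)"
proof (rule eq_matI)
  fix i j assume "i < dim_row (lift (A * B))" "j < dim_col (lift (A * B))"
  then have ij: "i < 4" "j < 4" by (auto simp: lift_def)
  have "(lift A * lift B) $$ (i,j) = (\<Sum>l<4. lift A $$ (i,l) * lift B $$ (l,j))"
    using ij by (intro mult_index[of _ 4 4 _ 4]) auto
  also have "\<dots> = (if i div 2 = j div 2 then \<Sum>l<2. A $$ (i mod 2,l) * B $$ (l,j mod 2) else 0)"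
    using less_4_disj[OF ij(1)] less_4_disj[OF ij(2)] by (auto simp: sum_lessThan_2 sum_lessThan_4 lift_def)
  also have "\<dots> = lift (A * B) $$ (i,j)"
    using ij assms by (simp add: lift_def mult_index[of _ 2 2 _ 2] del: index_mult_mat(1))
  finally show "(lift A * lift B) $$ (i,j) = lift (A * B) $$ (i,j)" .
qed (auto simp: lift_def)

lemma lift_adj: "A \<in> carrier_mat 2 2 \<Longrightarrow> adj (lift A) = lift (adj A)"
  by (rule eq_matI) (auto simp: lift_def adj_def)

lemma lift_one: "lift (1\<^sub>m 2) = 1\<^sub>m 4"
proof (rule eq_matI)
  fix i j assume "i < dim_row (1\<^sub>m 4)" "j < dim_col (1\<^sub>m 4)"
  then have ij: "i < 4" "j < 4" by auto
  show "lift (1\<^sub>m 2) $$ (i,j) = 1\<^sub>m 4 $$ (i,j)"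
    using less_4_disj[OF ij(1)] less_4_disj[OF ij(2)] by (auto simp: lift_def)
qed (auto simp: lift_def)

lemma unitary2D:
  assumes "unitary2 U"
  shows "U \<in> carrier_mat 2 2" "U * adj U = 1\<^sub>m 2" "adj U * U = 1\<^sub>m 2"
  using assms mat_mult_left_right_inverse[of U 2 "adj U"] by (auto simp: unitary2_def)

lemma lift_unitary:
  assumes "unitary2 U"
  shows "adj (lift U) * lift U = 1\<^sub>m 4"
  using unitary2D[OF assms] by (simp add: lift_adj lift_mult lift_one)

text \<open>\<open>id_tensor\<close> works block by block. For a conjugation this is multiplication
  by \<open>lift A\<close> and its adjoint, which makes trace arguments available.\<close>

lemma id_tensor_conj:
  assumes A: "A \<in> carrier_mat 2 2" and X: "X \<in> carrier_mat 4 4" and rs: "r < 4" "s < 4"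
  shows "(A * block2 X (r div 2) (s div 2) * adj A) $$ (r mod 2, s mod 2) = (lift A * X * adj (lift A)) $$ (r,s)"
proof -
  have "(lift A * X * adj (lift A)) $$ (r,s) = (\<Sum>k<4. (\<Sum>l<4. lift A $$ (r,l) * X $$ (l,k)) * cnj (lift A $$ (s,k)))"
    using X rs by (subst mult_index[of _ 4 4 _ 4]) (auto simp: mult_index[of _ 4 4 _ 4] adj_index[of _ 4 4] simp del: index_mult_mat(1) intro!: sum.cong mult_carrier_mat[of _ 4 4])
  also have "\<dots> = (\<Sum>k<2. (\<Sum>l<2. A $$ (r mod 2,l) * X $$ (2 * (r div 2) + l,2 * (s div 2) + k)) * cnj (A $$ (s mod 2,k)))"
    using less_4_disj[OF rs(1)] less_4_disj[OF rs(2)] by (auto simp: sum_lessThan_2 sum_lessThan_4 lift_def)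
  also have "\<dots> = (A * block2 X (r div 2) (s div 2) * adj A) $$ (r mod 2, s mod 2)"
  proof -
    have B: "block2 X (r div 2) (s div 2) \<in> carrier_mat 2 2" by (simp add: block2_def)
    show ?thesis using A B
      by (subst mult_index[of _ 2 2 _ 2]) (auto simp: mult_index[of _ 2 2 _ 2] adj_index[of _ 2 2] block2_def simp del: index_mult_mat(1) intro!: sum.cong)
  qed
  finally show ?thesis by simp
qed

text \<open>The coefficients are real of either sign, so that differences of channels are covered.
  The equation is restricted to 2 x 2 inputs because a \<open>qmap\<close> is an arbitrary function
  on matrices of all sizes.\<close>

definition kraus_comb :: "nat set \<Rightarrow> (nat \<Rightarrow> real) \<Rightarrow> (nat \<Rightarrow> complex mat) \<Rightarrow> qmap \<Rightarrow> bool" where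
  "kraus_comb K c A \<Phi> \<longleftrightarrow> finite K \<and> (\<forall>k\<in>K. unitary2 (A k)) \<and>
    (\<forall>\<rho>\<in>carrier_mat 2 2. \<forall>a<2. \<forall>b<2. \<Phi> \<rho> $$ (a,b) = (\<Sum>k\<in>K. complex_of_real (c k) * (A k * \<rho> * adj (A k)) $$ (a,b)))"

lemma id_tensor_kraus:
  assumes "kraus_comb K c A \<Phi>" "X \<in> carrier_mat 4 4" "r < 4" "s < 4"
  shows "id_tensor \<Phi> X $$ (r,s) = (\<Sum>k\<in>K. complex_of_real (c k) * (lift (A k) * X * adj (lift (A k))) $$ (r,s))"
proof -
  have "block2 X (r div 2) (s div 2) \<in> carrier_mat 2 2" by (simp add: block2_def)
  then have "id_tensor \<Phi> X $$ (r,s) = (\<Sum>k\<in>K. complex_of_real (c k) * (A k * block2 X (r div 2) (s div 2) * adj (A k)) $$ (r mod 2, s mod 2))"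
    using assms unfolding id_tensor_def kraus_comb_def by simp
  also have "\<dots> = (\<Sum>k\<in>K. complex_of_real (c k) * (lift (A k) * X * adj (lift (A k))) $$ (r,s))"
    using assms by (intro sum.cong refl arg_cong2[where f = "(*)"] id_tensor_conj) (auto simp: kraus_comb_def unitary2_def)
  finally show ?thesis .
qed

lemma id_tensor_carrier: "id_tensor \<Phi> X \<in> carrier_mat 4 4"
  by (simp add: id_tensor_def)

lemma mtrace_id_tensor_kraus:
  assumes K: "kraus_comb K c A \<Phi>" and X: "X \<in> carrier_mat 4 4" and B: "B \<in> carrier_mat 4 4"
  shows "mtrace (B * id_tensor \<Phi> X) = (\<Sum>k\<in>K. complex_of_real (c k) * mtrace (B * (lift (A k) * X * adj (lift (A k)))))"
proof -
  have c: "lift (A k) * X * adj (lift (A k)) \<in> carrier_mat 4 4" for k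
    using X by (intro mult_carrier_mat[of _ 4 4] adj_carrier lift_carrier)
  have "mtrace (B * id_tensor \<Phi> X) = (\<Sum>i<4. \<Sum>l<4. \<Sum>k\<in>K. complex_of_real (c k) * (B $$ (i,l) * (lift (A k) * X * adj (lift (A k))) $$ (l,i)))"
    unfolding mtrace_mult[OF B id_tensor_carrier]
    by (intro sum.cong refl) (simp add: id_tensor_kraus[OF K X] sum_distrib_left mult_ac del: index_mult_mat(1))
  also have "\<dots> = (\<Sum>i<4. \<Sum>k\<in>K. \<Sum>l<4. complex_of_real (c k) * (B $$ (i,l) * (lift (A k) * X * adj (lift (A k))) $$ (l,i)))"
    by (intro sum.cong refl sum.swap)
  also have "\<dots> = (\<Sum>k\<in>K. \<Sum>i<4. \<Sum>l<4. complex_of_real (c k) * (B $$ (i,l) * (lift (A k) * X * adj (lift (A k))) $$ (l,i)))"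
    by (rule sum.swap)
  also have "\<dots> = (\<Sum>k\<in>K. complex_of_real (c k) * mtrace (B * (lift (A k) * X * adj (lift (A k)))))"
    unfolding mtrace_mult[OF B c] sum_distrib_left ..
  finally show ?thesis .
qed

text \<open>Dualize with one contraction that attains the trace norm of the output. Conjugated by
  the unitaries it stays a contraction, so term k contributes at most |c k| times the trace norm of
  \<open>X\<close>.\<close>

lemma trace_norm_kraus_le:
  assumes K: "kraus_comb K c A \<Phi>" and X: "X \<in> carrier_mat 4 4"
  shows "trace_norm (id_tensor \<Phi> X) \<le> (\<Sum>k\<in>K. \<bar>c k\<bar>) * trace_norm X"
proof -
  from trace_norm_attained[OF id_tensor_carrier] obtain B where B: "contractive 4 B"
    and tB: "mtrace (B * id_tensor \<Phi> X) = complex_of_real (trace_norm (id_tensor \<Phi> X))" by blast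
  have Bc: "B \<in> carrier_mat 4 4" using B by (simp add: contractive_def)
  have le: "cmod (mtrace (B * (lift (A k) * X * adj (lift (A k))))) \<le> trace_norm X" if "k \<in> K" for k
  proof -
    let ?L = "lift (A k)"
    have U: "adj ?L * ?L = 1\<^sub>m 4" using K that by (intro lift_unitary) (simp add: kraus_comb_def)
    have L: "?L \<in> carrier_mat 4 4" by simp
    have "mtrace (B * (?L * X * adj ?L)) = mtrace ((B * ?L * X) * adj ?L)"
      using Bc L X by (auto dest!: carrier_dims simp: mult_assoc_dim simp del: assoc_mult_mat)
    also have "\<dots> = mtrace (adj ?L * (B * ?L * X))"
      using Bc L X by (intro mtrace_comm[of _ 4 4] mult_carrier_mat adj_carrier)
    also have "adj ?L * (B * ?L * X) = (adj ?L * B * ?L) * X"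
      using Bc L X by (auto dest!: carrier_dims simp: mult_assoc_dim simp del: assoc_mult_mat)
    finally show ?thesis using trace_norm_ge[OF X contractive_conj[OF B L U]] by simp
  qed
  have "trace_norm (id_tensor \<Phi> X) \<le> cmod (mtrace (B * id_tensor \<Phi> X))" unfolding tB by simp
  also have "\<dots> \<le> (\<Sum>k\<in>K. cmod (complex_of_real (c k) * mtrace (B * (lift (A k) * X * adj (lift (A k))))))"
    unfolding mtrace_id_tensor_kraus[OF K X Bc] by (rule norm_sum)
  also have "\<dots> \<le> (\<Sum>k\<in>K. \<bar>c k\<bar> * trace_norm X)"
    using le by (intro sum_mono) (simp add: norm_mult mult_left_mono)
  finally show ?thesis by (simp add: sum_distrib_right)
qed

section \<open>Bounds on the diamond norm\<close>

definition bell :: "complex mat" where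
  "bell = mat 4 1 (\<lambda>(r,_). if r = 0 \<or> r = 3 then 1 / complex_of_real (sqrt 2) else 0)"

lemma bell_carrier [simp]: "bell \<in> carrier_mat 4 1"
  by (simp add: bell_def)

lemma nrm2_bell: "nrm2 bell = 1"
  unfolding nrm2_sum[OF bell_carrier] by (simp add: sum_lessThan_4 bell_def norm_divide power_divide)

text \<open>The trace of \<open>B\<close> against the projection onto a unit vector is a diagonal
  value of the form of \<open>B\<close>, so at most 1 in modulus for a contraction.\<close>

lemma trace_norm_bell: "trace_norm (bell * adj bell) \<le> 1"
proof -
  have c: "bell * adj bell \<in> carrier_mat 4 4" by (intro mult_carrier_mat[of _ 4 1] adj_carrier bell_carrier)
  from trace_norm_attained[OF this] obtain B where B: "contractive 4 B"
    and tB: "mtrace (B * (bell * adj bell)) = complex_of_real (trace_norm (bell * adj bell))" by blast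
  have Bc: "B \<in> carrier_mat 4 4" using B by (simp add: contractive_def)
  have b: "bell \<in> carrier_mat 4 1" by (rule bell_carrier)
  have "mtrace (B * (bell * adj bell)) = mtrace ((B * bell) * adj bell)"
    using Bc b by (auto dest!: carrier_dims simp: mult_assoc_dim simp del: assoc_mult_mat)
  also have "\<dots> = mtrace (adj bell * (B * bell))"
    using Bc b by (intro mtrace_comm[of _ 4 1] mult_carrier_mat[of _ 4 4] adj_carrier)
  also have "adj bell * (B * bell) = adj bell * B * bell"
    using Bc b by (auto dest!: carrier_dims simp: mult_assoc_dim simp del: assoc_mult_mat)
  also have "mtrace (adj bell * B * bell) = (adj bell * B * bell) $$ (0,0)"
    using carrier_dims[OF b] by (simp add: mtrace_def del: index_mult_mat(1))
  finally have "(cmod (complex_of_real (trace_norm (bell * adj bell))))\<^sup>2 \<le> 1\<^sup>2"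
    using B tB nrm2_bell unfolding contractive_def by (metis b mult_1 one_power2)
  then have "cmod (complex_of_real (trace_norm (bell * adj bell))) \<le> 1" by (rule power2_le_imp_le) simp
  then show ?thesis by simp
qed

lemma diamond_norm_le:
  assumes "kraus_comb K c A \<Phi>"
  shows "diamond_norm \<Phi> \<le> (\<Sum>k\<in>K. \<bar>c k\<bar>)"
  unfolding diamond_norm_def
proof (rule cSup_least)
  \<comment> \<open>A least-upper-bound argument over the reals needs a nonempty set; the Bell
    projection is an admissible input.\<close>
  have "bell * adj bell \<in> carrier_mat 4 4" by (intro mult_carrier_mat[of _ 4 1] adj_carrier bell_carrier)
  then show "{trace_norm (id_tensor \<Phi> X) |X. X \<in> carrier_mat 4 4 \<and> trace_norm X \<le> 1} \<noteq> {}"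
    using trace_norm_bell by blast
  fix y assume "y \<in> {trace_norm (id_tensor \<Phi> X) |X. X \<in> carrier_mat 4 4 \<and> trace_norm X \<le> 1}"
  then obtain X where X: "X \<in> carrier_mat 4 4" "trace_norm X \<le> 1" "y = trace_norm (id_tensor \<Phi> X)" by blast
  have "y \<le> (\<Sum>k\<in>K. \<bar>c k\<bar>) * trace_norm X" using trace_norm_kraus_le[OF assms X(1)] X(3) by simp
  also have "\<dots> \<le> (\<Sum>k\<in>K. \<bar>c k\<bar>) * 1" using X(2) by (intro mult_left_mono sum_nonneg) auto
  finally show "y \<le> (\<Sum>k\<in>K. \<bar>c k\<bar>)" by simp
qed

text \<open>Over the reals a supremum dominates its set only if the set is bounded, and
  \<open>trace_norm_kraus_le\<close> gives the bound.\<close>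

lemma diamond_norm_ge_trace_norm:
  assumes "kraus_comb K c A \<Phi>" "X \<in> carrier_mat 4 4" "trace_norm X \<le> 1"
  shows "trace_norm (id_tensor \<Phi> X) \<le> diamond_norm \<Phi>"
  unfolding diamond_norm_def
proof (rule cSup_upper)
  show "trace_norm (id_tensor \<Phi> X) \<in> {trace_norm (id_tensor \<Phi> X) |X. X \<in> carrier_mat 4 4 \<and> trace_norm X \<le> 1}"
    using assms by blast
  show "bdd_above {trace_norm (id_tensor \<Phi> X) |X. X \<in> carrier_mat 4 4 \<and> trace_norm X \<le> 1}"
  proof (rule bdd_aboveI)
    fix y assume "y \<in> {trace_norm (id_tensor \<Phi> X) |X. X \<in> carrier_mat 4 4 \<and> trace_norm X \<le> 1}"
    then obtain X where X: "X \<in> carrier_mat 4 4" "trace_norm X \<le> 1" "y = trace_norm (id_tensor \<Phi> X)" by blast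
    have "y \<le> (\<Sum>k\<in>K. \<bar>c k\<bar>) * trace_norm X" using trace_norm_kraus_le[OF assms(1) X(1)] X(3) by simp
    also have "\<dots> \<le> (\<Sum>k\<in>K. \<bar>c k\<bar>) * 1" using X(2) by (intro mult_left_mono sum_nonneg) auto
    finally show "y \<le> (\<Sum>k\<in>K. \<bar>c k\<bar>)" by simp
  qed
qed

text \<open>The Hilbert-Schmidt inner product, conjugate-linear in \<open>G\<close>.\<close>

definition hs :: "complex mat \<Rightarrow> complex mat \<Rightarrow> complex" where
  "hs G A = (\<Sum>a<2. \<Sum>b<2. cnj (G $$ (a,b)) * A $$ (a,b))"

text \<open>Applied to the Bell vector, 1 (x) A lists the entries of \<open>A\<close> column by
  column. Overlaps of such vectors are therefore Hilbert-Schmidt products.\<close>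

lemma lift_bell_index:
  assumes "A \<in> carrier_mat 2 2" "r < 4"
  shows "(lift A * bell) $$ (r,0) = A $$ (r mod 2, r div 2) / complex_of_real (sqrt 2)"
  using assms less_4_disj[OF assms(2)]
  by (subst mult_index[of _ 4 4 _ 1]) (auto simp: sum_lessThan_4 lift_def bell_def)

lemma inner_lift_bell:
  assumes "G \<in> carrier_mat 2 2" "A \<in> carrier_mat 2 2"
  shows "(adj (lift G * bell) * (lift A * bell)) $$ (0,0) = hs G A / 2"
proof -
  have c: "lift M * bell \<in> carrier_mat 4 1" for M by (intro mult_carrier_mat[of _ 4 4] lift_carrier bell_carrier)
  have s2: "complex_of_real (sqrt 2) * complex_of_real (sqrt 2) = 2" by (simp flip: of_real_mult)
  show ?thesis unfolding inner_index[OF c c]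
    using assms by (simp add: lift_bell_index sum_lessThan_4 sum_lessThan_2 hs_def s2 add_divide_distrib del: index_mult_mat(1))
qed

text \<open>The test input is the maximally entangled state, the test reflection is along the Choi vector of G.\<close>
lemma diamond_norm_ge:
  assumes K: "kraus_comb K c A \<Phi>" and G: "G \<in> carrier_mat 2 2" and N: "hs G G = complex_of_real N" "N > 0"
  shows "(\<Sum>k\<in>K. c k * (cmod (hs G (A k)))\<^sup>2) - N * (\<Sum>k\<in>K. c k) \<le> N * diamond_norm \<Phi>"
proof -
  define x where "x = lift G * bell"
  define X where "X = bell * adj bell"
  define \<phi> where "\<phi> k = lift (A k) * bell" for k
  define M where "M = id_tensor \<Phi> X"
  have x: "x \<in> carrier_mat 4 1" unfolding x_def by (intro mult_carrier_mat[of _ 4 4] lift_carrier bell_carrier)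
  have \<phi>: "\<phi> k \<in> carrier_mat 4 1" for k unfolding \<phi>_def by (intro mult_carrier_mat[of _ 4 4] lift_carrier bell_carrier)
  have X: "X \<in> carrier_mat 4 4" unfolding X_def by (intro mult_carrier_mat[of _ 4 1] adj_carrier bell_carrier)
  have M: "M \<in> carrier_mat 4 4" unfolding M_def by (rule id_tensor_carrier)
  have Ak: "unitary2 (A k)" if "k \<in> K" for k using K that by (simp add: kraus_comb_def)
  have nx: "nrm2 x = N / 2" unfolding nrm2_def x_def inner_lift_bell[OF G G] N(1) by simp
  have LXL: "lift (A k) * X * adj (lift (A k)) = \<phi> k * adj (\<phi> k)" for k
    using carrier_dims[OF lift_carrier[of "A k"]] carrier_dims[OF bell_carrier]
    by (simp add: X_def \<phi>_def mult_assoc_dim adj_mult_dim del: assoc_mult_mat)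
  \<comment> \<open>The output \<open>M\<close> is the sum of the \<open>c k\<close> times the
    projections onto \<open>\<phi> k\<close>, so a trace against \<open>M\<close> reduces to
    quadratic forms at these vectors.\<close>
  have tr: "mtrace (B * M) = (\<Sum>k\<in>K. complex_of_real (c k) * (adj (\<phi> k) * B * \<phi> k) $$ (0,0))" if B: "B \<in> carrier_mat 4 4" for B
    unfolding M_def mtrace_id_tensor_kraus[OF K X B] LXL
  proof (intro sum.cong refl arg_cong2[where f = "(*)"])
    fix k
    have "mtrace (B * (\<phi> k * adj (\<phi> k))) = mtrace ((B * \<phi> k) * adj (\<phi> k))"
      using carrier_dims[OF B] carrier_dims[OF \<phi>[of k]] by (simp add: mult_assoc_dim del: assoc_mult_mat)
    also have "\<dots> = mtrace (adj (\<phi> k) * (B * \<phi> k))"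
      using B \<phi> by (intro mtrace_comm[of _ 4 1] mult_carrier_mat[of _ 4 4] adj_carrier)
    also have "adj (\<phi> k) * (B * \<phi> k) = adj (\<phi> k) * B * \<phi> k"
      using carrier_dims[OF B] carrier_dims[OF \<phi>[of k]] by (simp add: mult_assoc_dim del: assoc_mult_mat)
    also have "mtrace (adj (\<phi> k) * B * \<phi> k) = (adj (\<phi> k) * B * \<phi> k) $$ (0,0)"
      using carrier_dims[OF \<phi>[of k]] by (simp add: mtrace_def del: index_mult_mat(1))
    finally show "mtrace (B * (\<phi> k * adj (\<phi> k))) = (adj (\<phi> k) * B * \<phi> k) $$ (0,0)" .
  qed
  have trM: "mtrace M = complex_of_real (\<Sum>k\<in>K. c k)"
  proof -
    have "mtrace M = mtrace (1\<^sub>m 4 * M)" using M by simp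
    also have "\<dots> = (\<Sum>k\<in>K. complex_of_real (c k) * (adj (\<phi> k) * 1\<^sub>m 4 * \<phi> k) $$ (0,0))"
      by (rule tr) simp
    also have "\<dots> = (\<Sum>k\<in>K. complex_of_real (c k))"
    proof (intro sum.cong refl)
      fix k assume k: "k \<in> K"
      have "(adj (\<phi> k) * 1\<^sub>m 4 * \<phi> k) $$ (0,0) = complex_of_real (nrm2 (\<phi> k))"
        unfolding right_mult_one_mat[OF adj_carrier[OF \<phi>]] inner_self(1)[OF \<phi>] ..
      also have "nrm2 (\<phi> k) = 1"
        unfolding \<phi>_def nrm2_unitary[OF lift_carrier lift_unitary[OF Ak[OF k]] bell_carrier] nrm2_bell ..
      finally show "complex_of_real (c k) * (adj (\<phi> k) * 1\<^sub>m 4 * \<phi> k) $$ (0,0) = complex_of_real (c k)" by simp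
    qed
    finally show ?thesis by simp
  qed
  have xx: "x * adj x \<in> carrier_mat 4 4" using x by (intro mult_carrier_mat adj_carrier)
  \<comment> \<open>The form of \<open>M\<close> at \<open>x\<close> is the trace of
    \<open>x * adj x\<close> against \<open>M\<close>, so \<open>tr\<close> applies again; the terms
    become squared overlaps with the Choi vector of \<open>G\<close>.\<close>
  have qM: "(adj x * M * x) $$ (0,0) = complex_of_real (\<Sum>k\<in>K. c k * (cmod (hs G (A k)) / 2)\<^sup>2)"
  proof -
    have "(adj x * M * x) $$ (0,0) = mtrace (adj x * (M * x))"
      using carrier_dims[OF x] carrier_dims[OF M] by (simp add: mtrace_def mult_assoc_dim del: index_mult_mat(1) assoc_mult_mat)
    also have "\<dots> = mtrace ((M * x) * adj x)"
      using x M by (intro mtrace_comm[of _ 1 4] mult_carrier_mat[of _ 4 4] adj_carrier)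
    also have "\<dots> = mtrace (M * (x * adj x))"
      using carrier_dims[OF x] carrier_dims[OF M] by (simp add: mult_assoc_dim del: assoc_mult_mat)
    also have "\<dots> = mtrace ((x * adj x) * M)" by (rule mtrace_comm[OF M xx])
    also have "\<dots> = (\<Sum>k\<in>K. complex_of_real (c k) * (adj (\<phi> k) * (x * adj x) * \<phi> k) $$ (0,0))" by (rule tr[OF xx])
    also have "\<dots> = (\<Sum>k\<in>K. complex_of_real (c k * (cmod (hs G (A k)) / 2)\<^sup>2))"
    proof (intro sum.cong refl)
      fix k assume k: "k \<in> K"
      have xk: "(adj x * \<phi> k) $$ (0,0) = hs G (A k) / 2"
        unfolding x_def \<phi>_def by (rule inner_lift_bell[OF G unitary2D(1)[OF Ak[OF k]]])
      have kx: "(adj (\<phi> k) * x) $$ (0,0) = cnj ((adj x * \<phi> k) $$ (0,0))"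
        unfolding inner_index[OF \<phi> x] inner_index[OF x \<phi>] by (simp add: mult.commute)
      have "adj (\<phi> k) * (x * adj x) * \<phi> k = (adj (\<phi> k) * x) * (adj x * \<phi> k)"
        using carrier_dims[OF x] carrier_dims[OF \<phi>[of k]] by (simp add: mult_assoc_dim del: assoc_mult_mat)
      also have "\<dots> $$ (0,0) = (adj (\<phi> k) * x) $$ (0,0) * (adj x * \<phi> k) $$ (0,0)"
        using x \<phi>[of k] by (subst mult_index[of _ 1 1 _ 1]) (auto intro!: mult_carrier_mat)
      finally have "(adj (\<phi> k) * (x * adj x) * \<phi> k) $$ (0,0) = complex_of_real ((cmod (hs G (A k)) / 2)\<^sup>2)"
        unfolding kx xk by (simp add: complex_norm_square power_divide mult.commute del: of_real_power)
      then show "complex_of_real (c k) * (adj (\<phi> k) * (x * adj x) * \<phi> k) $$ (0,0) = complex_of_real (c k * (cmod (hs G (A k)) / 2)\<^sup>2)"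
        by simp
    qed
    finally show ?thesis by simp
  qed
  have "2 * (\<Sum>k\<in>K. c k * (cmod (hs G (A k)) / 2)\<^sup>2) - N / 2 * (\<Sum>k\<in>K. c k) \<le> N / 2 * trace_norm M"
    using trace_norm_reflection[OF M x] nx N(2) unfolding qM trM by simp
  also have "\<dots> \<le> N / 2 * diamond_norm \<Phi>"
    unfolding M_def using N(2) diamond_norm_ge_trace_norm[OF K X] trace_norm_bell by (intro mult_left_mono) (auto simp: X_def)
  finally show ?thesis by (simp add: power_divide flip: sum_divide_distrib)
qed

section \<open>Unit quaternions\<close>

text \<open>The matrix r 0 + i (r 1 Z + r 2 X - r 3 Y): up to a phase, r is its coordinate vector in the magic basis.\<close>
definition quat :: "(nat \<Rightarrow> real) \<Rightarrow> complex mat" where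
  "quat r = mat 2 2 (\<lambda>(i,j). if i = 0 then (if j = 0 then Complex (r 0) (r 1) else Complex (- r 3) (r 2))
     else (if j = 0 then Complex (r 3) (r 2) else Complex (r 0) (- r 1)))"

definition dot4 :: "(nat \<Rightarrow> real) \<Rightarrow> (nat \<Rightarrow> real) \<Rightarrow> real" where
  "dot4 x y = x 0 * y 0 + x 1 * y 1 + x 2 * y 2 + x 3 * y 3"

lemma quat_carrier [simp]: "quat r \<in> carrier_mat 2 2"
  by (simp add: quat_def)

lemma less_2_disj: "(i::nat) < 2 \<Longrightarrow> i = 0 \<or> i = 1"
  by auto

text \<open>Orthonormal rows force the second row to be D (-conj b, conj a), with (a, b) the first
  row and D the determinant. Dividing by a square root of D leads into SU(2), whose elements are the
  unit quaternions.\<close>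

lemma unitary_quat:
  assumes U: "unitary2 U"
  shows "\<exists>w r. cmod w = 1 \<and> dot4 r r = 1 \<and> U = w \<cdot>\<^sub>m quat r"
proof -
  note Uc = unitary2D(1)[OF U]
  define a where "a = U $$ (0,0)"
  define b where "b = U $$ (0,1)"
  define c where "c = U $$ (1,0)"
  define d where "d = U $$ (1,1)"
  have row: "U $$ (i,0) * cnj (U $$ (j,0)) + U $$ (i,1) * cnj (U $$ (j,1)) = (if i = j then 1 else 0)" if "i < 2" "j < 2" for i j
  proof -
    have "(U * adj U) $$ (i,j) = U $$ (i,0) * cnj (U $$ (j,0)) + U $$ (i,1) * cnj (U $$ (j,1))"
      using that Uc by (subst mult_index[of _ 2 2 _ 2]) (auto simp: sum_lessThan_2 adj_index[of _ 2 2])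
    then show ?thesis using unitary2D(2)[OF U] that by simp
  qed
  have aa: "a * cnj a + b * cnj b = 1" and cc: "c * cnj c + d * cnj d = 1" and ca: "c * cnj a + d * cnj b = 0"
    using row[of 0 0] row[of 1 1] row[of 1 0] by (simp_all add: a_def b_def c_def d_def)
  define D where "D = a * d - b * c"
  have d: "d = D * cnj a"
  proof -
    have "D * cnj a = (a * cnj a) * d - b * (c * cnj a)" by (simp add: D_def algebra_simps)
    also have "c * cnj a = - d * cnj b" using ca by (simp add: add_eq_0_iff2)
    also have "(a * cnj a) * d - b * (- d * cnj b) = (a * cnj a + b * cnj b) * d" by (simp add: algebra_simps)
    finally show ?thesis using aa by simp
  qed
  have c: "c = - (D * cnj b)"
  proof -
    have "D * cnj b = a * (d * cnj b) - (b * cnj b) * c" by (simp add: D_def algebra_simps)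
    also have "d * cnj b = - (c * cnj a)" using ca by (simp add: add_eq_0_iff)
    also have "a * (- (c * cnj a)) - (b * cnj b) * c = - (a * cnj a + b * cnj b) * c" by (simp add: algebra_simps)
    finally show ?thesis using aa by simp
  qed
  have "D * cnj D = (D * cnj D) * (a * cnj a + b * cnj b)" by (simp add: aa)
  also have "\<dots> = 1" using cc unfolding c d by (simp add: algebra_simps)
  finally have "complex_of_real ((cmod D)\<^sup>2) = 1" by (simp add: complex_norm_square del: of_real_power)
  then have "(cmod D)\<^sup>2 = 1" using of_real_eq_1_iff by blast
  then have cD: "cmod D = 1" by (metis norm_ge_zero power2_eq_1_iff order_trans zero_le_one neg_0_le_iff_le not_one_le_zero)
  define w where "w = csqrt D"
  have w2: "w * w = D" by (simp add: w_def flip: power2_eq_square)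
  have cw: "cmod w = 1" using cD by (simp add: w_def)
  have ww: "w * cnj w = 1" using cw by (simp add: complex_norm_square[symmetric])
  define r where "r k = (if k = 0 then Re (a * cnj w) else if k = 1 then Im (a * cnj w) else if k = 2 then Im (b * cnj w) else - Re (b * cnj w))" for k :: nat
  have e: "Complex (r 0) (r 1) = a * cnj w" "Complex (- r 3) (r 2) = b * cnj w" "Complex (r 3) (r 2) = - cnj (b * cnj w)"
    "Complex (r 0) (- r 1) = cnj (a * cnj w)"
    by (simp_all add: r_def complex_eq_iff)
  have "complex_of_real (dot4 r r) = (a * cnj w) * cnj (a * cnj w) + (b * cnj w) * cnj (b * cnj w)"
    unfolding complex_norm_square[symmetric] cmod_power2 by (simp add: dot4_def r_def power2_eq_square algebra_simps)
  also have "\<dots> = (w * cnj w) * (a * cnj a + b * cnj b)" by (simp add: algebra_simps)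
  finally have "complex_of_real (dot4 r r) = 1" using ww aa by simp
  then have nr: "dot4 r r = 1" using of_real_eq_1_iff by blast
  have "U = w \<cdot>\<^sub>m quat r"
  proof (rule eq_matI)
    fix i j assume "i < dim_row (w \<cdot>\<^sub>m quat r)" "j < dim_col (w \<cdot>\<^sub>m quat r)"
    then have ij: "i < 2" "j < 2" by (auto simp: quat_def)
    have "w * (a * cnj w) = a" "w * (b * cnj w) = b" using ww by (simp_all add: algebra_simps)
    moreover have "w * (- cnj (b * cnj w)) = c" "w * cnj (a * cnj w) = d"
      unfolding c d w2[symmetric] by (simp_all add: algebra_simps)
    ultimately show "U $$ (i,j) = (w \<cdot>\<^sub>m quat r) $$ (i,j)"
      using less_2_disj[OF ij(1)] less_2_disj[OF ij(2)]
      by (auto simp: quat_def e a_def b_def c_def d_def simp del: One_nat_def)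
  qed (use Uc in \<open>auto simp: quat_def\<close>)
  with cw nr show ?thesis by blast
qed

lemma unitary2_adj: "unitary2 U \<Longrightarrow> unitary2 (adj U)"
  unfolding unitary2_def[of "adj U"] adj_adj by (blast intro: adj_carrier dest: unitary2D)

lemma unitary2_mult:
  assumes "unitary2 U" "unitary2 V"
  shows "unitary2 (U * V)"
proof -
  note u = unitary2D[OF assms(1)] and v = unitary2D[OF assms(2)]
  have "U * V * adj (U * V) = U * (V * adj V) * adj U"
    using carrier_dims[OF u(1)] carrier_dims[OF v(1)] by (simp add: mat_algebra del: assoc_mult_mat)
  also have "\<dots> = 1\<^sub>m 2" unfolding v(2) right_mult_one_mat[OF u(1)] u(2) ..
  finally show ?thesis using u(1) v(1) by (simp add: unitary2_def)
qed

lemma hs_mtrace: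
  assumes "G \<in> carrier_mat 2 2" "A \<in> carrier_mat 2 2"
  shows "hs G A = mtrace (adj G * A)"
  using assms by (simp add: mtrace_mult[of _ 2] adj_index[of _ 2 2] hs_def sum_lessThan_2)

text \<open>Right multiplication by a unitary is an isometry, so a common target \<open>V\<close>
  drops out of all overlaps and only relative quaternions matter.\<close>

lemma hs_mult_unitary:
  assumes G: "G \<in> carrier_mat 2 2" and A: "A \<in> carrier_mat 2 2" and V: "unitary2 V"
  shows "hs (G * V) (A * V) = hs G A"
proof -
  note v = unitary2D[OF V]
  note d = carrier_dims[OF v(1)] carrier_dims[OF G] carrier_dims[OF A]
  have c: "G * V \<in> carrier_mat 2 2" "A * V \<in> carrier_mat 2 2" using G A v by auto
  have "hs (G * V) (A * V) = mtrace (adj V * (adj G * A * V))"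
    unfolding hs_mtrace[OF c] using d by (simp add: mat_algebra del: assoc_mult_mat)
  also have "\<dots> = mtrace ((adj G * A * V) * adj V)"
    using G A v by (intro mtrace_comm[of _ 2 2] mult_carrier_mat[of _ 2 2] adj_carrier)
  also have "(adj G * A * V) * adj V = adj G * A * (V * adj V)"
    using d by (simp add: mat_algebra del: assoc_mult_mat)
  also have "\<dots> = adj G * A" unfolding v(2) using G A by (intro right_mult_one_mat[of _ 2 2] mult_carrier_mat[of _ 2 2] adj_carrier)
  finally show ?thesis using hs_mtrace[OF G A] by simp
qed

lemma hs_quat: "hs (quat x) (w \<cdot>\<^sub>m quat y) = w * complex_of_real (2 * dot4 x y)"
  unfolding hs_def sum_lessThan_2 by (simp add: quat_def dot4_def complex_eq_iff algebra_simps)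

lemma hs_quat_unitary:
  assumes V: "unitary2 V"
  shows "hs (quat x * V) (w \<cdot>\<^sub>m quat y * V) = w * complex_of_real (2 * dot4 x y)"
  using hs_mult_unitary[OF quat_carrier _ V] by (simp add: hs_quat)

lemma dot4_Cauchy_Schwarz: "(dot4 x y)\<^sup>2 \<le> dot4 x x * dot4 y y"
proof -
  have *: "dot4 u v = (\<Sum>i<4. u i * v i)" for u v by (simp add: dot4_def sum_lessThan_4)
  show ?thesis using Cauchy_Schwarz_ineq_sum[of x y "{..<4}"] by (simp add: * power2_eq_square)
qed

lemma unitary_channel_carrier:
  assumes "A \<in> carrier_mat 2 2" "\<rho> \<in> carrier_mat 2 2"
  shows "unitary_channel A \<rho> \<in> carrier_mat 2 2"
  using assms unfolding unitary_channel_def by (intro mult_carrier_mat[of _ 2 2] adj_carrier)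

text \<open>The test vector is proportional to the top eigenvector of e e^T - r r^T.\<close>
lemma unitary_channel_diamond_overlap:
  assumes V: "unitary2 V" and U: "unitary2 U1" "unitary2 U2"
    and w: "cmod w1 = 1" "cmod w2 = 1" and n: "dot4 e e = 1" "dot4 r r = 1"
    and U1: "U1 = w1 \<cdot>\<^sub>m quat e * V" and U2: "U2 = w2 \<cdot>\<^sub>m quat r * V"
    and le: "1/2 * diamond_norm (map_diff (unitary_channel U1) (unitary_channel U2)) \<le> \<epsilon>"
  shows "1 - (dot4 e r)\<^sup>2 \<le> \<epsilon>\<^sup>2"
proof -
  define \<Phi> where "\<Phi> = map_diff (unitary_channel U1) (unitary_channel U2)"
  define t where "t = dot4 e r"
  define l where "l = sqrt (1 - t\<^sup>2)"
  have t1: "t\<^sup>2 \<le> 1" using dot4_Cauchy_Schwarz[of e r] n by (simp add: t_def)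
  have l2: "l\<^sup>2 = 1 - t\<^sup>2" and l0: "l \<ge> 0" using t1 by (simp_all add: l_def)
  show ?thesis
  \<comment> \<open>\<open>l\<close> is the sine of the angle between \<open>e\<close> and
    \<open>r\<close>. If it is 0, then \<open>e\<close> and \<open>r\<close> agree up to sign and
    the test vector below would vanish.\<close>
  proof (cases "l = 0")
    case True
    then show ?thesis using l2 by (simp add: t_def)
  next
    case False
    with l0 have lp: "l > 0" by simp
    define c where "c k = (if k = 0 then 1 else - 1 :: real)" for k :: nat
    define A where "A k = (if k = 0 then U1 else U2)" for k :: nat
    \<comment> \<open>Solves the eigenvalue equation of e e^T - r r^T for the eigenvalue
      \<open>l\<close> within the span of \<open>e\<close> and \<open>r\<close>. Hence (g.e)^2 -
      (g.r)^2 = l (g.g), and the lower bound loses nothing against 2 l.\<close>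
    define g where "g k = (1 + l) * e k - t * r k" for k
    have K: "kraus_comb {0,1} c A \<Phi>"
      unfolding kraus_comb_def
    proof (intro conjI ballI allI impI)
      fix \<rho> :: "complex mat" and a b :: nat assume \<rho>: "\<rho> \<in> carrier_mat 2 2" and ab: "a < 2" "b < 2"
      show "\<Phi> \<rho> $$ (a,b) = (\<Sum>k\<in>{0,1}. complex_of_real (c k) * (A k * \<rho> * adj (A k)) $$ (a,b))"
        using carrier_dims[OF unitary_channel_carrier[OF unitary2D(1)[OF U(1)] \<rho>]] carrier_dims[OF unitary_channel_carrier[OF unitary2D(1)[OF U(2)] \<rho>]] ab
        by (simp add: \<Phi>_def map_diff_def c_def A_def unitary_channel_def del: index_mult_mat(1))
    qed (use U in \<open>auto simp: A_def\<close>)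
    have gd: "dot4 g x = (1 + l) * dot4 e x - t * dot4 r x" for x
      by (simp add: dot4_def g_def algebra_simps)
    have sym: "dot4 x y = dot4 y x" for x y by (simp add: dot4_def mult.commute)
    have ge: "dot4 g e = l * (1 + l)" unfolding gd using n sym[of r e] l2 by (simp add: t_def power2_eq_square algebra_simps)
    have gr: "dot4 g r = t * l" unfolding gd using n by (simp add: t_def algebra_simps)
    have gg: "dot4 g g = 2 * l\<^sup>2 * (1 + l)"
    proof -
      have "dot4 g g = (1 + l) * (l * (1 + l)) - t * (t * l)" unfolding gd[of g] sym[of e g] sym[of r g] ge gr ..
      also have "\<dots> = (1 + l) * (l * (1 + l)) - l * t\<^sup>2" by (simp add: power2_eq_square)
      also have "t\<^sup>2 = 1 - l\<^sup>2" using l2 by simp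
      finally show ?thesis by (simp add: power2_eq_square algebra_simps)
    qed
    define G where "G = quat g * V"
    have G: "G \<in> carrier_mat 2 2" unfolding G_def using unitary2D(1)[OF V] by (intro mult_carrier_mat[of _ 2 2] quat_carrier)
    have GG: "hs G G = complex_of_real (2 * dot4 g g)"
    proof -
      have "1 \<cdot>\<^sub>m quat g = quat g" by (rule eq_matI) auto
      then show ?thesis using hs_mult_unitary[OF quat_carrier quat_carrier V, of g g] hs_quat[of g 1 g] by (simp add: G_def)
    qed
    have "hs G U1 = w1 * complex_of_real (2 * dot4 g e)" "hs G U2 = w2 * complex_of_real (2 * dot4 g r)"
      unfolding G_def U1 U2 by (rule hs_quat_unitary[OF V])+
    then have h: "(cmod (hs G U1))\<^sup>2 = (2 * dot4 g e)\<^sup>2" "(cmod (hs G U2))\<^sup>2 = (2 * dot4 g r)\<^sup>2"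
      using w by (simp_all only: norm_mult norm_of_real power2_abs mult_1)
    have "2 * dot4 g g > 0" unfolding gg using lp by simp
    from diamond_norm_ge[OF K G GG this]
    have "(2 * dot4 g e)\<^sup>2 - (2 * dot4 g r)\<^sup>2 \<le> 2 * dot4 g g * diamond_norm \<Phi>"
      by (simp add: c_def A_def h)
    moreover have "(2 * dot4 g e)\<^sup>2 - (2 * dot4 g r)\<^sup>2 = (2 * dot4 g g) * (2 * l)"
    proof -
      have "(2 * dot4 g e)\<^sup>2 - (2 * dot4 g r)\<^sup>2 = 4 * l\<^sup>2 * ((1 + l)\<^sup>2 - t\<^sup>2)"
        unfolding ge gr by (simp add: power2_eq_square algebra_simps)
      also have "t\<^sup>2 = 1 - l\<^sup>2" using l2 by simp
      finally show ?thesis unfolding gg by (simp add: power2_eq_square algebra_simps)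
    qed
    ultimately have "2 * l \<le> diamond_norm \<Phi>" using \<open>2 * dot4 g g > 0\<close> by (metis mult_le_cancel_left_pos)
    then have "l \<le> \<epsilon>" using le by (simp add: \<Phi>_def)
    then have "l\<^sup>2 \<le> \<epsilon>\<^sup>2" using l0 by (intro power_mono)
    then show ?thesis using l2 by (simp add: t_def)
  qed
qed

lemma conj_index:
  assumes A: "A \<in> carrier_mat 2 2" and R: "\<rho> \<in> carrier_mat 2 2" and B: "B \<in> carrier_mat 2 2" and ab: "a < 2" "b < 2"
  shows "(A * \<rho> * B) $$ (a,b) = (\<Sum>d<2. (\<Sum>c<2. A $$ (a,c) * \<rho> $$ (c,d)) * B $$ (d,b))"
  unfolding mult_index[OF mult_carrier_mat[OF A R] B ab]
  by (intro sum.cong refl) (simp only: mult_index[OF A R ab(1)] lessThan_iff)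

text \<open>The phase cancels against its conjugate. What remains separates the entries of the input
  from coefficients quadratic in \<open>r\<close>, ready for averaging.\<close>

lemma quat_conj:
  assumes "W = w \<cdot>\<^sub>m quat r" "cmod w = 1" "\<rho> \<in> carrier_mat 2 2" "a < 2" "b < 2"
  shows "(W * \<rho> * adj W) $$ (a,b) = (\<Sum>c<2. \<Sum>d<2. \<rho> $$ (c,d) * (quat r $$ (a,c) * cnj (quat r $$ (b,d))))"
proof -
  have W: "W \<in> carrier_mat 2 2" unfolding assms(1) by simp
  have Wi: "W $$ (i,j) = w * quat r $$ (i,j)" if "i < 2" "j < 2" for i j unfolding assms(1) using that by (simp add: quat_def)
  have one_less_2: "(1::nat) < 2" by simp
  have ww: "w * cnj w = 1" using assms(2) by (simp add: complex_norm_square[symmetric])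
  have "(W * \<rho> * adj W) $$ (a,b) = (\<Sum>d<2. (\<Sum>c<2. W $$ (a,c) * \<rho> $$ (c,d)) * cnj (W $$ (b,d)))"
    unfolding conj_index[OF W assms(3) adj_carrier[OF W] assms(4,5)] using assms(5)
    by (intro sum.cong refl) (simp only: adj_index[OF W] lessThan_iff)
  also have "\<dots> = (w * cnj w) * (\<Sum>c<2. \<Sum>d<2. \<rho> $$ (c,d) * (quat r $$ (a,c) * cnj (quat r $$ (b,d))))"
    unfolding sum_lessThan_2 Wi[OF assms(4) pos2] Wi[OF assms(4) one_less_2] Wi[OF assms(5) pos2] Wi[OF assms(5) one_less_2] complex_cnj_mult
    by (simp only: ring_distribs mult_ac add_ac)
  finally show ?thesis by (simp only: ww mult_1_left)
qed

section \<open>Choi matrices in the magic basis\<close>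

lemma channel_comp_adj:
  assumes U: "U \<in> carrier_mat 2 2" and V: "V \<in> carrier_mat 2 2" and \<rho>: "\<rho> \<in> carrier_mat 2 2"
  shows "unitary_channel U (unitary_channel (adj V) \<rho>) = (U * adj V) * \<rho> * adj (U * adj V)"
  unfolding unitary_channel_def using carrier_dims[OF U] carrier_dims[OF V] carrier_dims[OF \<rho>]
  by (simp add: mat_algebra del: assoc_mult_mat)

text \<open>The Choi matrix of a conjugation is the rank-one matrix of \<open>W\<close> read column
  by column.\<close>

lemma choi_index:
  assumes \<Phi>: "\<And>\<rho>. \<rho> \<in> carrier_mat 2 2 \<Longrightarrow> \<Phi> \<rho> = W * \<rho> * adj W" and W: "W \<in> carrier_mat 2 2" and rs: "r < 4" "s < 4"
  shows "choi \<Phi> $$ (r,s) = W $$ (r mod 2, r div 2) * cnj (W $$ (s mod 2, s div 2))"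
proof -
  have B: "block2 Omega_proj (r div 2) (s div 2) \<in> carrier_mat 2 2" by (simp add: block2_def)
  have "choi \<Phi> $$ (r,s) = (W * block2 Omega_proj (r div 2) (s div 2) * adj W) $$ (r mod 2, s mod 2)"
    unfolding choi_def id_tensor_def using rs by (simp add: \<Phi>[OF B] del: index_mult_mat(1))
  also have "\<dots> = (\<Sum>d<2. (\<Sum>c<2. W $$ (r mod 2,c) * block2 Omega_proj (r div 2) (s div 2) $$ (c,d)) * cnj (W $$ (s mod 2,d)))"
    using rs conj_index[OF W B adj_carrier[OF W], of "r mod 2" "s mod 2"] by (auto simp: adj_index[OF W] simp del: index_mult_mat(1) intro!: sum.cong)
  also have "\<dots> = W $$ (r mod 2, r div 2) * cnj (W $$ (s mod 2, s div 2))"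
    using less_4_disj[OF rs(1)] less_4_disj[OF rs(2)] by (auto simp: sum_lessThan_2 block2_def Omega_proj_def)
  finally show ?thesis .
qed

text \<open>In the magic basis the Choi vector has coordinates sqrt 2 w r_k with one common phase.
  That makes the matrix real, and it dictates the placement and signs of the components in
  \<open>quat\<close>.\<close>

lemma magic_choi_quat:
  assumes \<Phi>: "\<And>\<rho>. \<rho> \<in> carrier_mat 2 2 \<Longrightarrow> \<Phi> \<rho> = W * \<rho> * adj W" and W: "W = w \<cdot>\<^sub>m quat r" "cmod w = 1" and ab: "a < 4" "b < 4"
  shows "((1/2) \<cdot>\<^sub>m magic (choi \<Phi>)) $$ (a,b) = complex_of_real (r a * r b)"
proof -
  have Wc: "W \<in> carrier_mat 2 2" unfolding W by simp
  have ww: "w * cnj w = 1" using W(2) by (simp add: complex_norm_square[symmetric])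
  have s2: "complex_of_real (sqrt 2) * complex_of_real (sqrt 2) = 2" by (simp flip: of_real_mult)
  \<comment> \<open>The coordinate of the Choi vector of \<open>W\<close>; \<open>psi\<close> counts
    from 1 while matrix indices start at 0.\<close>
  define g where "g k = (\<Sum>r<4. cnj (psi (k+1) r) * W $$ (r mod 2, r div 2))" for k
  have g: "g k = complex_of_real (sqrt 2) * w * complex_of_real (r k)" if "k < 4" for k
  proof -
    have "complex_of_real (sqrt 2) * g k = 2 * w * complex_of_real (r k)"
      using less_4_disj[OF that] unfolding g_def W(1)
      by (auto simp: sum_lessThan_4 psi_def Let_def quat_def complex_eq_iff algebra_simps)
    also have "\<dots> = complex_of_real (sqrt 2) * (complex_of_real (sqrt 2) * w * complex_of_real (r k))"
      by (simp only: mult.assoc[symmetric] s2)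
    finally show ?thesis by simp
  qed
  have "magic (choi \<Phi>) $$ (a,b) = (\<Sum>r<4. \<Sum>s<4. cnj (psi (a+1) r) * choi \<Phi> $$ (r,s) * psi (b+1) s)"
    using ab by (simp add: magic_def)
  also have "\<dots> = (\<Sum>r<4. \<Sum>s<4. (cnj (psi (a+1) r) * W $$ (r mod 2, r div 2)) * cnj (cnj (psi (b+1) s) * W $$ (s mod 2, s div 2)))"
    by (intro sum.cong refl) (simp add: choi_index[OF \<Phi> Wc])
  also have "\<dots> = g a * cnj (g b)" unfolding g_def cnj_sum sum_product ..
  also have "\<dots> = (complex_of_real (sqrt 2) * complex_of_real (sqrt 2)) * (w * cnj w) * complex_of_real (r a * r b)"
    using ab by (simp add: g)
  finally show ?thesis using ab by (simp add: s2 ww magic_def)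
qed

lemma quat_uminus: "(- w) \<cdot>\<^sub>m quat (\<lambda>k. - r k) = w \<cdot>\<^sub>m quat r"
  by (rule eq_matI) (auto simp: quat_def complex_eq_iff)

lemma relative_unitary:
  assumes "unitary2 V" "unitary2 U" "U * adj V = W"
  shows "U = W * V"
proof -
  note v = unitary2D[OF assms(1)] and u = unitary2D[OF assms(2)]
  have "W * V = U * (adj V * V)" unfolding assms(3)[symmetric]
    using carrier_dims[OF v(1)] carrier_dims[OF u(1)] by (simp add: mat_algebra del: assoc_mult_mat)
  then show ?thesis unfolding v(3) using u by simp
qed

text \<open>Comparison with e e^T determines the quaternion of \<open>U1\<close> up to a sign. The
  quaternion of \<open>U2\<close> may be negated together with its phase, so its overlap with
  \<open>e\<close> can be made nonnegative, as the estimates on components and angles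
  require.\<close>

lemma relative_rotation:
  assumes V: "unitary2 V" and U1: "unitary2 U1" and U2: "unitary2 U2"
    and e: "dot4 e e = 1" "e 0 > 0"
    and choi: "(1/2) \<cdot>\<^sub>m magic (choi (unitary_channel U1 \<circ> unitary_channel (adj V))) = mat 4 4 (\<lambda>(a,b). complex_of_real (e a * e b))"
    and le: "1/2 * diamond_norm (map_diff (unitary_channel U1) (unitary_channel U2)) \<le> \<epsilon>"
  shows "\<exists>w r. cmod w = 1 \<and> dot4 r r = 1 \<and> U2 * adj V = w \<cdot>\<^sub>m quat r \<and> 0 \<le> dot4 e r \<and> 1 - (dot4 e r)\<^sup>2 \<le> \<epsilon>\<^sup>2"
proof -
  note v = unitary2D[OF V] and u1 = unitary2D[OF U1] and u2 = unitary2D[OF U2]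
  from unitary_quat[OF unitary2_mult[OF U1 unitary2_adj[OF V]]] obtain w1 r1
    where w1: "cmod w1 = 1" and r1: "dot4 r1 r1 = 1" and W1: "U1 * adj V = w1 \<cdot>\<^sub>m quat r1" by blast
  have re: "r1 a * r1 b = e a * e b" if "a < 4" "b < 4" for a b
  proof -
    have "complex_of_real (r1 a * r1 b) = complex_of_real (e a * e b)"
      using magic_choi_quat[of "unitary_channel U1 \<circ> unitary_channel (adj V)", OF _ W1 w1 that] channel_comp_adj[OF u1(1) v(1)] choi that
      by simp
    then show ?thesis by (simp only: of_real_eq_iff)
  qed
  \<comment> \<open>Row 0 of r1 r1^T = e e^T gives r1 = s e with s = 1 or s = -1, because
    \<open>e 0\<close> is nonzero.\<close>
  define s where "s = r1 0 / e 0"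
  have s2: "s * s = 1" using re[of 0 0] e(2) by (simp add: s_def)
  have rs: "r1 k = s * e k" if "k < 4" for k
  proof -
    have "(s * s) * r1 k = s * e k" using re[of 0 k] that e(2) by (simp add: s_def field_simps)
    then show ?thesis unfolding s2 by simp
  qed
  have "w1 \<cdot>\<^sub>m quat r1 = (complex_of_real s * w1) \<cdot>\<^sub>m quat e"
    by (rule eq_matI) (auto simp: quat_def rs complex_eq_iff algebra_simps)
  then have U1q: "U1 = (complex_of_real s * w1) \<cdot>\<^sub>m quat e * V" using relative_unitary[OF V U1 W1] by simp
  have cs: "cmod (complex_of_real s * w1) = 1" using s2 w1 by (auto simp: norm_mult square_eq_1_iff)
  from unitary_quat[OF unitary2_mult[OF U2 unitary2_adj[OF V]]] obtain w2 r2
    where w2: "cmod w2 = 1" and r2: "dot4 r2 r2 = 1" and W2: "U2 * adj V = w2 \<cdot>\<^sub>m quat r2" by blast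
  define w r where "w = (if dot4 e r2 \<ge> 0 then w2 else - w2)" and "r = (if dot4 e r2 \<ge> 0 then r2 else (\<lambda>k. - r2 k))"
  have wr: "cmod w = 1" "dot4 r r = 1" "U2 * adj V = w \<cdot>\<^sub>m quat r" "0 \<le> dot4 e r"
    using w2 r2 W2 quat_uminus[of w2 r2] by (auto simp: w_def r_def dot4_def)
  have "1 - (dot4 e r)\<^sup>2 \<le> \<epsilon>\<^sup>2"
    by (rule unitary_channel_diamond_overlap[OF V U1 U2 cs wr(1) e(1) wr(2) U1q relative_unitary[OF V U2 wr(3)] le])
  with wr show ?thesis by blast
qed

section \<open>Second moments and depolarizing channels\<close>

lemma depolarizing_index:
  fixes q :: real and \<rho> :: "complex mat"
  assumes "\<rho> \<in> carrier_mat 2 2"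
  defines "E \<equiv> complex_of_real (1 - 3*q) \<cdot>\<^sub>m \<rho> + complex_of_real q \<cdot>\<^sub>m
        (pauliX * \<rho> * pauliX + pauliY * \<rho> * pauliY + pauliZ * \<rho> * pauliZ)"
  shows "E \<in> carrier_mat 2 2"
    "E $$ (0,0) = complex_of_real (1 - 2 * q) * \<rho> $$ (0,0) + complex_of_real (2 * q) * \<rho> $$ (1,1)"
    "E $$ (1,1) = complex_of_real (1 - 2 * q) * \<rho> $$ (1,1) + complex_of_real (2 * q) * \<rho> $$ (0,0)"
    "E $$ (0,1) = complex_of_real (1 - 4 * q) * \<rho> $$ (0,1)"
    "E $$ (1,0) = complex_of_real (1 - 4 * q) * \<rho> $$ (1,0)"
proof -
  have p: "pauliX \<in> carrier_mat 2 2" "pauliY \<in> carrier_mat 2 2" "pauliZ \<in> carrier_mat 2 2"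
    by (simp_all add: pauliX_def pauliY_def pauliZ_def)
  have c: "P * \<rho> * P \<in> carrier_mat 2 2" if "P \<in> carrier_mat 2 2" for P
    using assms(1) that by (intro mult_carrier_mat[of _ 2 2])
  have i: "(P * \<rho> * P) $$ (a,b) = (\<Sum>d<2. (\<Sum>c<2. P $$ (a,c) * \<rho> $$ (c,d)) * P $$ (d,b))" if "P \<in> carrier_mat 2 2" "a < 2" "b < 2" for P a b
    using that assms(1) by (intro conj_index)
  note d = carrier_dims[OF assms(1)] carrier_dims[OF c[OF p(1)]] carrier_dims[OF c[OF p(2)]] carrier_dims[OF c[OF p(3)]] carrier_dims[OF p(1)] carrier_dims[OF p(2)] carrier_dims[OF p(3)]
  show "E \<in> carrier_mat 2 2" by (rule carrier_matI) (use d in \<open>simp_all add: E_def\<close>)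
  have Ei: "E $$ (a,b) = complex_of_real (1 - 3*q) * \<rho> $$ (a,b)
      + complex_of_real q * ((pauliX * \<rho> * pauliX) $$ (a,b) + (pauliY * \<rho> * pauliY) $$ (a,b) + (pauliZ * \<rho> * pauliZ) $$ (a,b))"
    if "a < 2" "b < 2" for a b
    using d that by (simp add: E_def del: index_mult_mat(1))
  have l: "(0::nat) < 2" "(1::nat) < 2" by simp_all
  have e: "pauliX $$ (0,0) = 0" "pauliX $$ (0,1) = 1" "pauliX $$ (1,0) = 1" "pauliX $$ (1,1) = 0"
    "pauliY $$ (0,0) = 0" "pauliY $$ (0,1) = - \<i>" "pauliY $$ (1,0) = \<i>" "pauliY $$ (1,1) = 0"
    "pauliZ $$ (0,0) = 1" "pauliZ $$ (0,1) = 0" "pauliZ $$ (1,0) = 0" "pauliZ $$ (1,1) = - 1"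
    by (simp_all add: pauliX_def pauliY_def pauliZ_def)
  show "E $$ (0,0) = complex_of_real (1 - 2 * q) * \<rho> $$ (0,0) + complex_of_real (2 * q) * \<rho> $$ (1,1)"
    unfolding Ei[OF l(1) l(1)] i[OF p(1) l(1) l(1)] i[OF p(2) l(1) l(1)] i[OF p(3) l(1) l(1)] sum_lessThan_2 e by (simp add: algebra_simps)
  show "E $$ (1,1) = complex_of_real (1 - 2 * q) * \<rho> $$ (1,1) + complex_of_real (2 * q) * \<rho> $$ (0,0)"
    unfolding Ei[OF l(2) l(2)] i[OF p(1) l(2) l(2)] i[OF p(2) l(2) l(2)] i[OF p(3) l(2) l(2)] sum_lessThan_2 e by (simp add: algebra_simps)
  show "E $$ (0,1) = complex_of_real (1 - 4 * q) * \<rho> $$ (0,1)"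
    unfolding Ei[OF l(1) l(2)] i[OF p(1) l(1) l(2)] i[OF p(2) l(1) l(2)] i[OF p(3) l(1) l(2)] sum_lessThan_2 e by (simp add: algebra_simps)
  show "E $$ (1,0) = complex_of_real (1 - 4 * q) * \<rho> $$ (1,0)"
    unfolding Ei[OF l(2) l(1)] i[OF p(1) l(2) l(1)] i[OF p(2) l(2) l(1)] i[OF p(3) l(2) l(1)] sum_lessThan_2 e by (simp add: algebra_simps)
qed

text \<open>Entries of the symmetric matrix sum_j p_j r_j r_j^T, which is half the magic-basis Choi
  matrix of the mixture relative to the target.\<close>

definition moment :: "(nat \<Rightarrow> real) \<Rightarrow> (nat \<Rightarrow> nat \<Rightarrow> real) \<Rightarrow> nat \<Rightarrow> nat \<Rightarrow> real" where
  "moment p r k l = (\<Sum>j\<in>{1..9}. p j * (r j k * r j l))"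

lemma mix9_comp_index:
  assumes V: "unitary2 V" and U: "\<forall>j\<in>{1..9}. unitary2 (U j)"
    and W: "\<forall>j\<in>{1..9}. cmod (w j) = 1 \<and> U j * adj V = w j \<cdot>\<^sub>m quat (r j)"
    and \<rho>: "\<rho> \<in> carrier_mat 2 2" and ab: "a < 2" "b < 2"
  shows "(mix9 p (\<lambda>j. unitary_channel (U j)) \<circ> unitary_channel (adj V)) \<rho> $$ (a,b)
    = (\<Sum>c<2. \<Sum>d<2. \<rho> $$ (c,d) * (\<Sum>j\<in>{1..9}. complex_of_real (p j) * (quat (r j) $$ (a,c) * cnj (quat (r j) $$ (b,d)))))"
proof -
  have "(mix9 p (\<lambda>j. unitary_channel (U j)) \<circ> unitary_channel (adj V)) \<rho> $$ (a,b)
     = (\<Sum>j\<in>{1..9}. complex_of_real (p j) * (U j * adj V * \<rho> * adj (U j * adj V)) $$ (a,b))"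
    using ab U unitary2D(1)[OF V] \<rho>
    by (simp add: mix9_def channel_comp_adj unitary2D(1) del: index_mult_mat(1))
  also have "\<dots> = (\<Sum>j\<in>{1..9}. complex_of_real (p j) * (\<Sum>c<2. \<Sum>d<2. \<rho> $$ (c,d) * (quat (r j) $$ (a,c) * cnj (quat (r j) $$ (b,d)))))"
    using W by (intro sum.cong refl arg_cong2[where f = "(*)"] quat_conj[OF _ _ \<rho> ab]) auto
  also have "\<dots> = (\<Sum>c<2. \<Sum>d<2. \<rho> $$ (c,d) * (\<Sum>j\<in>{1..9}. complex_of_real (p j) * (quat (r j) $$ (a,c) * cnj (quat (r j) $$ (b,d)))))"
    unfolding sum_lessThan_2 sum_distrib_left sum.distrib[symmetric] by (intro sum.cong refl) (simp add: algebra_simps)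
  finally show ?thesis .
qed

text \<open>\<open>T a c b d\<close> is the coefficient of input entry (c,d) in output entry (a,b).
  Products of quaternion entries are combinations of the r_k r_l, so the ten moments describe the
  mixture completely.\<close>

lemma quat_moment:
  fixes p r
  defines "T a c b d \<equiv> (\<Sum>j\<in>{1..9::nat}. complex_of_real (p j) * (quat (r j) $$ (a,c) * cnj (quat (r j) $$ (b,d))))"
  defines "m \<equiv> moment p r"
  shows
    "T 0 0 0 0 = Complex (m 0 0 + m 1 1) 0" "T 0 0 0 1 = Complex (m 1 2 - m 0 3) (- m 0 2 - m 1 3)"
    "T 0 1 0 0 = Complex (m 1 2 - m 0 3) (m 0 2 + m 1 3)" "T 0 1 0 1 = Complex (m 2 2 + m 3 3) 0"
    "T 1 0 1 0 = Complex (m 2 2 + m 3 3) 0" "T 1 0 1 1 = Complex (m 0 3 - m 1 2) (m 0 2 + m 1 3)"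
    "T 1 1 1 0 = Complex (m 0 3 - m 1 2) (- m 0 2 - m 1 3)" "T 1 1 1 1 = Complex (m 0 0 + m 1 1) 0"
    "T 0 0 1 0 = Complex (m 0 3 + m 1 2) (m 1 3 - m 0 2)" "T 0 0 1 1 = Complex (m 0 0 - m 1 1) (2 * m 0 1)"
    "T 0 1 1 0 = Complex (m 2 2 - m 3 3) (2 * m 2 3)" "T 0 1 1 1 = Complex (- m 0 3 - m 1 2) (m 0 2 - m 1 3)"
    "T 1 0 0 0 = Complex (m 0 3 + m 1 2) (m 0 2 - m 1 3)" "T 1 0 0 1 = Complex (m 2 2 - m 3 3) (- 2 * m 2 3)"
    "T 1 1 0 0 = Complex (m 0 0 - m 1 1) (- 2 * m 0 1)" "T 1 1 0 1 = Complex (- m 0 3 - m 1 2) (m 1 3 - m 0 2)"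
  unfolding T_def m_def moment_def
  by (simp_all add: complex_eq_iff quat_def algebra_simps sum.distrib sum_subtractf sum_negf)
    (simp_all add: sum_distrib_left mult.left_commute)

lemma mix9_comp_entry:
  fixes p r
  defines "T a c b d \<equiv> (\<Sum>j\<in>{1..9::nat}. complex_of_real (p j) * (quat (r j) $$ (a,c) * cnj (quat (r j) $$ (b,d))))"
  assumes "unitary2 V" "\<forall>j\<in>{1..9}. unitary2 (U j)"
    and "\<forall>j\<in>{1..9}. cmod (w j) = 1 \<and> U j * adj V = w j \<cdot>\<^sub>m quat (r j)"
    and "\<rho> \<in> carrier_mat 2 2" "a < 2" "b < 2"
  shows "(mix9 p (\<lambda>j. unitary_channel (U j)) \<circ> unitary_channel (adj V)) \<rho> $$ (a,b)
    = (\<rho> $$ (0,0) * T a 0 b 0 + \<rho> $$ (0,1) * T a 0 b 1) + (\<rho> $$ (1,0) * T a 1 b 0 + \<rho> $$ (1,1) * T a 1 b 1)"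
  unfolding T_def using mix9_comp_index[OF assms(2-)] unfolding sum_lessThan_2 .

lemma mix9_depolarizingI:
  assumes V: "unitary2 V" and U: "\<forall>j\<in>{1..9}. unitary2 (U j)"
    and W: "\<forall>j\<in>{1..9}. cmod (w j) = 1 \<and> U j * adj V = w j \<cdot>\<^sub>m quat (r j)"
    and q: "q \<ge> 0"
    and m: "moment p r 0 0 = 1 - 3 * q" "moment p r 1 1 = q" "moment p r 2 2 = q" "moment p r 3 3 = q"
      "moment p r 0 1 = 0" "moment p r 0 2 = 0" "moment p r 0 3 = 0"
      "moment p r 1 2 = 0" "moment p r 1 3 = 0" "moment p r 2 3 = 0"
  shows "depolarizing (mix9 p (\<lambda>j. unitary_channel (U j)) \<circ> unitary_channel (adj V))"
  unfolding depolarizing_def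
proof (intro exI[of _ q] conjI ballI q)
  fix \<rho> :: "complex mat" assume \<rho>: "\<rho> \<in> carrier_mat 2 2"
  let ?E = "complex_of_real (1 - 3*q) \<cdot>\<^sub>m \<rho> + complex_of_real q \<cdot>\<^sub>m
        (pauliX * \<rho> * pauliX + pauliY * \<rho> * pauliY + pauliZ * \<rho> * pauliZ)"
  let ?M = "(mix9 p (\<lambda>j. unitary_channel (U j)) \<circ> unitary_channel (adj V)) \<rho>"
  note D = depolarizing_index[OF \<rho>, of q]
  show "?M = ?E"
  proof (rule eq_matI)
    fix a b assume "a < dim_row ?E" "b < dim_col ?E"
    then have ab: "a < 2" "b < 2" using carrier_dims[OF D(1)] by auto
    have l: "(0::nat) < 2" "(1::nat) < 2" by simp_all
    note I = mix9_comp_entry[OF V U W \<rho>, where p = p]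
    have "?M $$ (0,0) = ?E $$ (0,0)"
      unfolding D(2) I[OF l(1) l(1)] quat_moment m by (simp add: complex_eq_iff algebra_simps)
    moreover have "?M $$ (1,1) = ?E $$ (1,1)"
      unfolding D(3) I[OF l(2) l(2)] quat_moment m by (simp add: complex_eq_iff algebra_simps)
    moreover have "?M $$ (0,1) = ?E $$ (0,1)"
      unfolding D(4) I[OF l(1) l(2)] quat_moment m by (simp add: complex_eq_iff algebra_simps)
    moreover have "?M $$ (1,0) = ?E $$ (1,0)"
      unfolding D(5) I[OF l(2) l(1)] quat_moment m by (simp add: complex_eq_iff algebra_simps)
    ultimately show "?M $$ (a,b) = ?E $$ (a,b)" using less_2_disj[OF ab(1)] less_2_disj[OF ab(2)] by metis
  qed (use carrier_dims[OF D(1)] in \<open>simp_all add: mix9_def\<close>)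
qed

text \<open>Two matrix units suffice: the diagonal one gives m00 + m11 = 1 - 2q, the off-diagonal
  one m00 - m11 = 1 - 4q, and the mean of the two is the claim.\<close>

lemma depolarizing_mix9_moment:
  assumes V: "unitary2 V" and U: "\<forall>j\<in>{1..9}. unitary2 (U j)"
    and W: "\<forall>j\<in>{1..9}. cmod (w j) = 1 \<and> U j * adj V = w j \<cdot>\<^sub>m quat (r j)"
    and E: "\<And>\<rho>. \<rho> \<in> carrier_mat 2 2 \<Longrightarrow> (mix9 p (\<lambda>j. unitary_channel (U j)) \<circ> unitary_channel (adj V)) \<rho>
      = complex_of_real (1 - 3*q) \<cdot>\<^sub>m \<rho> + complex_of_real q \<cdot>\<^sub>m
        (pauliX * \<rho> * pauliX + pauliY * \<rho> * pauliY + pauliZ * \<rho> * pauliZ)"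
  shows "moment p r 0 0 = 1 - 3 * q"
proof -
  define A where "A = mat 2 2 (\<lambda>(i,j). if i = 0 \<and> j = 0 then 1 else (0::complex))"
  define B where "B = mat 2 2 (\<lambda>(i,j). if i = 0 \<and> j = 1 then 1 else (0::complex))"
  have c: "A \<in> carrier_mat 2 2" "B \<in> carrier_mat 2 2" by (simp_all add: A_def B_def)
  have Ai: "A $$ (0,0) = 1" "A $$ (0,1) = 0" "A $$ (1,0) = 0" "A $$ (1,1) = 0"
    and Bi: "B $$ (0,0) = 0" "B $$ (0,1) = 1" "B $$ (1,0) = 0" "B $$ (1,1) = 0" by (simp_all add: A_def B_def)
  let ?M = "mix9 p (\<lambda>j. unitary_channel (U j)) \<circ> unitary_channel (adj V)"
  have l: "(0::nat) < 2" "(1::nat) < 2" by simp_all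
  have "?M A $$ (0,0) = complex_of_real (1 - 2 * q)"
    unfolding E[OF c(1)] depolarizing_index(2)[OF c(1)] Ai by (simp only: mult_1_right mult_zero_right add_0_right)
  moreover have "?M A $$ (0,0) = Complex (moment p r 0 0 + moment p r 1 1) 0"
    unfolding mix9_comp_entry[OF V U W c(1) l(1) l(1)] Ai quat_moment by simp
  moreover have "?M B $$ (0,1) = complex_of_real (1 - 4 * q)"
    unfolding E[OF c(2)] depolarizing_index(4)[OF c(2)] Bi by (simp only: mult_1_right)
  moreover have "?M B $$ (0,1) = Complex (moment p r 0 0 - moment p r 1 1) (2 * moment p r 0 1)"
    unfolding mix9_comp_entry[OF V U W c(2) l(1) l(2)] Bi quat_moment by simp
  ultimately have "Complex (moment p r 0 0 + moment p r 1 1) 0 = complex_of_real (1 - 2 * q)"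
    "Complex (moment p r 0 0 - moment p r 1 1) (2 * moment p r 0 1) = complex_of_real (1 - 4 * q)" by simp_all
  then show ?thesis by (simp add: complex_eq_iff)
qed

lemma pauli_unitary: "unitary2 pauliX" "unitary2 pauliY" "unitary2 pauliZ"
  and pauli_adj: "adj pauliX = pauliX" "adj pauliY = pauliY" "adj pauliZ = pauliZ"
proof -
  have p: "pauliX \<in> carrier_mat 2 2" "pauliY \<in> carrier_mat 2 2" "pauliZ \<in> carrier_mat 2 2"
    by (simp_all add: pauliX_def pauliY_def pauliZ_def)
  show a: "adj pauliX = pauliX" "adj pauliY = pauliY" "adj pauliZ = pauliZ"
    by (rule eq_matI; auto simp: adj_def pauliX_def pauliY_def pauliZ_def)+
  have "P * P = 1\<^sub>m 2" if "P \<in> {pauliX, pauliY, pauliZ}" for P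
  proof (rule eq_matI)
    fix i j assume "i < dim_row (1\<^sub>m 2)" "j < dim_col (1\<^sub>m 2)"
    then have ij: "i < 2" "j < 2" by auto
    have "(P * P) $$ (i,j) = (\<Sum>l<2. P $$ (i,l) * P $$ (l,j))" using that p ij by (intro mult_index[of _ 2 2 _ 2]) auto
    then show "(P * P) $$ (i,j) = 1\<^sub>m 2 $$ (i,j)"
      using that less_2_disj[OF ij(1)] less_2_disj[OF ij(2)]
      by (auto simp: sum_lessThan_2 pauliX_def pauliY_def pauliZ_def)
  qed (use that p in auto)
  then show "unitary2 pauliX" "unitary2 pauliY" "unitary2 pauliZ" using p a by (simp_all add: unitary2_def)
qed

text \<open>The difference has coefficient 3q at \<open>V\<close> and -q at each Pauli multiple of
  \<open>V\<close>. The absolute values sum to 6q. Testing with \<open>V\<close> itself attains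
  this, because the Pauli matrices are traceless and so orthogonal to the identity.\<close>

lemma diamond_norm_depolarizing:
  assumes V: "unitary2 V" and q: "q \<ge> 0"
    and E: "\<And>\<rho>. \<rho> \<in> carrier_mat 2 2 \<Longrightarrow> (\<Psi> \<circ> unitary_channel (adj V)) \<rho>
      = complex_of_real (1 - 3*q) \<cdot>\<^sub>m \<rho> + complex_of_real q \<cdot>\<^sub>m
        (pauliX * \<rho> * pauliX + pauliY * \<rho> * pauliY + pauliZ * \<rho> * pauliZ)"
  shows "diamond_norm (map_diff (unitary_channel V) \<Psi>) = 6 * q"
proof -
  note v = unitary2D[OF V] and p = unitary2D(1)[OF pauli_unitary(1)] unitary2D(1)[OF pauli_unitary(2)] unitary2D(1)[OF pauli_unitary(3)]
  define A where "A k = (if k = 0 then V else if k = 1 then pauliX * V else if k = 2 then pauliY * V else pauliZ * V)" for k :: nat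
  define c where "c k = (if k = 0 then 3 * q else - q)" for k :: nat
  have K: "kraus_comb {0,1,2,3} c A (map_diff (unitary_channel V) \<Psi>)"
    unfolding kraus_comb_def
  proof (intro conjI ballI allI impI)
    fix \<rho> :: "complex mat" and a b :: nat assume \<rho>: "\<rho> \<in> carrier_mat 2 2" and ab: "a < 2" "b < 2"
    \<comment> \<open>\<open>E\<close> describes \<Psi> after the inverse of \<open>V\<close>; at
      \<sigma> that inverse cancels and leaves \<Psi> at \<rho>.\<close>
    define \<sigma> where "\<sigma> = unitary_channel V \<rho>"
    have \<sigma>: "\<sigma> \<in> carrier_mat 2 2" unfolding \<sigma>_def by (rule unitary_channel_carrier[OF v(1) \<rho>])
    have "unitary_channel (adj V) \<sigma> = (adj V * V) * \<rho> * (adj V * V)"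
      unfolding \<sigma>_def unitary_channel_def using carrier_dims[OF v(1)] carrier_dims[OF \<rho>] by (simp add: mult_assoc_dim del: assoc_mult_mat)
    also have "\<dots> = \<rho>" unfolding v(3) using \<rho> by simp
    finally have P: "\<Psi> \<rho> = complex_of_real (1 - 3*q) \<cdot>\<^sub>m \<sigma> + complex_of_real q \<cdot>\<^sub>m
        (pauliX * \<sigma> * pauliX + pauliY * \<sigma> * pauliY + pauliZ * \<sigma> * pauliZ)"
      using E[OF \<sigma>] by simp
    have conj: "(P * V) * \<rho> * adj (P * V) = P * \<sigma> * P" if "P \<in> carrier_mat 2 2" "adj P = P" for P
      unfolding \<sigma>_def unitary_channel_def using carrier_dims[OF v(1)] carrier_dims[OF \<rho>] carrier_dims[OF that(1)] that(2)
      by (simp add: mat_algebra del: assoc_mult_mat)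
    have cP: "P * \<sigma> * P \<in> carrier_mat 2 2" if "P \<in> carrier_mat 2 2" for P using \<sigma> that by (intro mult_carrier_mat[of _ 2 2])
    note d = carrier_dims[OF \<sigma>] carrier_dims[OF cP[OF p(1)]] carrier_dims[OF cP[OF p(2)]] carrier_dims[OF cP[OF p(3)]] carrier_dims[OF p(1)] carrier_dims[OF p(2)] carrier_dims[OF p(3)]
    have "map_diff (unitary_channel V) \<Psi> \<rho> $$ (a,b) = \<sigma> $$ (a,b) - \<Psi> \<rho> $$ (a,b)"
      unfolding map_diff_def \<sigma>_def[symmetric] P using ab d by simp
    also have "\<dots> = complex_of_real (3 * q) * \<sigma> $$ (a,b) - complex_of_real q * ((pauliX * \<sigma> * pauliX) $$ (a,b) + (pauliY * \<sigma> * pauliY) $$ (a,b) + (pauliZ * \<sigma> * pauliZ) $$ (a,b))"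
      unfolding P using ab d by (simp add: algebra_simps del: index_mult_mat(1))
    also have "\<dots> = (\<Sum>k\<in>{0,1,2,3}. complex_of_real (c k) * (A k * \<rho> * adj (A k)) $$ (a,b))"
      by (simp add: c_def A_def conj[OF p(1) pauli_adj(1)] conj[OF p(2) pauli_adj(2)] conj[OF p(3) pauli_adj(3)]
          \<sigma>_def[unfolded unitary_channel_def, symmetric] algebra_simps del: index_mult_mat(1))
    finally show "map_diff (unitary_channel V) \<Psi> \<rho> $$ (a,b) = (\<Sum>k\<in>{0,1,2,3}. complex_of_real (c k) * (A k * \<rho> * adj (A k)) $$ (a,b))" .
  qed (use V unitary2_mult[OF _ V] pauli_unitary in \<open>auto simp: A_def\<close>)
  have "diamond_norm (map_diff (unitary_channel V) \<Psi>) \<le> 6 * q"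
    using diamond_norm_le[OF K] q by (simp add: c_def)
  moreover have "6 * q \<le> diamond_norm (map_diff (unitary_channel V) \<Psi>)"
  proof -
    have h: "hs V (P * V) = hs (1\<^sub>m 2) P" if "P \<in> carrier_mat 2 2" for P
      using hs_mult_unitary[OF _ that V, of "1\<^sub>m 2"] v(1) by simp
    have hP: "hs V (pauliX * V) = 0" "hs V (pauliY * V) = 0" "hs V (pauliZ * V) = 0"
      unfolding h[OF p(1)] h[OF p(2)] h[OF p(3)] by (simp_all add: hs_def sum_lessThan_2 pauliX_def pauliY_def pauliZ_def)
    have hV: "hs V V = complex_of_real 2"
      using h[of "1\<^sub>m 2"] v(1) by (simp add: hs_def sum_lessThan_2)
    show ?thesis using diamond_norm_ge[OF K v(1) hV] by (simp add: c_def A_def hP hV)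
  qed
  ultimately show ?thesis by simp
qed

section \<open>The frame of nine vectors\<close>

text \<open>If 0 were outside the compact convex hull, a separating functional would be strictly
  positive at every point, which \<open>sep\<close> forbids.\<close>

lemma zero_in_convex_hull_weights:
  fixes w :: "nat \<Rightarrow> 'a :: euclidean_space"
  assumes J: "finite J" "J \<noteq> {}" and sep: "\<And>a. \<exists>j\<in>J. a \<bullet> w j \<le> 0"
  shows "\<exists>p. (\<forall>j\<in>J. 0 \<le> p j) \<and> sum p J = 1 \<and> (\<Sum>j\<in>J. p j *\<^sub>R w j) = 0"
proof -
  define S where "S = convex hull (w ` J)"
  have fin: "finite (w ` J)" using J by simp
  have "closed S" unfolding S_def using finite_imp_compact_convex_hull[OF fin] compact_imp_closed by blast
  moreover have "convex S" unfolding S_def by (rule convex_convex_hull)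
  ultimately have "0 \<in> S"
  proof (rule_tac ccontr)
    assume "convex S" "closed S" "0 \<notin> S"
    then obtain a b where ab: "0 < b" "\<And>x. x \<in> S \<Longrightarrow> b < a \<bullet> x"
      using separating_hyperplane_closed_0[of S] by auto
    from sep obtain j where "j \<in> J" "a \<bullet> w j \<le> 0" by blast
    moreover from this have "w j \<in> S" unfolding S_def by (simp add: hull_inc)
    ultimately show False using ab by fastforce
  qed
  then obtain u where u: "\<And>x. x \<in> w ` J \<Longrightarrow> 0 \<le> u x" "sum u (w ` J) = 1" "(\<Sum>x\<in>w ` J. u x *\<^sub>R x) = 0"
    unfolding S_def convex_hull_finite[OF fin] by auto
  \<comment> \<open>w need not be injective: all the weight of a point goes to one of its indices\<close>
  define g where "g = inv_into J w"
  define p where "p j = (if j \<in> g ` w ` J then u (w j) else 0)" for j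
  have gJ: "g ` w ` J \<subseteq> J" unfolding g_def by (auto intro: inv_into_into)
  have wg: "w (g x) = x" if "x \<in> w ` J" for x unfolding g_def using that by (rule f_inv_into_f)
  have inj: "inj_on g (w ` J)" by (metis inj_onI wg)
  have sums: "(\<Sum>j\<in>J. p j *\<^sub>R h (w j)) = (\<Sum>x\<in>w ` J. u x *\<^sub>R h x)" for h :: "'a \<Rightarrow> 'b :: real_vector"
  proof -
    have "(\<Sum>j\<in>J. p j *\<^sub>R h (w j)) = (\<Sum>j\<in>g ` w ` J. p j *\<^sub>R h (w j))"
      using J(1) gJ by (intro sum.mono_neutral_right) (auto simp: p_def)
    also have "\<dots> = (\<Sum>x\<in>w ` J. p (g x) *\<^sub>R h (w (g x)))" using inj by (simp add: sum.reindex)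
    also have "\<dots> = (\<Sum>x\<in>w ` J. u x *\<^sub>R h x)" by (intro sum.cong refl) (auto simp: wg p_def)
    finally show ?thesis .
  qed
  have "sum p J = 1" using sums[of "\<lambda>_. 1::real"] u(2) by simp
  moreover have "(\<Sum>j\<in>J. p j *\<^sub>R w j) = 0" using sums[of "\<lambda>x. x"] u(3) by simp
  moreover have "\<forall>j\<in>J. 0 \<le> p j" using u(1) by (simp add: p_def)
  ultimately show ?thesis by blast
qed

text \<open>Three negative axes and the cyclic shifts of (2,-2,1)/3 and (2,2,1)/3. By 1 + 4 + 4 = 9
  these are rational unit vectors, so all later checks are exact arithmetic. The frame is numbered
  from 1, the list from 0.\<close>

definition frame :: "nat \<Rightarrow> nat \<Rightarrow> real" where
  "frame j k = ([[-1,0,0],[0,-1,0],[0,0,-1],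
    [2/3,-2/3,1/3],[1/3,2/3,-2/3],[-2/3,1/3,2/3],
    [2/3,2/3,1/3],[1/3,2/3,2/3],[2/3,1/3,2/3]] ! (j - 1)) ! k"

lemma nine_cases: "j \<in> {1..9::nat} \<Longrightarrow> j = 1 \<or> j = 2 \<or> j = 3 \<or> j = 4 \<or> j = 5 \<or> j = 6 \<or> j = 7 \<or> j = 8 \<or> j = 9"
  by (simp; presburger)

lemma frame_values:
  "frame 1 0 = -1" "frame 1 1 = 0" "frame 1 2 = 0"
  "frame 2 0 = 0" "frame 2 1 = -1" "frame 2 2 = 0"
  "frame 3 0 = 0" "frame 3 1 = 0" "frame 3 2 = -1"
  "frame 4 0 = 2/3" "frame 4 1 = -2/3" "frame 4 2 = 1/3"
  "frame 5 0 = 1/3" "frame 5 1 = 2/3" "frame 5 2 = -2/3"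
  "frame 6 0 = -2/3" "frame 6 1 = 1/3" "frame 6 2 = 2/3"
  "frame 7 0 = 2/3" "frame 7 1 = 2/3" "frame 7 2 = 1/3"
  "frame 8 0 = 1/3" "frame 8 1 = 2/3" "frame 8 2 = 2/3"
  "frame 9 0 = 2/3" "frame 9 1 = 1/3" "frame 9 2 = 2/3"
  by (simp_all add: frame_def numeral_eq_Suc)

lemma frame_unit:
  assumes "j \<in> {1..9}"
  shows "(frame j 0)\<^sup>2 + (frame j 1)\<^sup>2 + (frame j 2)\<^sup>2 = 1"
  using nine_cases[OF assms] by (elim disjE) (simp_all add: frame_values power2_eq_square del: One_nat_def)

lemma frame_bound: "j \<in> {1..9} \<Longrightarrow> k < 3 \<Longrightarrow> \<bar>frame j k\<bar> \<le> 1"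
proof -
  assume j: "j \<in> {1..9}" and k: "k < 3"
  have "k = 0 \<or> k = 1 \<or> k = 2" using k by auto
  then have "(frame j k)\<^sup>2 \<le> 1"
  proof (elim disjE)
    assume k: "k = 0" show ?thesis unfolding k using frame_unit[OF j] zero_le_power2[of "frame j 1"] zero_le_power2[of "frame j 2"] by linarith
  next
    assume k: "k = 1" show ?thesis unfolding k using frame_unit[OF j] zero_le_power2[of "frame j 0"] zero_le_power2[of "frame j 2"] by linarith
  next
    assume k: "k = 2" show ?thesis unfolding k using frame_unit[OF j] zero_le_power2[of "frame j 0"] zero_le_power2[of "frame j 1"] by linarith
  qed
  then show ?thesis using abs_square_le_1 by blast
qed

type_synonym real8 = "real \<times> real \<times> real \<times> real \<times> real \<times> real \<times> real \<times> real"

text \<open>The shape of a Farkas certificate: nonnegative multipliers for nine inequalities, to be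
  filled in with numerals.\<close>

lemma conic9_nonneg:
  fixes l1 :: real
  assumes "0 \<le> l1" "0 \<le> l2" "0 \<le> l3" "0 \<le> l4" "0 \<le> l5" "0 \<le> l6" "0 \<le> l7" "0 \<le> l8" "0 \<le> l9"
    and "0 \<le> g1" "0 \<le> g2" "0 \<le> g3" "0 \<le> g4" "0 \<le> g5" "0 \<le> g6" "0 \<le> g7" "0 \<le> g8" "0 \<le> g9"
  shows "0 \<le> l1 * g1 + l2 * g2 + l3 * g3 + l4 * g4 + l5 * g5 + l6 * g6 + l7 * g7 + l8 * g8 + l9 * g9"
  using assms by (intro add_nonneg_nonneg mult_nonneg_nonneg)

text \<open>The weights (7/48, 7/48, 7/48, 1/8, 1/8, 1/8, 1/16, 1/16, 1/16) annihilate all harmonic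
  polynomials of degree 1 and 2 on the frame, and their values on the frame determine such a polynomial.\<close>
lemma frame_harmonic_bound:
  fixes a1 a2 a3 a4 a5 a6 a7 a8 \<mu> :: real
  assumes h: "\<And>j. j \<in> {1..9} \<Longrightarrow> a1 * frame j 0 + a2 * frame j 1 + a3 * frame j 2
    + a4 * (frame j 0 * frame j 1) + a5 * (frame j 1 * frame j 2) + a6 * (frame j 2 * frame j 0)
    + a7 * ((frame j 0)\<^sup>2 - (frame j 1)\<^sup>2) + a8 * ((frame j 1)\<^sup>2 - (frame j 2)\<^sup>2) \<ge> - \<mu>"
  shows "\<bar>a1\<bar> \<le> 39 * \<mu>" "\<bar>a2\<bar> \<le> 39 * \<mu>" "\<bar>a3\<bar> \<le> 39 * \<mu>" "\<bar>a4\<bar> \<le> 39 * \<mu>"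
    "\<bar>a5\<bar> \<le> 39 * \<mu>" "\<bar>a6\<bar> \<le> 39 * \<mu>" "\<bar>a7\<bar> \<le> 39 * \<mu>" "\<bar>a8\<bar> \<le> 39 * \<mu>"
proof -
  note h' = h[of 1] h[of 2] h[of 3] h[of 4] h[of 5] h[of 6] h[of 7] h[of 8] h[of 9]
  \<comment> \<open>The values at the last six vectors are multiples of 1/9, so those inequalities
    are multiplied by 9.\<close>
  have e: "0 \<le> - a1 + a7 + \<mu>" "0 \<le> - a2 - a7 + a8 + \<mu>" "0 \<le> - a3 - a8 + \<mu>"
    "0 \<le> 6 * a1 - 6 * a2 + 3 * a3 - 4 * a4 - 2 * a5 + 2 * a6 + 3 * a8 + 9 * \<mu>"
    "0 \<le> 3 * a1 + 6 * a2 - 6 * a3 + 2 * a4 - 4 * a5 - 2 * a6 - 3 * a7 + 9 * \<mu>"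
    "0 \<le> - 6 * a1 + 3 * a2 + 6 * a3 - 2 * a4 + 2 * a5 - 4 * a6 + 3 * a7 - 3 * a8 + 9 * \<mu>"
    "0 \<le> 6 * a1 + 6 * a2 + 3 * a3 + 4 * a4 + 2 * a5 + 2 * a6 + 3 * a8 + 9 * \<mu>"
    "0 \<le> 3 * a1 + 6 * a2 + 6 * a3 + 2 * a4 + 4 * a5 + 2 * a6 - 3 * a7 + 9 * \<mu>"
    "0 \<le> 6 * a1 + 3 * a2 + 6 * a3 + 2 * a4 + 2 * a5 + 4 * a6 + 3 * a7 - 3 * a8 + 9 * \<mu>"
    using h' unfolding frame_values by (simp_all add: power2_eq_square field_simps)
  \<comment> \<open>the multipliers come from inverting the 9 x 9 matrix of values on the frame\<close>
  note comb = conic9_nonneg[OF _ _ _ _ _ _ _ _ _ e]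
  have "a1 \<le> 39 * \<mu>"
    using comb[of 153 141 129 12 14 12 3 9 7]
    by simp
  moreover have "- a1 \<le> 39 * \<mu>"
    using comb[of 60 66 72 7 6 7 5 2 3]
    by simp
  ultimately show "\<bar>a1\<bar> \<le> 39 * \<mu>" by linarith
  have "a2 \<le> 39 * \<mu>"
    using comb[of 129 153 141 12 12 14 7 3 9]
    by simp
  moreover have "- a2 \<le> 39 * \<mu>"
    using comb[of 72 60 66 7 7 6 3 5 2]
    by simp
  ultimately show "\<bar>a2\<bar> \<le> 39 * \<mu>" by linarith
  have "a3 \<le> 39 * \<mu>"
    using comb[of 141 129 153 14 12 12 9 7 3]
    by simp
  moreover have "- a3 \<le> 39 * \<mu>"
    using comb[of 66 72 60 6 7 7 2 3 5]
    by simp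
  ultimately show "\<bar>a3\<bar> \<le> 39 * \<mu>" by linarith
  \<comment> \<open>A zero multiplier makes a certificate optimal, so 39 is sharp here, and likewise
    for \<open>a5\<close> and \<open>a6\<close> from above. The other certificates contain a
    positive multiple of the annihilating weights, which pads them to the same constant.\<close>
  have "a4 \<le> 39 * \<mu>"
    using comb[of 24 18 24 3 2 2 1 2 0]
    by simp
  moreover have "- a4 \<le> 39 * \<mu>"
    using comb[of 129 165 129 8 14 14 7 1 13]
    by simp
  ultimately show "\<bar>a4\<bar> \<le> 39 * \<mu>" by linarith
  have "a5 \<le> 39 * \<mu>"
    using comb[of 24 24 18 2 3 2 0 1 2]
    by simp
  moreover have "- a5 \<le> 39 * \<mu>"
    using comb[of 129 129 165 14 8 14 13 7 1]
    by simp
  ultimately show "\<bar>a5\<bar> \<le> 39 * \<mu>" by linarith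
  have "a6 \<le> 39 * \<mu>"
    using comb[of 18 24 24 2 2 3 2 0 1]
    by simp
  moreover have "- a6 \<le> 39 * \<mu>"
    using comb[of 165 129 129 14 14 8 1 13 7]
    by simp
  ultimately show "\<bar>a6\<bar> \<le> 39 * \<mu>" by linarith
  have "a7 \<le> 39 * \<mu>"
    using comb[of 795 867 795 74 86 74 19 55 43]
    by simp
  moreover have "- a7 \<le> 39 * \<mu>"
    using comb[of 843 771 843 82 70 82 59 23 35]
    by simp
  ultimately show "\<bar>a7\<bar> \<le> 39 * \<mu>" by linarith
  have "a8 \<le> 39 * \<mu>"
    using comb[of 771 843 843 70 82 82 23 35 59]
    by simp
  moreover have "- a8 \<le> 39 * \<mu>"
    using comb[of 867 795 795 86 74 74 55 43 19]
    by simp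
  ultimately show "\<bar>a8\<bar> \<le> 39 * \<mu>" by linarith
qed

section \<open>Stability of the cancelling weights\<close>

text \<open>Each of the two linear error terms costs e, and since e is at most 1 the quadratic term
  costs no more than e.\<close>

lemma abs_mult_diff_le:
  fixes x y u v e :: real
  assumes "\<bar>x - u\<bar> \<le> e" "\<bar>y - v\<bar> \<le> e" "\<bar>u\<bar> \<le> 1" "\<bar>v\<bar> \<le> 1" "e \<le> 1"
  shows "\<bar>x * y - u * v\<bar> \<le> 3 * e"
proof -
  have e: "0 \<le> e" using assms(1) by linarith
  have "x * y - u * v = (x - u) * (y - v) + u * (y - v) + (x - u) * v" by (simp add: algebra_simps)
  also have "\<bar>\<dots>\<bar> \<le> \<bar>(x - u) * (y - v)\<bar> + \<bar>u * (y - v)\<bar> + \<bar>(x - u) * v\<bar>" by linarith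
  also have "\<dots> \<le> e * 1 + 1 * e + e * 1"
    unfolding abs_mult using assms e by (intro add_mono mult_mono) linarith+
  finally show ?thesis by simp
qed

lemma abs_triangle_mono:
  fixes x y :: real
  shows "\<bar>x\<bar> \<le> a \<Longrightarrow> \<bar>y\<bar> \<le> b \<Longrightarrow> \<bar>x + y\<bar> \<le> a + b"
  by linarith

text \<open>A basis of the harmonic polynomials of degree 1 and 2 (3 + 5 = 8). Degree 1 carries the
  real part \<open>s\<close>, because the conditions to be met concern the products r_0 r_k.\<close>

definition harmonic8 :: "real \<Rightarrow> real \<Rightarrow> real \<Rightarrow> real \<Rightarrow> real8" where
  "harmonic8 s x y z = (s * x, s * y, s * z, x * y, y * z, z * x, x\<^sup>2 - y\<^sup>2, y\<^sup>2 - z\<^sup>2)"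

text \<open>Let a functional with coefficient sum N (in modulus) be positive at all perturbed
  points. On the exact frame it exceeds -(12/5000) N, so its eight coefficients sum in modulus to at
  most 8 * 39 * (12/5000) N < N unless N = 0. Then it vanishes and is not positive.\<close>

lemma balanced_weights:
  fixes s :: "nat \<Rightarrow> real" and u :: "nat \<Rightarrow> nat \<Rightarrow> real"
  assumes s: "\<And>j. j \<in> {1..9} \<Longrightarrow> \<bar>s j - 1\<bar> \<le> 1/5000"
    and u: "\<And>j k. j \<in> {1..9} \<Longrightarrow> k < 3 \<Longrightarrow> \<bar>u j k - frame j k\<bar> \<le> 1/5000"
  shows "\<exists>p. (\<forall>j\<in>{1..9}. 0 \<le> p j) \<and> sum p {1..9} = 1 \<and>
    (\<Sum>j\<in>{1..9}. p j *\<^sub>R harmonic8 (s j) (u j 0) (u j 1) (u j 2)) = 0"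
proof (rule zero_in_convex_hull_weights)
  fix a :: real8
  obtain a1 a2 a3 a4 a5 a6 a7 a8 where a: "a = (a1,a2,a3,a4,a5,a6,a7,a8)" by (metis prod_cases3)
  define N where "N = \<bar>a1\<bar> + \<bar>a2\<bar> + \<bar>a3\<bar> + \<bar>a4\<bar> + \<bar>a5\<bar> + \<bar>a6\<bar> + \<bar>a7\<bar> + \<bar>a8\<bar>"
  define w where "w j = harmonic8 (s j) (u j 0) (u j 1) (u j 2)" for j
  define h where "h j = a1 * frame j 0 + a2 * frame j 1 + a3 * frame j 2
    + a4 * (frame j 0 * frame j 1) + a5 * (frame j 1 * frame j 2) + a6 * (frame j 2 * frame j 0)
    + a7 * ((frame j 0)\<^sup>2 - (frame j 1)\<^sup>2) + a8 * ((frame j 1)\<^sup>2 - (frame j 2)\<^sup>2)" for j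
  have inner: "a \<bullet> w j = a1 * (s j * u j 0) + a2 * (s j * u j 1) + a3 * (s j * u j 2)
    + a4 * (u j 0 * u j 1) + a5 * (u j 1 * u j 2) + a6 * (u j 2 * u j 0)
    + a7 * ((u j 0)\<^sup>2 - (u j 1)\<^sup>2) + a8 * ((u j 1)\<^sup>2 - (u j 2)\<^sup>2)" for j
    by (simp add: a w_def harmonic8_def inner_prod_def)
  \<comment> \<open>A product moves by at most 3/5000 and a difference of squares by twice that;
    12/5000 is a common bound for all eight coordinates.\<close>
  have near: "\<bar>a \<bullet> w j - h j\<bar> \<le> 12/5000 * N" if j: "j \<in> {1..9}" for j
  proof -
    have f: "\<bar>frame j 0\<bar> \<le> 1" "\<bar>frame j 1\<bar> \<le> 1" "\<bar>frame j 2\<bar> \<le> 1" using frame_bound[OF j] by auto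
    have d: "\<bar>u j 0 - frame j 0\<bar> \<le> 1/5000" "\<bar>u j 1 - frame j 1\<bar> \<le> 1/5000" "\<bar>u j 2 - frame j 2\<bar> \<le> 1/5000"
      using u[OF j] by auto
    have m: "\<bar>x * y - v * z\<bar> \<le> 3/5000"
      if "\<bar>x - v\<bar> \<le> 1/5000" "\<bar>y - z\<bar> \<le> 1/5000" "\<bar>v\<bar> \<le> 1" "\<bar>z\<bar> \<le> 1" for x y v z :: real
      using abs_mult_diff_le[OF that] by simp
    \<comment> \<open>The frame value is read as 1 * z, with \<open>s j\<close> a perturbation of
      1.\<close>
    have s1: "\<bar>s j * y - z\<bar> \<le> 3/5000" if "\<bar>y - z\<bar> \<le> 1/5000" "\<bar>z\<bar> \<le> 1" for y z
      using m[OF s[OF j] that(1) _ that(2)] by simp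
    note su = s1[OF d(1) f(1)] s1[OF d(2) f(2)] s1[OF d(3) f(3)]
    note uu = m[OF d(1) d(2) f(1) f(2)] m[OF d(2) d(3) f(2) f(3)] m[OF d(3) d(1) f(3) f(1)]
    note sq = m[OF d(1) d(1) f(1) f(1), folded power2_eq_square] m[OF d(2) d(2) f(2) f(2), folded power2_eq_square]
      m[OF d(3) d(3) f(3) f(3), folded power2_eq_square]
    have l: "x \<le> 12/5000" if "x \<le> 3/5000" for x :: real using that by simp
    have sq1: "\<bar>((u j 0)\<^sup>2 - (u j 1)\<^sup>2) - ((frame j 0)\<^sup>2 - (frame j 1)\<^sup>2)\<bar> \<le> 12/5000" using sq(1,2) by linarith
    have sq2: "\<bar>((u j 1)\<^sup>2 - (u j 2)\<^sup>2) - ((frame j 1)\<^sup>2 - (frame j 2)\<^sup>2)\<bar> \<le> 12/5000" using sq(2,3) by linarith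
    have b: "\<bar>c * x - c * y\<bar> \<le> 12/5000 * \<bar>c\<bar>" if "\<bar>x - y\<bar> \<le> 12/5000" for c x y :: real
      using mult_left_mono[OF that abs_ge_zero[of c]] by (simp add: abs_mult mult.commute flip: right_diff_distrib)
    have eq: "a \<bullet> w j - h j = (a1 * (s j * u j 0) - a1 * frame j 0)
      + (a2 * (s j * u j 1) - a2 * frame j 1)
      + (a3 * (s j * u j 2) - a3 * frame j 2)
      + (a4 * (u j 0 * u j 1) - a4 * (frame j 0 * frame j 1))
      + (a5 * (u j 1 * u j 2) - a5 * (frame j 1 * frame j 2))
      + (a6 * (u j 2 * u j 0) - a6 * (frame j 2 * frame j 0))
      + (a7 * ((u j 0)\<^sup>2 - (u j 1)\<^sup>2) - a7 * ((frame j 0)\<^sup>2 - (frame j 1)\<^sup>2))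
      + (a8 * ((u j 1)\<^sup>2 - (u j 2)\<^sup>2) - a8 * ((frame j 1)\<^sup>2 - (frame j 2)\<^sup>2))"
      unfolding inner h_def by linarith
    show ?thesis unfolding eq N_def distrib_left
      by (intro abs_triangle_mono b su[THEN l] uu[THEN l] sq1 sq2)
  qed
  show "\<exists>j\<in>{1..9}. a \<bullet> harmonic8 (s j) (u j 0) (u j 1) (u j 2) \<le> 0"
  proof (rule ccontr)
    assume "\<not> ?thesis"
    then have pos: "a \<bullet> w j > 0" if "j \<in> {1..9}" for j using that by (force simp: w_def)
    have "h j \<ge> - (12/5000 * N)" if "j \<in> {1..9}" for j using near[OF that] pos[OF that] by linarith
    note bounds = frame_harmonic_bound[OF this[unfolded h_def]]
    \<comment> \<open>8 * 39 * 12/5000 < 1: this is what forces the scale c to be large\<close>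
    have "N \<le> 39 * (12/5000 * N) + 39 * (12/5000 * N) + 39 * (12/5000 * N) + 39 * (12/5000 * N)
      + 39 * (12/5000 * N) + 39 * (12/5000 * N) + 39 * (12/5000 * N) + 39 * (12/5000 * N)"
      by (subst (1) N_def) (intro add_mono bounds)
    then have "N \<le> 0" by simp
    moreover have "0 \<le> N" unfolding N_def by (intro add_nonneg_nonneg abs_ge_zero)
    ultimately have "\<bar>a \<bullet> w 1 - h 1\<bar> \<le> 0" "N = 0" using near[of 1] by simp_all
    then have "h 1 = a \<bullet> w 1" by simp
    moreover have "h 1 = 0" using bounds unfolding h_def \<open>N = 0\<close> by simp
    ultimately have "a \<bullet> w 1 = 0" by simp
    then show False using pos[of 1] by simp
  qed
qed auto

section \<open>Trigonometry of the perturbed angles\<close>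

text \<open>Read C = cos a, S = sin a, t = cos b: the last hypothesis says that x is the cosine of an angle between
  |a - b| and a + b.\<close>
lemma sine_triangle:
  fixes C S t x \<epsilon> :: real
  assumes CS: "C\<^sup>2 + S\<^sup>2 = 1" "C > 0" "0 \<le> \<epsilon>" "\<epsilon> \<le> S" "S \<le> 1/4"
    and t: "0 \<le> t" "t \<le> 1" "1 - t\<^sup>2 \<le> \<epsilon>\<^sup>2" and x: "(x - C * t)\<^sup>2 \<le> S\<^sup>2 * (1 - t\<^sup>2)"
  shows "(S - \<epsilon>)\<^sup>2 \<le> 1 - x\<^sup>2" "1 - x\<^sup>2 \<le> (S + \<epsilon>)\<^sup>2"
proof -
  define \<sigma> where "\<sigma> = sqrt (1 - t\<^sup>2)"
  have t2: "t\<^sup>2 \<le> 1" using t by (simp add: power_le_one)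
  have s2: "\<sigma>\<^sup>2 = 1 - t\<^sup>2" and s0: "0 \<le> \<sigma>" using t2 by (simp_all add: \<sigma>_def)
  have se: "\<sigma> \<le> \<epsilon>" using s2 t(3) CS(3) by (metis power2_le_imp_le)
  have S0: "0 \<le> S" using CS by linarith
  have sS: "\<sigma> \<le> S" using se CS by linarith
  have S2: "S\<^sup>2 \<le> 1/16" using power_mono[OF CS(5) S0, of 2] by (simp add: power2_eq_square)
  have sig2: "\<sigma>\<^sup>2 \<le> S\<^sup>2" using sS s0 by (rule power_mono)
  \<comment> \<open>With \<sigma> = sin b, the inequality sin b <= sin a between acute angles
    reverses for cosines.\<close>
  have Ct: "C \<le> t" by (rule power2_le_imp_le) (use CS(1) s2 sig2 t(1) in linarith)+
  have C1: "C \<le> 1" using CS(1) t Ct by linarith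
  have C34: "3/4 \<le> C" by (rule power2_le_imp_le) (use CS(1,2) S2 in \<open>simp_all add: power_divide\<close>)
  have "(x - C * t)\<^sup>2 \<le> (S * \<sigma>)\<^sup>2" using x s2 by (simp add: power_mult_distrib)
  then have ab: "\<bar>x - C * t\<bar> \<le> S * \<sigma>" using S0 s0 by (metis abs_le_square_iff abs_of_nonneg mult_nonneg_nonneg)
  have Ss: "S * \<sigma> \<le> 1/16"
  proof -
    have "S * \<sigma> \<le> S * S" using sS S0 by (rule mult_left_mono)
    then show ?thesis using S2 by (simp add: power2_eq_square)
  qed
  have CC: "9/16 \<le> C * t"
  proof -
    have "3/4 * (3/4) \<le> C * t" by (rule mult_mono) (use C34 Ct in linarith)+
    then show ?thesis by simp
  qed
  \<comment> \<open>The addition theorems for a + b and a - b.\<close>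
  have id1: "(C * t - S * \<sigma>)\<^sup>2 + (S * t + C * \<sigma>)\<^sup>2 = 1" "(C * t + S * \<sigma>)\<^sup>2 + (S * t - C * \<sigma>)\<^sup>2 = 1"
  proof -
    have "(C * t - S * \<sigma>)\<^sup>2 + (S * t + C * \<sigma>)\<^sup>2 = (C\<^sup>2 + S\<^sup>2) * (t\<^sup>2 + \<sigma>\<^sup>2)"
      "(C * t + S * \<sigma>)\<^sup>2 + (S * t - C * \<sigma>)\<^sup>2 = (C\<^sup>2 + S\<^sup>2) * (t\<^sup>2 + \<sigma>\<^sup>2)"
      by (simp_all add: power2_eq_square algebra_simps)
    then show "(C * t - S * \<sigma>)\<^sup>2 + (S * t + C * \<sigma>)\<^sup>2 = 1" "(C * t + S * \<sigma>)\<^sup>2 + (S * t - C * \<sigma>)\<^sup>2 = 1"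
      using CS(1) s2 by simp_all
  qed
  \<comment> \<open>Squaring is monotone because cos(a + b) is at least 9/16 - 1/16 > 0; this is
    where S <= 1/4 enters.\<close>
  have "(C * t - S * \<sigma>)\<^sup>2 \<le> x\<^sup>2" using ab Ss CC by (intro power_mono) linarith+
  moreover have "(S * t + C * \<sigma>)\<^sup>2 \<le> (S + \<epsilon>)\<^sup>2"
  proof (intro power_mono add_mono)
    show "S * t \<le> S" using mult_left_mono[OF t(2) S0] by simp
    show "C * \<sigma> \<le> \<epsilon>" using mult_right_mono[OF C1 s0] se by simp
    show "0 \<le> S * t + C * \<sigma>" using S0 t s0 CS by simp
  qed
  ultimately show "1 - x\<^sup>2 \<le> (S + \<epsilon>)\<^sup>2" using id1(1) by linarith
  have "x\<^sup>2 \<le> (C * t + S * \<sigma>)\<^sup>2" using ab Ss CC by (intro power_mono) linarith+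
  moreover have "(S - \<epsilon>)\<^sup>2 \<le> (S * t - C * \<sigma>)\<^sup>2"
  proof (intro power_mono)
    show "0 \<le> S - \<epsilon>" using CS by simp
    \<comment> \<open>Equivalent to sin a - sin b <= sin(a - b), and for nonzero sines to tan(b/2)
      <= tan(a/2). Multiplication by (1 + t)(1 + C) reduces it to \<sigma> <= S and C <= t.\<close>
    have "S * (1 - t) \<le> \<sigma> * (1 - C)"
    proof -
      have "(S * (1 - t)) * ((1 + t) * (1 + C)) = S * \<sigma>\<^sup>2 * (1 + C)" unfolding s2 by (simp add: power2_eq_square algebra_simps)
      also have "\<dots> = (S * \<sigma>) * (\<sigma> * (1 + C))" by (simp add: power2_eq_square)
      also have "\<dots> \<le> (S * \<sigma>) * (S * (1 + t))"
        using sS Ct s0 S0 CS(2) by (intro mult_left_mono mult_mono) auto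
      also have "\<dots> = \<sigma> * S\<^sup>2 * (1 + t)" by (simp add: power2_eq_square)
      also have "S\<^sup>2 = 1 - C\<^sup>2" using CS(1) by simp
      also have "\<sigma> * (1 - C\<^sup>2) * (1 + t) = (\<sigma> * (1 - C)) * ((1 + t) * (1 + C))" by (simp add: power2_eq_square algebra_simps)
      finally show ?thesis using t(1) CS(2) by (simp add: mult_le_cancel_right)
    qed
    then have "S - \<sigma> \<le> S * t - C * \<sigma>" by (simp add: algebra_simps)
    then show "S - \<epsilon> \<le> S * t - C * \<sigma>" using se by linarith
  qed
  ultimately show "(S - \<epsilon>)\<^sup>2 \<le> 1 - x\<^sup>2" using id1(2) by linarith
qed

section \<open>Mixing\<close>

text \<open>The spherical triangle inequality |cos c - cos a cos b| <= sin a sin b for the unit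
  quaternion, \<open>e\<close> and \<open>r\<close>. Both it and Cauchy-Schwarz for the imaginary
  parts say that the Gram determinant of these three vectors is nonnegative.\<close>

lemma first_component_bound:
  assumes n: "dot4 e e = 1" "dot4 r r = 1" and S: "(e 0)\<^sup>2 + S\<^sup>2 = 1"
  shows "(r 0 - e 0 * dot4 e r)\<^sup>2 \<le> S\<^sup>2 * (1 - (dot4 e r)\<^sup>2)"
proof -
  define s where "s = e 1 * r 1 + e 2 * r 2 + e 3 * r 3"
  have "(dot4 (e(0 := 0)) (r(0 := 0)))\<^sup>2 \<le> dot4 (e(0 := 0)) (e(0 := 0)) * dot4 (r(0 := 0)) (r(0 := 0))"
    by (rule dot4_Cauchy_Schwarz)
  moreover have "dot4 (e(0 := 0)) (e(0 := 0)) = 1 - (e 0)\<^sup>2" "dot4 (r(0 := 0)) (r(0 := 0)) = 1 - (r 0)\<^sup>2"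
    using n by (simp_all add: dot4_def power2_eq_square)
  ultimately have s2: "s\<^sup>2 \<le> (1 - (e 0)\<^sup>2) * (1 - (r 0)\<^sup>2)" by (simp add: dot4_def s_def)
  have t: "dot4 e r = e 0 * r 0 + s" by (simp add: dot4_def s_def)
  have S': "S\<^sup>2 = 1 - (e 0)\<^sup>2" using S by simp
  have "S\<^sup>2 * (1 - (dot4 e r)\<^sup>2) - (r 0 - e 0 * dot4 e r)\<^sup>2 = (1 - (e 0)\<^sup>2) * (1 - (r 0)\<^sup>2) - s\<^sup>2"
    unfolding S' t by (simp add: power2_eq_square algebra_simps)
  with s2 show ?thesis by linarith
qed

text \<open>For an overlap t between 0 and 1 one has 1 - t <= 1 - t^2, so the squared chord 2 - 2t
  is at most 2 epsilon^2. The factor sqrt 2 is rounded up to 2.\<close>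

lemma component_close:
  assumes n: "dot4 e e = 1" "dot4 r r = 1" and t: "0 \<le> dot4 e r" "1 - (dot4 e r)\<^sup>2 \<le> \<epsilon>\<^sup>2" and \<epsilon>: "0 \<le> \<epsilon>" and k: "k < 4"
  shows "\<bar>r k - e k\<bar> \<le> 2 * \<epsilon>"
proof -
  define t where "t = dot4 e r"
  have "t\<^sup>2 \<le> 1" using dot4_Cauchy_Schwarz[of e r] n by (simp add: t_def)
  then have t1: "t \<le> 1" by (simp add: abs_square_le_1 abs_le_iff)
  have "(1 - t) * 1 \<le> (1 - t) * (1 + t)" using t1 t(1) by (intro mult_left_mono) (auto simp: t_def)
  also have "\<dots> = 1 - t\<^sup>2" by (simp add: power2_eq_square algebra_simps)
  finally have "1 - t \<le> \<epsilon>\<^sup>2" using t(2) by (simp add: t_def)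
  moreover have "(r k - e k)\<^sup>2 \<le> (\<Sum>i<4. (r i - e i)\<^sup>2)" using k by (intro member_le_sum) auto
  moreover have "(\<Sum>i<4. (r i - e i)\<^sup>2) = 2 - 2 * t"
    using n unfolding t_def dot4_def sum_lessThan_4 by (simp add: power2_eq_square algebra_simps)
  ultimately have "(r k - e k)\<^sup>2 \<le> 2 * \<epsilon>\<^sup>2" by linarith
  also have "\<dots> \<le> (2 * \<epsilon>)\<^sup>2" by (simp add: power_mult_distrib)
  finally have "\<bar>r k - e k\<bar> \<le> \<bar>2 * \<epsilon>\<bar>" by (simp only: abs_le_square_iff)
  then show ?thesis using \<epsilon> by simp
qed

text \<open>The vector e^(j) of the theorem with \<delta> = c epsilon, in the same syntactic form so
  that the hypothesis can be folded into it.\<close>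

definition tilt :: "real \<Rightarrow> nat \<Rightarrow> nat \<Rightarrow> real" where
  "tilt \<delta> j k = (if k = 0 then sqrt (1 - \<delta>\<^sup>2) else \<delta> * frame j (k - 1))"

lemma tilt_unit:
  assumes "\<delta>\<^sup>2 < 1" "j \<in> {1..9}"
  shows "dot4 (tilt \<delta> j) (tilt \<delta> j) = 1" "tilt \<delta> j 0 > 0" "(tilt \<delta> j 0)\<^sup>2 + \<delta>\<^sup>2 = 1"
proof -
  show "tilt \<delta> j 0 > 0" "(tilt \<delta> j 0)\<^sup>2 + \<delta>\<^sup>2 = 1" using assms(1) by (simp_all add: tilt_def)
  have t: "tilt \<delta> j 1 = \<delta> * frame j 0" "tilt \<delta> j 2 = \<delta> * frame j 1" "tilt \<delta> j 3 = \<delta> * frame j 2" by (simp_all add: tilt_def)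
  have "dot4 (tilt \<delta> j) (tilt \<delta> j) = (tilt \<delta> j 0)\<^sup>2 + \<delta>\<^sup>2 * ((frame j 0)\<^sup>2 + (frame j 1)\<^sup>2 + (frame j 2)\<^sup>2)"
    unfolding dot4_def t by (simp add: power2_eq_square algebra_simps)
  then show "dot4 (tilt \<delta> j) (tilt \<delta> j) = 1" unfolding frame_unit[OF assms(2)] using \<open>(tilt \<delta> j 0)\<^sup>2 + \<delta>\<^sup>2 = 1\<close> by simp
qed

text \<open>Divided by \<delta>, the imaginary parts lie near the frame. The cancellation is
  homogeneous and survives scaling back by \<delta> or \<delta>^2. Unit length gives the moment
  matrix trace 1, which fixes its remaining entry as 1 - 3q.\<close>

lemma balanced_moments:
  fixes r :: "nat \<Rightarrow> nat \<Rightarrow> real"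
  assumes \<delta>: "\<delta> > 0" and n: "\<And>j. j \<in> {1..9} \<Longrightarrow> dot4 (r j) (r j) = 1"
    and r0: "\<And>j. j \<in> {1..9} \<Longrightarrow> \<bar>r j 0 - 1\<bar> \<le> 1/5000"
    and r: "\<And>j k. j \<in> {1..9} \<Longrightarrow> k < 3 \<Longrightarrow> \<bar>r j (k + 1) - \<delta> * frame j k\<bar> \<le> \<delta> / 5000"
  shows "\<exists>p q. prob9 p \<and> 0 \<le> q \<and> moment p r 0 0 = 1 - 3 * q \<and> moment p r 1 1 = q \<and> moment p r 2 2 = q \<and> moment p r 3 3 = q
    \<and> moment p r 0 1 = 0 \<and> moment p r 0 2 = 0 \<and> moment p r 0 3 = 0 \<and> moment p r 1 2 = 0 \<and> moment p r 1 3 = 0 \<and> moment p r 2 3 = 0"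
proof -
  define u where "u j k = r j (k + 1) / \<delta>" for j k
  have u: "\<bar>u j k - frame j k\<bar> \<le> 1/5000" if "j \<in> {1..9}" "k < 3" for j k
  proof -
    have "u j k - frame j k = (r j (k + 1) - \<delta> * frame j k) / \<delta>" using \<delta> by (simp add: u_def field_simps)
    then have "\<bar>u j k - frame j k\<bar> = \<bar>r j (k + 1) - \<delta> * frame j k\<bar> / \<delta>" using \<delta> by (simp only: abs_divide abs_of_pos)
    also have "\<dots> \<le> (\<delta> / 5000) / \<delta>" using r[OF that] \<delta> by (intro divide_right_mono) auto
    finally show ?thesis using \<delta> by simp
  qed
  from balanced_weights[of "\<lambda>j. r j 0" u, OF r0 u] obtain p where p: "\<forall>j\<in>{1..9}. 0 \<le> p j" "sum p {1..9} = 1"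
    and z: "(\<Sum>j\<in>{1..9}. p j *\<^sub>R harmonic8 (r j 0) (u j 0) (u j 1) (u j 2)) = 0" by blast
  have z': "(\<Sum>j\<in>{1..9}. p j * (r j 0 * u j 0)) = 0" "(\<Sum>j\<in>{1..9}. p j * (r j 0 * u j 1)) = 0" "(\<Sum>j\<in>{1..9}. p j * (r j 0 * u j 2)) = 0"
    "(\<Sum>j\<in>{1..9}. p j * (u j 0 * u j 1)) = 0" "(\<Sum>j\<in>{1..9}. p j * (u j 1 * u j 2)) = 0" "(\<Sum>j\<in>{1..9}. p j * (u j 2 * u j 0)) = 0"
    "(\<Sum>j\<in>{1..9}. p j * ((u j 0)\<^sup>2 - (u j 1)\<^sup>2)) = 0" "(\<Sum>j\<in>{1..9}. p j * ((u j 1)\<^sup>2 - (u j 2)\<^sup>2)) = 0"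
    using z by (simp_all add: harmonic8_def prod_eq_iff fst_sum snd_sum del: One_nat_def)
  have ru: "r j 1 = \<delta> * u j 0" "r j 2 = \<delta> * u j 1" "r j 3 = \<delta> * u j 2" for j
    using \<delta> by (simp_all add: u_def numeral_3_eq_3 numeral_2_eq_2)
  define m where "m = moment p r"
  have scale: "(\<Sum>j\<in>{1..9}. p j * g j) = c * (\<Sum>j\<in>{1..9}. p j * f j)" if "\<And>j. g j = c * f j" for f g :: "nat \<Rightarrow> real" and c
    unfolding sum_distrib_left using that by (intro sum.cong refl) simp
  \<comment> \<open>The right sides are left unsimplified so that the vanishing sums of
    \<open>z'\<close> can be substituted for the 0.\<close>
  have m0: "m 0 1 = \<delta> * 0" "m 0 2 = \<delta> * 0" "m 0 3 = \<delta> * 0"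
    unfolding m_def moment_def ru by (subst z'[symmetric], rule scale, simp)+
  have mo: "m 1 2 = \<delta>\<^sup>2 * 0" "m 2 3 = \<delta>\<^sup>2 * 0" "m 1 3 = \<delta>\<^sup>2 * 0"
    unfolding m_def moment_def ru by (subst z'(4)[symmetric], rule scale, simp add: power2_eq_square)
      (subst z'(5)[symmetric], rule scale, simp add: power2_eq_square,
       subst z'(6)[symmetric], rule scale, simp add: power2_eq_square)
  have "m 1 1 - m 2 2 = \<delta>\<^sup>2 * 0"
    unfolding m_def moment_def ru sum_subtractf[symmetric] right_diff_distrib[symmetric]
    by (subst z'(7)[symmetric], rule scale) (simp add: power2_eq_square algebra_simps)
  moreover have "m 2 2 - m 3 3 = \<delta>\<^sup>2 * 0"
    unfolding m_def moment_def ru sum_subtractf[symmetric] right_diff_distrib[symmetric]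
    by (subst z'(8)[symmetric], rule scale) (simp add: power2_eq_square algebra_simps)
  moreover have "m 0 0 + m 1 1 + m 2 2 + m 3 3 = 1"
  proof -
    have "m 0 0 + m 1 1 + m 2 2 + m 3 3 = (\<Sum>j\<in>{1..9}. p j * dot4 (r j) (r j))"
      unfolding m_def moment_def dot4_def distrib_left sum.distrib ..
    also have "\<dots> = (\<Sum>j\<in>{1..9}. p j)" using n by (intro sum.cong) auto
    finally show ?thesis using p(2) by simp
  qed
  moreover have "0 \<le> m 1 1" unfolding m_def moment_def using p(1) by (auto intro!: sum_nonneg mult_nonneg_nonneg simp flip: power2_eq_square)
  ultimately have "prob9 p \<and> 0 \<le> m 1 1 \<and> m 0 0 = 1 - 3 * m 1 1 \<and> m 1 1 = m 1 1 \<and> m 2 2 = m 1 1 \<and> m 3 3 = m 1 1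
    \<and> m 0 1 = 0 \<and> m 0 2 = 0 \<and> m 0 3 = 0 \<and> m 1 2 = 0 \<and> m 1 3 = 0 \<and> m 2 3 = 0"
    using p m0 mo by (simp add: prob9_def)
  then show ?thesis unfolding m_def by blast
qed

lemma convex_average_bounds:
  fixes x :: "nat \<Rightarrow> real"
  assumes p: "prob9 p" and x: "\<And>j. j \<in> {1..9} \<Longrightarrow> a \<le> x j \<and> x j \<le> b"
  shows "a \<le> (\<Sum>j\<in>{1..9}. p j * x j)" "(\<Sum>j\<in>{1..9}. p j * x j) \<le> b"
proof -
  have s: "(\<Sum>j\<in>{1..9}. p j * y) = y" for y using p by (simp add: prob9_def flip: sum_distrib_right)
  have p0: "0 \<le> p j" if "j \<in> {1..9}" for j using p that by (simp add: prob9_def)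
  have "(\<Sum>j\<in>{1..9}. p j * a) \<le> (\<Sum>j\<in>{1..9}. p j * x j)" by (intro sum_mono mult_left_mono p0) (use x in auto)
  then show "a \<le> (\<Sum>j\<in>{1..9}. p j * x j)" unfolding s .
  have "(\<Sum>j\<in>{1..9}. p j * x j) \<le> (\<Sum>j\<in>{1..9}. p j * b)" by (intro sum_mono mult_left_mono p0) (use x in auto)
  then show "(\<Sum>j\<in>{1..9}. p j * x j) \<le> b" unfolding s .
qed

lemma mixing_bounds:
  fixes \<epsilon> :: real
  assumes V: "unitary2 V" and \<epsilon>: "0 < \<epsilon>" "\<epsilon> \<le> 1/10^8"
    and Uh: "\<forall>j\<in>{1..9}. unitary2 (Uh j) \<and>
       (1/2) \<cdot>\<^sub>m magic (choi (unitary_channel (Uh j) \<circ> unitary_channel (adj V)))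
         = mat 4 4 (\<lambda>(a,b). complex_of_real (tilt (10000 * \<epsilon>) j a * tilt (10000 * \<epsilon>) j b))"
    and U: "\<forall>j\<in>{1..9}. unitary2 (U j) \<and>
       (1/2) * diamond_norm (map_diff (unitary_channel (Uh j)) (unitary_channel (U j))) \<le> \<epsilon>"
  shows "\<exists>p. prob9 p \<and> depolarizing (mix9 p (\<lambda>j. unitary_channel (U j)) \<circ> unitary_channel (adj V))"
    and "\<And>p. prob9 p \<Longrightarrow> depolarizing (mix9 p (\<lambda>j. unitary_channel (U j)) \<circ> unitary_channel (adj V)) \<Longrightarrow>
      ((10000 - 1) * \<epsilon>)\<^sup>2 \<le> (1/2) * diamond_norm (map_diff (unitary_channel V) (mix9 p (\<lambda>j. unitary_channel (U j)))) \<and>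
      (1/2) * diamond_norm (map_diff (unitary_channel V) (mix9 p (\<lambda>j. unitary_channel (U j)))) \<le> ((10000 + 1) * \<epsilon>)\<^sup>2"
proof -
  \<comment> \<open>Components move by at most 2 epsilon, which for this factor is \<delta> / 5000,
    the tolerance of \<open>balanced_weights\<close>.\<close>
  define \<delta> where "\<delta> = 10000 * \<epsilon>"
  have d0: "0 < \<delta>" and d1: "\<delta> \<le> 1/10^4" using \<epsilon> by (simp_all add: \<delta>_def)
  have d2: "\<delta>\<^sup>2 \<le> 1/10^8" using power_mono[OF d1, of 2] d0 by (simp add: power_divide)
  then have d2': "\<delta>\<^sup>2 < 1" by simp
  note T = tilt_unit[OF d2']
  have "\<exists>w r. cmod w = 1 \<and> dot4 r r = 1 \<and> U j * adj V = w \<cdot>\<^sub>m quat r \<and> 0 \<le> dot4 (tilt \<delta> j) r \<and> 1 - (dot4 (tilt \<delta> j) r)\<^sup>2 \<le> \<epsilon>\<^sup>2"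
    if j: "j \<in> {1..9}" for j
    using Uh U j by (intro relative_rotation[OF V _ _ T(1)[OF j] T(2)[OF j], of "Uh j"]) (auto simp: \<delta>_def)
  then obtain w r where wr: "\<And>j. j \<in> {1..9} \<Longrightarrow> cmod (w j) = 1 \<and> dot4 (r j) (r j) = 1 \<and> U j * adj V = w j \<cdot>\<^sub>m quat (r j) \<and>
      0 \<le> dot4 (tilt \<delta> j) (r j) \<and> 1 - (dot4 (tilt \<delta> j) (r j))\<^sup>2 \<le> \<epsilon>\<^sup>2" by metis
  have Uu: "\<forall>j\<in>{1..9}. unitary2 (U j)" using U by blast
  have W: "\<forall>j\<in>{1..9}. cmod (w j) = 1 \<and> U j * adj V = w j \<cdot>\<^sub>m quat (r j)" using wr by blast
  have close: "\<bar>r j k - tilt \<delta> j k\<bar> \<le> 2 * \<epsilon>" if "j \<in> {1..9}" "k < 4" for j k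
    using wr[OF that(1)] \<epsilon>(1) T(1)[OF that(1)] that(2) by (intro component_close) auto
  \<comment> \<open>A number in [0,1] lies below its square root, so the tilted real part is at
    least 1 - \<delta>^2. Both \<delta>^2 and 2 epsilon are far below 1/5000.\<close>
  have r0: "\<bar>r j 0 - 1\<bar> \<le> 1/5000" if j: "j \<in> {1..9}" for j
  proof -
    have "(1 - \<delta>\<^sup>2)\<^sup>2 \<le> 1 - \<delta>\<^sup>2" using d2' by (simp add: power2_eq_square[of "1 - \<delta>\<^sup>2"] mult_left_le)
    then have "1 - \<delta>\<^sup>2 \<le> tilt \<delta> j 0" by (simp add: tilt_def real_le_rsqrt)
    moreover have "tilt \<delta> j 0 \<le> 1" by (simp add: tilt_def)
    moreover have "\<bar>r j 0 - tilt \<delta> j 0\<bar> \<le> 2 * \<epsilon>" using close[OF j, of 0] by simp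
    moreover have "\<delta>\<^sup>2 \<le> 1/100000000" "\<epsilon> \<le> 1/100000000" using d2 \<epsilon>(2) by simp_all
    ultimately show ?thesis by linarith
  qed
  have rk: "\<bar>r j (k + 1) - \<delta> * frame j k\<bar> \<le> \<delta> / 5000" if "j \<in> {1..9}" "k < 3" for j k
    using close[OF that(1), of "k + 1"] that(2) by (simp add: tilt_def \<delta>_def)
  have n1: "dot4 (r j) (r j) = 1" if "j \<in> {1..9}" for j using wr[OF that] by blast
  from balanced_moments[of \<delta> r, OF d0 n1 r0 rk] obtain p q where "prob9 p" "0 \<le> q"
    "moment p r 0 0 = 1 - 3 * q" "moment p r 1 1 = q" "moment p r 2 2 = q" "moment p r 3 3 = q"
    "moment p r 0 1 = 0" "moment p r 0 2 = 0" "moment p r 0 3 = 0" "moment p r 1 2 = 0" "moment p r 1 3 = 0" "moment p r 2 3 = 0"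
    by blast
  then show "\<exists>p. prob9 p \<and> depolarizing (mix9 p (\<lambda>j. unitary_channel (U j)) \<circ> unitary_channel (adj V))"
    using mix9_depolarizingI[OF V Uu W] by blast
  fix p assume p: "prob9 p" and dep: "depolarizing (mix9 p (\<lambda>j. unitary_channel (U j)) \<circ> unitary_channel (adj V))"
  let ?D = "(1/2) * diamond_norm (map_diff (unitary_channel V) (mix9 p (\<lambda>j. unitary_channel (U j))))"
  from dep obtain q where q: "0 \<le> q" and E: "\<And>\<rho>. \<rho> \<in> carrier_mat 2 2 \<Longrightarrow>
      (mix9 p (\<lambda>j. unitary_channel (U j)) \<circ> unitary_channel (adj V)) \<rho> = complex_of_real (1 - 3*q) \<cdot>\<^sub>m \<rho> + complex_of_real q \<cdot>\<^sub>m
        (pauliX * \<rho> * pauliX + pauliY * \<rho> * pauliY + pauliZ * \<rho> * pauliZ)"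
    unfolding depolarizing_def by blast
  have "?D = 3 * q" using diamond_norm_depolarizing[OF V q E] by simp
  also have "\<dots> = 1 - moment p r 0 0" using depolarizing_mix9_moment[OF V Uu W E] by simp
  also have "\<dots> = (\<Sum>j\<in>{1..9}. p j * (1 - (r j 0)\<^sup>2))"
    using p by (simp add: moment_def prob9_def right_diff_distrib sum_subtractf power2_eq_square)
  finally have D: "?D = (\<Sum>j\<in>{1..9}. p j * (1 - (r j 0)\<^sup>2))" .
  \<comment> \<open>Both bounds hold for each of the nine channels separately, and a weighted
    average inherits them.\<close>
  have "(\<delta> - \<epsilon>)\<^sup>2 \<le> 1 - (r j 0)\<^sup>2 \<and> 1 - (r j 0)\<^sup>2 \<le> (\<delta> + \<epsilon>)\<^sup>2" if j: "j \<in> {1..9}" for j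
  proof -
    note n = T(1)[OF j] and R = wr[OF j]
    have "(dot4 (tilt \<delta> j) (r j))\<^sup>2 \<le> 1" using dot4_Cauchy_Schwarz[of "tilt \<delta> j" "r j"] n R by simp
    then have t1: "dot4 (tilt \<delta> j) (r j) \<le> 1" by (simp add: abs_square_le_1 abs_le_iff)
    have e: "0 \<le> \<epsilon>" "\<epsilon> \<le> \<delta>" "\<delta> \<le> 1/4" using \<epsilon> d1 by (simp_all add: \<delta>_def)
    have x: "(r j 0 - tilt \<delta> j 0 * dot4 (tilt \<delta> j) (r j))\<^sup>2 \<le> \<delta>\<^sup>2 * (1 - (dot4 (tilt \<delta> j) (r j))\<^sup>2)"
      using first_component_bound[OF n _ T(3)[OF j]] R by blast
    show ?thesis using sine_triangle[OF T(3)[OF j] T(2)[OF j] e _ t1 _ x] R by blast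
  qed
  from convex_average_bounds[OF p this]
  have "(\<delta> - \<epsilon>)\<^sup>2 \<le> ?D" "?D \<le> (\<delta> + \<epsilon>)\<^sup>2" unfolding D by simp_all
  moreover have "\<delta> - \<epsilon> = (10000 - 1) * \<epsilon>" "\<delta> + \<epsilon> = (10000 + 1) * \<epsilon>" by (simp_all add: \<delta>_def)
  ultimately show "((10000 - 1) * \<epsilon>)\<^sup>2 \<le> ?D \<and> ?D \<le> ((10000 + 1) * \<epsilon>)\<^sup>2" by simp
qed

theorem theoremS2:
  shows "\<exists>(c::real) (\<epsilon>0::real) (v::nat \<Rightarrow> nat \<Rightarrow> real).
    c > 0 \<and> \<epsilon>0 > 0 \<and> (\<forall>j\<in>{1..9}. (\<Sum>k<3. (v j k)\<^sup>2) = 1) \<and>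
    (\<forall>Uhat \<epsilon> (Uh::nat \<Rightarrow> complex mat) (U::nat \<Rightarrow> complex mat).
      unitary2 Uhat \<longrightarrow> 0 < \<epsilon> \<longrightarrow> \<epsilon> \<le> \<epsilon>0 \<longrightarrow>
      (\<forall>j\<in>{1..9}. unitary2 (Uh j) \<and>
         (let e = (\<lambda>k::nat. if k = 0 then sqrt (1 - (c*\<epsilon>)\<^sup>2) else c*\<epsilon>*v j (k - 1)) in
          (1/2) \<cdot>\<^sub>m magic (choi (unitary_channel (Uh j) \<circ> unitary_channel (adj Uhat)))
            = mat 4 4 (\<lambda>(a,b). complex_of_real (e a * e b)))) \<longrightarrow>
      (\<forall>j\<in>{1..9}. unitary2 (U j) \<and>
         (1/2) * diamond_norm (map_diff (unitary_channel (Uh j)) (unitary_channel (U j))) \<le> \<epsilon>) \<longrightarrow>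
      (let S = {p. prob9 p \<and> depolarizing (mix9 p (\<lambda>j. unitary_channel (U j)) \<circ> unitary_channel (adj Uhat))};
           f = (\<lambda>p. (1/2) * diamond_norm (map_diff (unitary_channel Uhat) (mix9 p (\<lambda>j. unitary_channel (U j)))))
       in S \<noteq> {} \<and>
          (\<forall>p\<in>S. (\<forall>p'\<in>S. f p \<le> f p') \<longrightarrow> ((c - 1)*\<epsilon>)\<^sup>2 \<le> f p \<and> f p \<le> ((c + 1)*\<epsilon>)\<^sup>2)))"
proof (rule exI[of _ "10000 :: real"], rule exI[of _ "1/10^8 :: real"], rule exI[of _ frame], intro conjI allI impI ballI)
  fix j :: nat assume "j \<in> {1..9}"
  then show "(\<Sum>k<3. (frame j k)\<^sup>2) = 1" using frame_unit by (simp add: numeral_3_eq_3 numeral_2_eq_2)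
next
  fix Uhat :: "complex mat" and \<epsilon> :: real and Uh U :: "nat \<Rightarrow> complex mat"
  assume V: "unitary2 Uhat" and \<epsilon>: "0 < \<epsilon>" "\<epsilon> \<le> 1/10^8"
    and Uh: "\<forall>j\<in>{1..9}. unitary2 (Uh j) \<and>
         (let e = (\<lambda>k::nat. if k = 0 then sqrt (1 - (10000*\<epsilon>)\<^sup>2) else 10000*\<epsilon>*frame j (k - 1)) in
          (1/2) \<cdot>\<^sub>m magic (choi (unitary_channel (Uh j) \<circ> unitary_channel (adj Uhat)))
            = mat 4 4 (\<lambda>(a,b). complex_of_real (e a * e b)))"
    and U: "\<forall>j\<in>{1..9}. unitary2 (U j) \<and>
         (1/2) * diamond_norm (map_diff (unitary_channel (Uh j)) (unitary_channel (U j))) \<le> \<epsilon>"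
  note B = mixing_bounds[OF V \<epsilon> Uh[unfolded Let_def, folded tilt_def] U]
  show "let S = {p. prob9 p \<and> depolarizing (mix9 p (\<lambda>j. unitary_channel (U j)) \<circ> unitary_channel (adj Uhat))};
           f = (\<lambda>p. (1/2) * diamond_norm (map_diff (unitary_channel Uhat) (mix9 p (\<lambda>j. unitary_channel (U j)))))
       in S \<noteq> {} \<and>
          (\<forall>p\<in>S. (\<forall>p'\<in>S. f p \<le> f p') \<longrightarrow> ((10000 - 1)*\<epsilon>)\<^sup>2 \<le> f p \<and> f p \<le> ((10000 + 1)*\<epsilon>)\<^sup>2)"
    unfolding Let_def using B by blast
qed simp_all

end
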